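(* Let $P\equiv(P,G,B,\pi)$ and $Q\equiv(Q,H,B,\pi')$ be smooth (Banach) principal bundles over the same base $B$, and let $(f,\varphi,\mathrm{id}_B)$ be a principal bundle morphism of $P$ into $Q$. Then for every connection $\omega$ on $P$ there exists a unique connection $\theta$ on $Q$ which is $(f,\varphi,\mathrm{id}_B)$-related with $\omega$.
   Context: All manifolds and bundles are modelled on Banach spaces and are smooth ($C^\infty$); Lie groups are Banach–Lie groups. In a principal bundle $(P,G,B,\pi)$ the structure group $G$ acts on the total space $P$ on the right; $R_g\colon P\to P$, $R_g(p)=pg$. $\mathfrak{g}=T_eG$ and $\mathfrak{h}=T_eH$ are the Lie algebras of $G$ and $H$. A principal bundle morphism $(f,\varphi,\mathrm{id}_B)\colon (P,G,B,\pi)\to(Q,H,B,\pi')$ consists of a smooth map $f\colon P\to Q$ and a morphism of (Banach–)Lie groups $\varphi\colon G\to H$ with $\pi'\circ f=\pi$ and $f(pg)=f(p)\varphi(g)$ for all $p\in P$, $g\in G$. $\overline{\varphi}=T_e\varphi\colon\mathfrak{g}\to\mathfrak{h}$ is the induced Lie algebra morphism. A connection on $P$ is (equivalently) given by a connection form: a smooth $\mathfrak{g}$-valued 1-form $\omega$ on $P$ with $\omega(X^* )=X$ for all $X\in\mathfrak{g}$, where $X^*$ is the fundamental vector field, $X^*_p=T_e(g\mapsto pg)(X)$, and $R_g^*\omega=\mathrm{Ad}(g^{-1}).\omega$ for all $g\in G$. Connections $\omega$ on $P$ and $\theta$ on $Q$ are $(f,\varphi,\mathrm{id}_B)$-related if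 $f^*\theta=\overline{\varphi}\omega$, i.e. $\theta_{f(p)}(T_pf(u))=\overline{\varphi}(\omega_p(u))$ for all $p\in P$, $u\in T_pP$. *)

theory Defs
  imports "HOL-Analysis.Analysis" "HOL-Algebra.Group"
begin

subsection \<open>Smooth maps between Banach spaces\<close>

text \<open>
  The iterated Frechet derivative of order \<open>k\<close> takes values in
  \<open>L(E, L(E, \<dots>, L(E, F)))\<close>, a type that depends on \<open>k\<close>. As usual it is identified with the
  isometric space of bounded \<open>k\<close>-linear maps, whose elements are given here as functions on
  lists of length \<open>k\<close>; their values on lists of other lengths are irrelevant.
\<close>

definition bounded_multilinear ::
    "nat \<Rightarrow> ('e::real_normed_vector list \<Rightarrow> 'f::real_normed_vector) \<Rightarrow> bool" where
  "bounded_multilinear k T \<longleftrightarrow>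
     (\<forall>vs i. length vs = k \<longrightarrow> i < k \<longrightarrow> linear (\<lambda>v. T (vs[i := v]))) \<and>
     (\<exists>K. \<forall>vs. length vs = k \<longrightarrow> norm (T vs) \<le> K * (\<Prod>v\<leftarrow>vs. norm v))"

text \<open>
  \<open>D k\<close> is the derivative of order \<open>k\<close>: it is Frechet differentiable, with respect to the operator
  norm on bounded \<open>k\<close>-linear maps, with derivative \<open>h \<mapsto> D (Suc k) x (h, \<dots>)\<close>.
  Only used for open \<open>S\<close>.
\<close>

definition smooth_on ::
    "'e::real_normed_vector set \<Rightarrow> ('e \<Rightarrow> 'f::real_normed_vector) \<Rightarrow> bool" where
  "smooth_on S f \<longleftrightarrow>
     (\<exists>D :: nat \<Rightarrow> 'e \<Rightarrow> 'e list \<Rightarrow> 'f.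
        (\<forall>x\<in>S. D 0 x [] = f x) \<and>
        (\<forall>k. \<forall>x\<in>S. bounded_multilinear k (D k x) \<and>
           (\<forall>\<epsilon>>0. \<exists>\<delta>>0. \<forall>y\<in>S. norm (y - x) < \<delta> \<longrightarrow>
              (\<forall>vs. length vs = k \<longrightarrow>
                 norm (D k y vs - D k x vs - D (Suc k) x ((y - x) # vs))
                   \<le> \<epsilon> * norm (y - x) * (\<Prod>v\<leftarrow>vs. norm v)))))"


subsection \<open>Banach manifolds\<close>

text \<open>
  A chart is a pair of a domain and a coordinate map (only its values on the domain matter). As in
  Lang's book, a manifold is a set with an atlas, the topology being the one induced by the atlas;
  no separation axiom is imposed.
\<close>

type_synonym ('a, 'e) chart = "'a set \<times> ('a \<Rightarrow> 'e)"
type_synonym ('a, 'e) atlas = "('a, 'e) chart set"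

definition points :: "('a, 'e) atlas \<Rightarrow> 'a set" where
  "points M = (\<Union>c\<in>M. fst c)"

definition charts_at :: "('a, 'e) atlas \<Rightarrow> 'a \<Rightarrow> ('a, 'e) chart set" where
  "charts_at M x = {c \<in> M. x \<in> fst c}"

definition chart_inv :: "('a, 'e) chart \<Rightarrow> 'e \<Rightarrow> 'a" where
  "chart_inv c = inv_into (fst c) (snd c)"

definition coord_rep :: "('a, 'e) chart \<Rightarrow> ('b, 'f) chart \<Rightarrow> ('a \<Rightarrow> 'b) \<Rightarrow> 'e \<Rightarrow> 'f" where
  "coord_rep c d f = snd d \<circ> f \<circ> chart_inv c"

definition banach_manifold :: "('a, 'e::banach) atlas \<Rightarrow> bool" where
  "banach_manifold M \<longleftrightarrow>
     (\<forall>c\<in>M. inj_on (snd c) (fst c) \<and> open (snd c ` fst c)) \<and>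
     (\<forall>c\<in>M. \<forall>d\<in>M. open (snd c ` (fst c \<inter> fst d)) \<and>
        smooth_on (snd c ` (fst c \<inter> fst d)) (coord_rep c d (\<lambda>x. x)))"

definition open_in_manifold :: "('a, 'e::banach) atlas \<Rightarrow> 'a set \<Rightarrow> bool" where
  "open_in_manifold M W \<longleftrightarrow> W \<subseteq> points M \<and> (\<forall>c\<in>M. open (snd c ` (fst c \<inter> W)))"

definition restrict_atlas :: "('a, 'e) atlas \<Rightarrow> 'a set \<Rightarrow> ('a, 'e) atlas" where
  "restrict_atlas M W = (\<lambda>c. (fst c \<inter> W, snd c)) ` M"

definition prod_atlas :: "('a, 'e) atlas \<Rightarrow> ('b, 'f) atlas \<Rightarrow> ('a \<times> 'b, 'e \<times> 'f) atlas" where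
  "prod_atlas M N = (\<lambda>(c, d). (fst c \<times> fst d, map_prod (snd c) (snd d))) ` (M \<times> N)"

text \<open>The openness condition expresses continuity of \<open>f\<close>.\<close>

definition smooth_map ::
    "('a, 'e::banach) atlas \<Rightarrow> ('b, 'f::banach) atlas \<Rightarrow> ('a \<Rightarrow> 'b) \<Rightarrow> bool" where
  "smooth_map M N f \<longleftrightarrow>
     f \<in> points M \<rightarrow> points N \<and>
     (\<forall>c\<in>M. \<forall>d\<in>N.
        open (snd c ` {x \<in> fst c. f x \<in> fst d}) \<and>
        smooth_on (snd c ` {x \<in> fst c. f x \<in> fst d}) (coord_rep c d f))"

definition diffeomorphism ::
    "('a, 'e::banach) atlas \<Rightarrow> ('b, 'f::banach) atlas \<Rightarrow> ('a \<Rightarrow> 'b) \<Rightarrow> bool" where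
  "diffeomorphism M N f \<longleftrightarrow>
     smooth_map M N f \<and>
     (\<exists>g. smooth_map N M g \<and> (\<forall>x\<in>points M. g (f x) = x) \<and> (\<forall>y\<in>points N. f (g y) = y))"


subsection \<open>Tangent vectors\<close>

text \<open>
  A tangent vector at \<open>x\<close> is an equivalence class of pairs \<open>(c, v)\<close> of a chart \<open>c\<close> at \<open>x\<close> and a vector
  \<open>v\<close> of the model space. Such a class contains exactly one pair for every chart at \<open>x\<close>, so it is
  the graph of a function from the charts at \<open>x\<close> to the model space; this function, extended by \<open>0\<close>
  to all other charts, represents the tangent vector. The vector space operations are pointwise.
\<close>

type_synonym ('a, 'e) tangent_vector = "('a, 'e) chart \<Rightarrow> 'e"

definition tangent_space ::
    "('a, 'e::banach) atlas \<Rightarrow> 'a \<Rightarrow> ('a, 'e) tangent_vector set" where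
  "tangent_space M x =
     {u. (\<forall>c\<in>charts_at M x. \<forall>d\<in>charts_at M x.
            u d = frechet_derivative (coord_rep c d (\<lambda>y. y)) (at (snd c x)) (u c)) \<and>
         (\<forall>c. c \<notin> charts_at M x \<longrightarrow> u c = 0)}"

text \<open>\<open>tangent_map M N f x\<close> is \<open>T\<^sub>x f\<close>; the result does not depend on the chosen chart \<open>c\<close>.\<close>

definition tangent_map ::
    "('a, 'e::banach) atlas \<Rightarrow> ('b, 'f::banach) atlas \<Rightarrow> ('a \<Rightarrow> 'b) \<Rightarrow> 'a \<Rightarrow>
     ('a, 'e) tangent_vector \<Rightarrow> ('b, 'f) tangent_vector" where
  "tangent_map M N f x u =
     (let c = (SOME c. c \<in> charts_at M x)
      in (\<lambda>d. if d \<in> charts_at N (f x)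
               then frechet_derivative (coord_rep c d f) (at (snd c x)) (u c) else 0))"


subsection \<open>Banach-Lie groups\<close>

record ('g, 'e) lie_group = "'g monoid" +
  atlas :: "('g, 'e) atlas"

definition banach_lie_group :: "('g, 'e::banach) lie_group \<Rightarrow> bool" where
  "banach_lie_group G \<longleftrightarrow>
     group G \<and> banach_manifold (atlas G) \<and> points (atlas G) = carrier G \<and>
     smooth_map (prod_atlas (atlas G) (atlas G)) (atlas G) (\<lambda>(g, h). g \<otimes>\<^bsub>G\<^esub> h) \<and>
     smooth_map (atlas G) (atlas G) (\<lambda>g. inv\<^bsub>G\<^esub> g)"

definition lie_group_hom ::
    "('g, 'e::banach) lie_group \<Rightarrow> ('h, 'f::banach) lie_group \<Rightarrow> ('g \<Rightarrow> 'h) \<Rightarrow> bool" where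
  "lie_group_hom G H \<phi> \<longleftrightarrow> \<phi> \<in> hom G H \<and> smooth_map (atlas G) (atlas H) \<phi>"

definition lie_algebra :: "('g, 'e::banach) lie_group \<Rightarrow> ('g, 'e) tangent_vector set" where
  "lie_algebra G = tangent_space (atlas G) \<one>\<^bsub>G\<^esub>"

definition lie_algebra_map ::
    "('g, 'e::banach) lie_group \<Rightarrow> ('h, 'f::banach) lie_group \<Rightarrow> ('g \<Rightarrow> 'h) \<Rightarrow>
     ('g, 'e) tangent_vector \<Rightarrow> ('h, 'f) tangent_vector" where
  "lie_algebra_map G H \<phi> = tangent_map (atlas G) (atlas H) \<phi> \<one>\<^bsub>G\<^esub>"

definition Ad ::
    "('g, 'e::banach) lie_group \<Rightarrow> 'g \<Rightarrow> ('g, 'e) tangent_vector \<Rightarrow> ('g, 'e) tangent_vector" where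
  "Ad G g = lie_algebra_map G G (\<lambda>h. g \<otimes>\<^bsub>G\<^esub> h \<otimes>\<^bsub>G\<^esub> inv\<^bsub>G\<^esub> g)"


subsection \<open>Principal bundles\<close>

text \<open>
  \<open>act p g\<close> is \<open>p g\<close>. Equivariant local trivializations \<open>U \<times> G \<rightarrow> pr\<^sup>-\<^sup>1(U)\<close> force the action to be free
  and its orbits to be the fibres of \<open>pr\<close>, and \<open>pr\<close> to be a surjective submersion.
\<close>

definition principal_bundle ::
    "('p, 'ep::banach) atlas \<Rightarrow> ('g, 'eg::banach) lie_group \<Rightarrow> ('b, 'eb::banach) atlas \<Rightarrow>
     ('p \<Rightarrow> 'b) \<Rightarrow> ('p \<Rightarrow> 'g \<Rightarrow> 'p) \<Rightarrow> bool" where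
  "principal_bundle P G B pr act \<longleftrightarrow>
     banach_manifold P \<and> banach_lie_group G \<and> banach_manifold B \<and>
     smooth_map P B pr \<and>
     smooth_map (prod_atlas P (atlas G)) P (\<lambda>(p, g). act p g) \<and>
     (\<forall>p\<in>points P. act p \<one>\<^bsub>G\<^esub> = p) \<and>
     (\<forall>p\<in>points P. \<forall>g\<in>carrier G. \<forall>h\<in>carrier G. act (act p g) h = act p (g \<otimes>\<^bsub>G\<^esub> h)) \<and>
     (\<forall>b\<in>points B. \<exists>U \<Phi>.
        open_in_manifold B U \<and> b \<in> U \<and>
        diffeomorphism (prod_atlas (restrict_atlas B U) (atlas G))
          (restrict_atlas P {p \<in> points P. pr p \<in> U}) \<Phi> \<and>
        (\<forall>x\<in>U. \<forall>g\<in>carrier G. pr (\<Phi> (x, g)) = x) \<and>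
        (\<forall>x\<in>U. \<forall>g\<in>carrier G. \<forall>h\<in>carrier G. \<Phi> (x, g \<otimes>\<^bsub>G\<^esub> h) = act (\<Phi> (x, g)) h))"

text \<open>A morphism \<open>(f, \<phi>, id\<^sub>B)\<close> of bundles over the same base.\<close>

definition principal_bundle_morphism ::
    "('p, 'ep::banach) atlas \<Rightarrow> ('g, 'eg::banach) lie_group \<Rightarrow> ('p \<Rightarrow> 'b) \<Rightarrow> ('p \<Rightarrow> 'g \<Rightarrow> 'p) \<Rightarrow>
     ('q, 'eq::banach) atlas \<Rightarrow> ('h, 'eh::banach) lie_group \<Rightarrow> ('q \<Rightarrow> 'b) \<Rightarrow> ('q \<Rightarrow> 'h \<Rightarrow> 'q) \<Rightarrow>
     ('p \<Rightarrow> 'q) \<Rightarrow> ('g \<Rightarrow> 'h) \<Rightarrow> bool" where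
  "principal_bundle_morphism P G pr act Q H pr' act' f \<phi> \<longleftrightarrow>
     smooth_map P Q f \<and> lie_group_hom G H \<phi> \<and>
     (\<forall>p\<in>points P. pr' (f p) = pr p) \<and>
     (\<forall>p\<in>points P. \<forall>g\<in>carrier G. f (act p g) = act' (f p) (\<phi> g))"


subsection \<open>Connections\<close>

type_synonym ('p, 'ep, 'g, 'eg) lie_form =
  "'p \<Rightarrow> ('p, 'ep) tangent_vector \<Rightarrow> ('g, 'eg) tangent_vector"

text \<open>
  Smooth 1-forms on \<open>P\<close> with values in the Lie algebra of \<open>G\<close>. With respect to charts \<open>c\<close> of \<open>P\<close> and \<open>d\<close>
  of \<open>G\<close> at the unit, such a form is given by a smooth map \<open>A\<close> into the Banach space of bounded
  linear maps between the model spaces; in particular it is continuous linear on every tangent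
  space. The use of extensional function spaces determines the values at arguments
  outside of the tangent spaces, so that equality of forms is equality of functions.
\<close>

definition smooth_lie_form ::
    "('p, 'ep::banach) atlas \<Rightarrow> ('g, 'eg::banach) lie_group \<Rightarrow> ('p, 'ep, 'g, 'eg) lie_form \<Rightarrow> bool"
  where
  "smooth_lie_form P G \<omega> \<longleftrightarrow>
     \<omega> \<in> (\<Pi>\<^sub>E p\<in>points P. tangent_space P p \<rightarrow>\<^sub>E lie_algebra G) \<and>
     (\<forall>c\<in>P. \<forall>d\<in>charts_at (atlas G) \<one>\<^bsub>G\<^esub>.
        \<exists>A :: 'ep \<Rightarrow> 'ep \<Rightarrow>\<^sub>L 'eg. smooth_on (snd c ` fst c) A \<and>
          (\<forall>p\<in>fst c. \<forall>u\<in>tangent_space P p. \<omega> p u d = blinfun_apply (A (snd c p)) (u c)))"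

definition fundamental_vector_field ::
    "('p, 'ep::banach) atlas \<Rightarrow> ('g, 'eg::banach) lie_group \<Rightarrow> ('p \<Rightarrow> 'g \<Rightarrow> 'p) \<Rightarrow>
     ('g, 'eg) tangent_vector \<Rightarrow> 'p \<Rightarrow> ('p, 'ep) tangent_vector" where
  "fundamental_vector_field P G act X p = tangent_map (atlas G) P (\<lambda>g. act p g) \<one>\<^bsub>G\<^esub> X"

definition connection_form ::
    "('p, 'ep::banach) atlas \<Rightarrow> ('g, 'eg::banach) lie_group \<Rightarrow> ('p \<Rightarrow> 'g \<Rightarrow> 'p) \<Rightarrow>
     ('p, 'ep, 'g, 'eg) lie_form \<Rightarrow> bool" where
  "connection_form P G act \<omega> \<longleftrightarrow>
     smooth_lie_form P G \<omega> \<and>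
     (\<forall>X\<in>lie_algebra G. \<forall>p\<in>points P. \<omega> p (fundamental_vector_field P G act X p) = X) \<and>
     (\<forall>g\<in>carrier G. \<forall>p\<in>points P. \<forall>u\<in>tangent_space P p.
        \<omega> (act p g) (tangent_map P P (\<lambda>q. act q g) p u) = Ad G (inv\<^bsub>G\<^esub> g) (\<omega> p u))"

definition related_connections ::
    "('p, 'ep::banach) atlas \<Rightarrow> ('g, 'eg::banach) lie_group \<Rightarrow>
     ('q, 'eq::banach) atlas \<Rightarrow> ('h, 'eh::banach) lie_group \<Rightarrow>
     ('p \<Rightarrow> 'q) \<Rightarrow> ('g \<Rightarrow> 'h) \<Rightarrow>
     ('p, 'ep, 'g, 'eg) lie_form \<Rightarrow> ('q, 'eq, 'h, 'eh) lie_form \<Rightarrow> bool" where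
  "related_connections P G Q H f \<phi> \<omega> \<theta> \<longleftrightarrow>
     (\<forall>p\<in>points P. \<forall>u\<in>tangent_space P p.
        \<theta> (f p) (tangent_map P Q f p u) = lie_algebra_map G H \<phi> (\<omega> p u))"

end

theory Submission
  imports Defs
begin

text \<open>
  Over a small open set \<open>W\<close> of the base choose a section \<open>s\<close> of \<open>P\<close>. Then \<open>f \<circ> s\<close> is a section of
  \<open>Q\<close>, and there are unique smooth equivariant maps \<open>\<gamma>\<close> and \<open>\<tau>\<close> to the structure groups with
  \<open>p = s(x) \<gamma>(p)\<close> and \<open>q = f(s(x)) \<tau>(q)\<close> for \<open>p\<close> and \<open>q\<close> over \<open>x \<in> W\<close>; they satisfy
  \<open>\<tau> \<circ> f = \<phi> \<circ> \<gamma>\<close> (lemma \<open>frame_exists\<close>). Differentiating \<open>q = f(s(x)) \<tau>(q)\<close> with the Leibniz rule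
  expresses any connection form \<open>\<theta>\<close> on \<open>Q\<close> as
    \<open>\<theta>\<^sub>q(v) = Ad(\<tau>(q)\<^sup>-\<^sup>1) \<theta>(T(f \<circ> s \<circ> pr') v) + T(q' \<mapsto> \<tau>(q)\<^sup>-\<^sup>1 \<tau>(q')) v\<close>
  (lemma \<open>connection_decomposition\<close>). If \<open>\<theta>\<close> is related with \<open>\<omega>\<close>, then \<open>\<theta>(T f u)\<close> is the image of
  \<open>\<omega>(u)\<close> in the Lie algebra of \<open>H\<close>, so the right-hand side depends on \<open>\<omega>\<close> only. This is uniqueness
  (\<open>gauge_form_unique\<close>).

  Conversely, the right-hand side, with \<open>\<omega>\<close> inserted, defines the \<open>gauge_form\<close> on the part of \<open>Q\<close>
  over \<open>W\<close>. It reproduces the generators of fundamental vector fields, is equivariant and is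
  smooth; it is related with \<open>\<omega>\<close>, as one sees by applying the same decomposition to \<open>\<omega>\<close> and the
  identity \<open>p = s(x) \<gamma>(p)\<close>. Each of these properties at a fibre of \<open>Q\<close> involves that fibre alone,
  so choosing one frame for each point of the base and using its gauge form over that point yields
  a form with all the pointwise properties. By uniqueness it agrees with the gauge form of every
  frame on the whole set \<open>W\<close> of that frame, and hence it is smooth.

  The calculus behind this has to establish, for smoothness in terms of explicit derivatives of
  all orders, that composites are smooth and that the derivative of a smooth map is a smooth
  operator-valued map. The type of the iterated derivative \<open>E \<rightarrow> L(E, L(E, \<dots>))\<close> changes with the
  order, which forbids the usual induction; it is replaced by an induction over families of maps
  between two fixed spaces, where differentiating a family means to collect the directional
  derivatives of its members in bounded directions (\<open>equi_C\<close>, \<open>smooth_on_iff_equi_C\<close>). Manifolds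
  are treated through germs (\<open>smooth_map_at\<close>), and all arguments about bundles use the tangent
  maps only through the chain rule, additivity and the Leibniz rule \<open>tangent_map_leibniz\<close>.
\<close>

section \<open>Families of maps with uniformly bounded derivatives\<close>

text \<open>
  Every point of \<open>S\<close> has a neighbourhood on which the family \<open>F\<close> is uniformly bounded.
\<close>

definition locally_bounded :: "'e::real_normed_vector set \<Rightarrow> ('e \<Rightarrow> 'f::real_normed_vector) set \<Rightarrow> bool" where
  "locally_bounded S F \<longleftrightarrow> (\<forall>x\<in>S. \<exists>K. \<forall>\<^sub>F y in nhds x. \<forall>f\<in>F. norm (f y) \<le> K)"

text \<open>
  All directional derivatives of members of \<open>F\<close> in directions of norm at most \<open>r\<close>.
\<close>

abbreviation dir_derivs ::
    "('e::real_normed_vector \<Rightarrow> 'f::real_normed_vector) set \<Rightarrow> real \<Rightarrow> ('e \<Rightarrow> 'f) set" where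
  "dir_derivs F r \<equiv> {\<lambda>x. frechet_derivative f (at x) v |f v. f \<in> F \<and> norm v \<le> r}"

text \<open>
  The derivatives up to order \<open>n\<close> of the members of \<open>F\<close> exist on \<open>S\<close>, and they are locally bounded
  uniformly in the family. The place of the derivative of a family is taken by \<open>dir_derivs F r\<close>
  for every radius \<open>r\<close>; uniformity in the direction keeps track of the operator norm, while the
  type of the maps does not change. Meaningful for open \<open>S\<close>.
\<close>

primrec equi_C :: "nat \<Rightarrow> 'e::real_normed_vector set \<Rightarrow> ('e \<Rightarrow> 'f::real_normed_vector) set \<Rightarrow> bool" where
  "equi_C 0 S F \<longleftrightarrow> locally_bounded S F"
| "equi_C (Suc n) S F \<longleftrightarrow> locally_bounded S F \<and> (\<forall>f\<in>F. \<forall>x\<in>S. f differentiable (at x)) \<and>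
     (\<forall>r. equi_C n S (dir_derivs F r))"

lemma equi_C_locally_bounded: "equi_C n S F \<Longrightarrow> locally_bounded S F"
  by (cases n) auto

lemma equi_C_SucD: "equi_C (Suc n) S F \<Longrightarrow> equi_C n S F"
  by (induction n arbitrary: F) auto

lemma locally_bounded_cong:
  assumes "open S" "\<And>f. f \<in> F \<Longrightarrow> \<exists>g\<in>G. \<forall>x\<in>S. f x = g x" "locally_bounded S G"
  shows "locally_bounded S F"
  unfolding locally_bounded_def
proof
  fix x assume x: "x \<in> S"
  then obtain K where K: "\<forall>\<^sub>F y in nhds x. \<forall>f\<in>G. norm (f y) \<le> K"
    using assms(3) unfolding locally_bounded_def by blast
  have "\<forall>\<^sub>F y in nhds x. y \<in> S"
    using assms(1) x by (simp add: eventually_nhds_in_open)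
  with K have "\<forall>\<^sub>F y in nhds x. \<forall>f\<in>F. norm (f y) \<le> K"
    by eventually_elim (use assms(2) in force)
  then show "\<exists>K. \<forall>\<^sub>F y in nhds x. \<forall>f\<in>F. norm (f y) \<le> K" by blast
qed

lemma frechet_derivative_eqI:
  "(f has_derivative f') (at x) \<Longrightarrow> frechet_derivative f (at x) = f'"
  by (metis frechet_derivative_at)

text \<open>
  Only the values on \<open>S\<close> matter, although \<open>frechet_derivative\<close> mentions the total functions.
\<close>

lemma equi_C_cong:
  assumes "open S" "\<And>f. f \<in> F \<Longrightarrow> \<exists>g\<in>G. \<forall>x\<in>S. f x = g x" "equi_C n S G"
  shows "equi_C n S F"
  using assms(2,3)
proof (induction n arbitrary: F G)
  case 0
  then show ?case using locally_bounded_cong[OF assms(1)] by (metis equi_C.simps(1))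
next
  case (Suc n)
  have der: "(f has_derivative frechet_derivative g (at x)) (at x)"
    if "g \<in> G" "\<forall>x\<in>S. f x = g x" "x \<in> S" for f g x
  proof -
    have "(g has_derivative frechet_derivative g (at x)) (at x)"
      using Suc.prems(2) that by (simp add: frechet_derivative_works)
    then show ?thesis
      using has_derivative_transform_within_open[OF _ assms(1) that(3)] that(2) by fastforce
  qed
  show ?case
    unfolding equi_C.simps
  proof (intro conjI allI ballI)
    show "locally_bounded S F"
      using locally_bounded_cong[OF assms(1) Suc.prems(1)] Suc.prems(2) by simp
    show "f differentiable (at x)" if "f \<in> F" "x \<in> S" for f x
      using der Suc.prems(1)[OF that(1)] that differentiable_def by blast
    show "equi_C n S (dir_derivs F r)" for r
    proof (rule Suc.IH)
      show "equi_C n S (dir_derivs G r)"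
        using Suc.prems(2) by simp
      fix k assume "k \<in> dir_derivs F r"
      then obtain f v where k: "k = (\<lambda>x. frechet_derivative f (at x) v)" "f \<in> F" "norm v \<le> r"
        by blast
      obtain g where g: "g \<in> G" "\<forall>x\<in>S. f x = g x" using Suc.prems(1) k by blast
      have "k x = frechet_derivative g (at x) v" if "x \<in> S" for x
        unfolding k using frechet_derivative_eqI[OF der[OF g that]] by simp
      then show "\<exists>g\<in>(dir_derivs G r). \<forall>x\<in>S. k x = g x"
        by (intro bexI[of _ "\<lambda>x. frechet_derivative g (at x) v"]) (use g k in auto)
    qed
  qed
qed

lemma equi_C_mono: "open S \<Longrightarrow> F \<subseteq> G \<Longrightarrow> equi_C n S G \<Longrightarrow> equi_C n S F"
  by (rule equi_C_cong) auto

text \<open>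
  An explicitly known derivative \<open>f'\<close> can replace \<open>frechet_derivative\<close>.
\<close>

lemma equi_C_SucI:
  assumes S: "open S" and lb: "locally_bounded S F"
    and der: "\<And>f x. f \<in> F \<Longrightarrow> x \<in> S \<Longrightarrow> (f has_derivative f' f x) (at x)"
    and eq: "\<And>r. equi_C n S {\<lambda>x. f' f x v |f v. f \<in> F \<and> norm v \<le> r}"
  shows "equi_C (Suc n) S F"
  unfolding equi_C.simps
proof (intro conjI allI ballI)
  show "f differentiable (at x)" if "f \<in> F" "x \<in> S" for f x
    using der that differentiable_def by blast
  show "equi_C n S (dir_derivs F r)" for r
  proof (rule equi_C_cong[OF S _ eq])
    fix k assume "k \<in> dir_derivs F r"
    then obtain f v where k: "k = (\<lambda>x. frechet_derivative f (at x) v)" "f \<in> F" "norm v \<le> r"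
      by blast
    have "\<forall>x\<in>S. k x = f' f x v"
      unfolding k using frechet_derivative_eqI[OF der[OF k(2)]] by simp
    then show "\<exists>g\<in>{\<lambda>x. f' f x v |f v. f \<in> F \<and> norm v \<le> r}. \<forall>x\<in>S. k x = g x"
      by (intro bexI[of _ "\<lambda>x. f' f x v"]) (use k in auto)
  qed
qed (fact lb)

lemma locally_bounded_image2:
  assumes "locally_bounded S F" "locally_bounded S G"
    and "\<And>f g y. f \<in> F \<Longrightarrow> g \<in> G \<Longrightarrow> norm (h f g y) \<le> C * norm (f y) + C' * norm (g y) +
        C'' * (norm (f y) * norm (g y))"
    and "C \<ge> 0" "C' \<ge> 0" "C'' \<ge> 0"
  shows "locally_bounded S {h f g |f g. f \<in> F \<and> g \<in> G}"
  unfolding locally_bounded_def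
proof
  fix x assume x: "x \<in> S"
  obtain K L where K: "\<forall>\<^sub>F y in nhds x. \<forall>f\<in>F. norm (f y) \<le> K"
    and L: "\<forall>\<^sub>F y in nhds x. \<forall>g\<in>G. norm (g y) \<le> L"
    using assms(1,2) x unfolding locally_bounded_def by meson
  from K L have "\<forall>\<^sub>F y in nhds x. \<forall>k\<in>{h f g |f g. f \<in> F \<and> g \<in> G}. norm (k y) \<le> C * \<bar>K\<bar> + C' * \<bar>L\<bar> +
      C'' * (\<bar>K\<bar> * \<bar>L\<bar>)"
  proof eventually_elim
    case (elim y)
    have "norm (h f g y) \<le> C * \<bar>K\<bar> + C' * \<bar>L\<bar> + C'' * (\<bar>K\<bar> * \<bar>L\<bar>)" if "f \<in> F" "g \<in> G" for f g
    proof -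
      have "norm (f y) \<le> \<bar>K\<bar>" "norm (g y) \<le> \<bar>L\<bar>" using elim that by force+
      then have "C * norm (f y) + C' * norm (g y) + C'' * (norm (f y) * norm (g y)) \<le> C * \<bar>K\<bar> +
          C' * \<bar>L\<bar> + C'' * (\<bar>K\<bar> * \<bar>L\<bar>)"
        by (intro add_mono mult_left_mono mult_mono) (use assms in auto)
      then show ?thesis using assms(3)[OF that] by (meson order_trans)
    qed
    then show ?case by blast
  qed
  then show "\<exists>K. \<forall>\<^sub>F y in nhds x. \<forall>k\<in>{h f g |f g. f \<in> F \<and> g \<in> G}. norm (k y) \<le> K" by blast
qed

lemma equi_C_const:
  fixes S :: "'e::real_normed_vector set"
  assumes S: "open S"
  shows "equi_C n S {\<lambda>x. c |c :: 'f::real_normed_vector. norm c \<le> K}"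
proof (induction n arbitrary: K)
  case 0
  show ?case by (auto simp: locally_bounded_def intro!: exI[of _ K] always_eventually)
next
  case (Suc n)
  show ?case
  proof (rule equi_C_SucI[where f' = "\<lambda>f x v. 0", OF S])
    fix r
    have "{\<lambda>x. 0 |(f :: 'e \<Rightarrow> 'f) (v :: 'e). f \<in> {\<lambda>x. c |c. norm c \<le> K} \<and> norm v \<le> r} \<subseteq>
        {\<lambda>x. c |c :: 'f. norm c \<le> 0}"
      by auto
    from equi_C_mono[OF S this Suc]
    show "equi_C n S {\<lambda>x. 0 :: 'f |(f :: 'e \<Rightarrow> 'f) (v :: 'e). f \<in> {\<lambda>x. c |c. norm c \<le> K} \<and> norm v \<le> r}" .
  qed (auto simp: locally_bounded_def intro!: exI[of _ K] always_eventually)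
qed

lemma pointwise_add_memI:
  "f \<in> F \<Longrightarrow> g \<in> G \<Longrightarrow> (\<lambda>x. f x + g x) \<in> {\<lambda>x. f x + g x |f g. f \<in> F \<and> g \<in> G}"
  by blast

lemma equi_C_add:
  assumes S: "open S" and "equi_C n S F" "equi_C n S G"
  shows "equi_C n S {\<lambda>x. f x + g x |f g. f \<in> F \<and> g \<in> G}"
  using assms(2,3)
proof (induction n arbitrary: F G)
  case 0
  then show ?case
    using locally_bounded_image2[of S F G "\<lambda>f g x. f x + g x" 1 1 0] by (simp add: norm_triangle_ineq)
next
  case (Suc n)
  let ?H = "{\<lambda>x. f x + g x |f g. f \<in> F \<and> g \<in> G}"
  have der: "((\<lambda>x. f x + g x) has_derivative (\<lambda>v. frechet_derivative f (at x) v +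
      frechet_derivative g (at x) v)) (at x)"
    if "f \<in> F" "g \<in> G" "x \<in> S" for f g x
    using Suc.prems that by (auto intro!: has_derivative_add simp: frechet_derivative_works[symmetric])
  show ?case
  proof (rule equi_C_SucI[where f' = "\<lambda>f x. frechet_derivative f (at x)", OF S])
    show "locally_bounded S ?H"
      using locally_bounded_image2[of S F G "\<lambda>f g x. f x + g x" 1 1 0] Suc.prems
          by (simp add: norm_triangle_ineq)
    show "(h has_derivative frechet_derivative h (at x)) (at x)" if "h \<in> ?H" "x \<in> S" for h x
      using that der by (auto simp: frechet_derivative_works[symmetric] differentiable_def)
    fix r
    have *: "equi_C n S {\<lambda>x. f x + g x |f g. f \<in> dir_derivs F r \<and> g \<in> dir_derivs G r}"
      by (rule Suc.IH) (use Suc.prems in auto)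
    show "equi_C n S (dir_derivs ?H r)"
    proof (rule equi_C_cong[OF S _ *])
      fix k assume "k \<in> dir_derivs ?H r"
      then obtain f g v where k: "k = (\<lambda>x. frechet_derivative (\<lambda>x. f x + g x) (at x) v)" "f \<in> F" "g \<in>
          G" "norm v \<le> r"
        by blast
      have "\<forall>x\<in>S. k x = frechet_derivative f (at x) v + frechet_derivative g (at x) v"
        unfolding k using frechet_derivative_eqI[OF der[OF k(2,3)]] by simp
      then show "\<exists>g\<in>{\<lambda>x. f x + g x |f g. f \<in> dir_derivs F r \<and> g \<in> dir_derivs G r}. \<forall>x\<in>S. k x = g x"
        by (intro bexI[of _ "\<lambda>x. frechet_derivative f (at x) v + frechet_derivative g (at x) v"] CollectI
             exI[of _ "\<lambda>x. frechet_derivative f (at x) v"] exI[of _ "\<lambda>x. frechet_derivative g (at x) v"])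
           (use k in auto)
    qed
  qed
qed

lemma equi_C_bilinear:
  assumes S: "open S" and b: "bounded_bilinear b" and "equi_C n S F" "equi_C n S G"
  shows "equi_C n S {\<lambda>x. b (f x) (g x) |f g. f \<in> F \<and> g \<in> G}"
  using assms(3,4)
proof (induction n arbitrary: F G)
  case 0
  obtain K where "K \<ge> 0" "\<And>x y. norm (b x y) \<le> norm x * norm y * K"
    using bounded_bilinear.nonneg_bounded[OF b] by blast
  with 0 show ?case
    using locally_bounded_image2[of S F G "\<lambda>f g x. b (f x) (g x)" 0 0 K] by (simp add: ac_simps)
next
  case (Suc n)
  obtain K where K: "K \<ge> 0" "\<And>x y. norm (b x y) \<le> norm x * norm y * K"
    using bounded_bilinear.nonneg_bounded[OF b] by blast
  let ?H = "{\<lambda>x. b (f x) (g x) |f g. f \<in> F \<and> g \<in> G}"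
  let ?B = "\<lambda>F G. {\<lambda>x. b (f x) (g x) |f g. f \<in> F \<and> g \<in> G}"
  have der: "((\<lambda>x. b (f x) (g x)) has_derivative (\<lambda>v. b (f x) (frechet_derivative g (at x) v) +
      b (frechet_derivative f (at x) v) (g x))) (at x)"
    if "f \<in> F" "g \<in> G" "x \<in> S" for f g x
    using Suc.prems that
    by (auto intro!: bounded_bilinear.FDERIV[OF b] simp: frechet_derivative_works[symmetric])
  show ?case
  proof (rule equi_C_SucI[where f' = "\<lambda>f x. frechet_derivative f (at x)", OF S])
    show "locally_bounded S ?H"
      using locally_bounded_image2[of S F G "\<lambda>f g x. b (f x) (g x)" 0 0 K] Suc.prems K
          by (simp add: ac_simps)
    show "(h has_derivative frechet_derivative h (at x)) (at x)" if "h \<in> ?H" "x \<in> S" for h x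
      using that der by (auto simp: frechet_derivative_works[symmetric] differentiable_def)
    fix r
    have "equi_C n S (?B F (dir_derivs G r))" "equi_C n S (?B (dir_derivs F r) G)"
      using Suc.prems Suc.prems[THEN equi_C_SucD] by (intro Suc.IH; simp)+
    from equi_C_add[OF S this]
    have *: "equi_C n S {\<lambda>x. f x + g x |f g. f \<in> ?B F (dir_derivs G r) \<and> g \<in> ?B (dir_derivs F r) G}" .
    show "equi_C n S (dir_derivs ?H r)"
    proof (rule equi_C_cong[OF S _ *])
      fix k assume "k \<in> dir_derivs ?H r"
      then obtain f g v where k: "k = (\<lambda>x. frechet_derivative (\<lambda>x. b (f x) (g x)) (at x) v)" "f \<in> F"
          "g \<in> G" "norm v \<le> r"
        by blast
      have e: "\<forall>x\<in>S. k x = b (f x) (frechet_derivative g (at x) v) + b (frechet_derivative f (at x) v)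
          (g x)"
        unfolding k using frechet_derivative_eqI[OF der[OF k(2,3)]] by simp
      have 1: "(\<lambda>x. b (f x) (frechet_derivative g (at x) v)) \<in> ?B F (dir_derivs G r)"
        by (intro CollectI exI[of _ f] exI[of _ "\<lambda>x. frechet_derivative g (at x) v"]) (use k in auto)
      have 2: "(\<lambda>x. b (frechet_derivative f (at x) v) (g x)) \<in> ?B (dir_derivs F r) G"
        by (intro CollectI exI[of _ g] exI[of _ "\<lambda>x. frechet_derivative f (at x) v"]) (use k in auto)
      have "(\<lambda>x. b (f x) (frechet_derivative g (at x) v) + b (frechet_derivative f (at x) v) (g x))
          \<in> {\<lambda>x. f x + g x |f g. f \<in> ?B F (dir_derivs G r) \<and> g \<in> ?B (dir_derivs F r) G}"
        by (rule pointwise_add_memI[OF 1 2])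
      with e show "\<exists>g\<in>{\<lambda>x. f x + g x |f g. f \<in> ?B F (dir_derivs G r) \<and> g \<in> ?B (dir_derivs F r) G}.
          \<forall>x\<in>S. k x = g x"
        by (rule bexI)
    qed
  qed
qed

lemma equi_C_Un:
  assumes S: "open S" and "equi_C n S F" "equi_C n S G"
  shows "equi_C n S (F \<union> G)"
  using assms(2,3)
proof (induction n arbitrary: F G)
  case 0
  show ?case
    unfolding equi_C.simps locally_bounded_def
  proof
    fix x assume x: "x \<in> S"
    obtain K L where K: "\<forall>\<^sub>F y in nhds x. \<forall>f\<in>F. norm (f y) \<le> K"
      and L: "\<forall>\<^sub>F y in nhds x. \<forall>g\<in>G. norm (g y) \<le> L"
      using 0 x unfolding locally_bounded_def equi_C.simps by meson
    from K L have "\<forall>\<^sub>F y in nhds x. \<forall>f\<in>F \<union> G. norm (f y) \<le> max K L"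
      by eventually_elim (auto simp: le_max_iff_disj)
    then show "\<exists>K. \<forall>\<^sub>F y in nhds x. \<forall>f\<in>F \<union> G. norm (f y) \<le> K" by blast
  qed
next
  case (Suc n)
  have lb: "locally_bounded S (F \<union> G)"
    using Suc.IH[of F G] Suc.prems equi_C_SucD equi_C_locally_bounded by blast
  have D: "dir_derivs (F \<union> G) r = dir_derivs F r \<union> dir_derivs G r" for r by blast
  have "equi_C n S (dir_derivs (F \<union> G) r)" for r
    unfolding D by (rule Suc.IH) (use Suc.prems in auto)
  then show ?case using Suc.prems lb by auto
qed

lemma equi_C_sum:
  fixes m :: nat
  assumes S: "open S" and F: "equi_C n S F"
  shows "equi_C n S {\<lambda>x. \<Sum>i<m. h i x |h. \<forall>i<m. h i \<in> F}"
proof (induction m)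
  case 0
  show ?case by (rule equi_C_mono[OF S _ equi_C_const[OF S, of n 0]]) auto
next
  case (Suc m)
  show ?case
  proof (rule equi_C_mono[OF S _ equi_C_add[OF S Suc F]])
    show "{\<lambda>x. \<Sum>i<Suc m. h i x |h. \<forall>i<Suc m. h i \<in> F}
      \<subseteq> {\<lambda>x. f x + g x |f g. f \<in> {\<lambda>x. \<Sum>i<m. h i x |h. \<forall>i<m. h i \<in> F} \<and> g \<in> F}"
    proof
      fix k assume "k \<in> {\<lambda>x. \<Sum>i<Suc m. h i x |h. \<forall>i<Suc m. h i \<in> F}"
      then obtain h where k: "k = (\<lambda>x. (\<Sum>i<m. h i x) + h m x)" and h: "\<forall>i<Suc m. h i \<in> F"
        by auto
      have 1: "(\<lambda>x. \<Sum>i<m. h i x) \<in> {\<lambda>x. \<Sum>i<m. h i x |h. \<forall>i<m. h i \<in> F}"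
        by (intro CollectI exI[of _ h]) (use h in auto)
      have 2: "h m \<in> F" using h by simp
      show "k \<in> {\<lambda>x. f x + g x |f g. f \<in> {\<lambda>x. \<Sum>i<m. h i x |h. \<forall>i<m. h i \<in> F} \<and> g \<in> F}"
        unfolding k by (rule pointwise_add_memI[OF 1 2])
    qed
  qed
qed

section \<open>The Leibniz rule for multilinear maps with variable arguments\<close>

text \<open>
  The product of the norms of the arguments, as in the definition of \<open>bounded_multilinear\<close>.
\<close>

abbreviation prod_norm :: "'e::real_normed_vector list \<Rightarrow> real" where
  "prod_norm vs \<equiv> \<Prod>v\<leftarrow>vs. norm v"

lemma prod_list_norm_nonneg: "0 \<le> prod_norm vs"
  by (induction vs) auto

lemma prod_list_norm_le_power:
  "(\<And>v. v \<in> set vs \<Longrightarrow> norm v \<le> r) \<Longrightarrow> prod_norm vs \<le> \<bar>r\<bar> ^ length vs"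
proof (induction vs)
  case (Cons v vs)
  have "norm v \<le> \<bar>r\<bar>" using Cons.prems[of v] by simp
  moreover have "prod_norm vs \<le> \<bar>r\<bar> ^ length vs" using Cons by simp
  ultimately show ?case by (auto intro!: mult_mono prod_list_norm_nonneg)
qed simp

lemma has_derivative_at_eventually:
  "(f has_derivative f') (at x) \<longleftrightarrow>
     bounded_linear f' \<and> (\<forall>e>0. \<forall>\<^sub>F y in nhds x. norm (f y - f x - f' (y - x)) \<le> e * norm (y - x))"
  by (simp add: has_derivative_at_alt eventually_nhds_metric dist_norm)

lemma has_derivative_transform_nhds:
  assumes "(f has_derivative f') (at x)" "\<forall>\<^sub>F y in nhds x. f y = g y"
  shows "(g has_derivative f') (at x)"
proof -
  obtain S where "open S" "x \<in> S" "\<forall>y\<in>S. f y = g y"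
    using assms(2) unfolding eventually_nhds by blast
  then show ?thesis
    using has_derivative_transform_within_open[OF assms(1)] by blast
qed

lemma less_divide_norm_add_one:
  assumes "(e::real) > 0"
  shows "0 < e / (norm z + 1)" "e / (norm z + 1) * norm z \<le> e"
proof -
  have p: "norm z + 1 > 0" by (simp add: add_nonneg_pos)
  then show "0 < e / (norm z + 1)" using assms by simp
  have "norm z / (norm z + 1) \<le> 1" using p by simp
  from mult_left_mono[OF this, of e] show "e / (norm z + 1) * norm z \<le> e"
    using assms by simp
qed

lemma bounded_multilinear_Cons:
  assumes "bounded_multilinear (Suc k) T"
  shows "bounded_multilinear k (\<lambda>vs. T (v # vs))"
  unfolding bounded_multilinear_def
proof (intro conjI allI impI)
  fix vs :: "'a list" and i assume "length vs = k" "i < k"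
  then have "linear (\<lambda>w. T ((v # vs)[Suc i := w]))"
    using assms unfolding bounded_multilinear_def by (auto simp del: list_update.simps)
  then show "linear (\<lambda>w. T (v # vs[i := w]))" by simp
next
  obtain K where K: "\<And>vs. length vs = Suc k \<Longrightarrow> norm (T vs) \<le> K * prod_norm vs"
    using assms unfolding bounded_multilinear_def by blast
  have "norm (T (v # vs)) \<le> (K * norm v) * prod_norm vs" if "length vs = k" for vs
    using K[of "v # vs"] that by (simp add: ac_simps)
  then show "\<exists>K. \<forall>vs. length vs = k \<longrightarrow> norm (T (v # vs)) \<le> K * prod_norm vs" by blast
qed

lemma bounded_multilinear_linear_nth:
  assumes "bounded_multilinear (Suc (length us + length vs)) T"
  shows "linear (\<lambda>w. T (us @ w # vs))"
proof -
  have *: "linear (\<lambda>w. T (xs[i := w]))"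
    if "length xs = Suc (length us + length vs)" "i < Suc (length us + length vs)" for xs i
    using assms that unfolding bounded_multilinear_def by blast
  have "linear (\<lambda>w. T ((us @ 0 # vs)[length us := w]))"
    by (rule *) auto
  then show ?thesis by simp
qed

lemma bounded_multilinear_bounded_linear_nth:
  assumes "bounded_multilinear (Suc (length us + length vs)) T"
  shows "bounded_linear (\<lambda>w. T (us @ w # vs))"
proof -
  obtain K where K: "\<And>xs. length xs = Suc (length us + length vs) \<Longrightarrow> norm (T xs) \<le> K * prod_norm xs"
    using assms unfolding bounded_multilinear_def by blast
  have lin: "linear (\<lambda>w. T (us @ w # vs))"
    by (rule bounded_multilinear_linear_nth[OF assms])
  have "norm (T (us @ w # vs)) \<le> norm w * (K * (prod_norm us * prod_norm vs))" for w
    using K[of "us @ w # vs"] by (simp add: ac_simps)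
  then show ?thesis
    using lin by (intro bounded_linear_intro) (auto dest: linear_add linear_scale)
qed

lemma bounded_multilinear_bounded_linear_hd:
  assumes "bounded_multilinear (Suc (length vs)) T"
  shows "bounded_linear (\<lambda>w. T (w # vs))"
  using bounded_multilinear_bounded_linear_nth[of "[]" vs T] assms by simp

lemma tendsto_prod_list_norm:
  "(\<And>a. a \<in> set as \<Longrightarrow> (a \<longlongrightarrow> a x) F) \<Longrightarrow>
    ((\<lambda>y. \<Prod>a\<leftarrow>as. norm (a y)) \<longlongrightarrow> (\<Prod>a\<leftarrow>as. norm (a x))) F"
  by (induction as) (auto intro!: tendsto_intros)

lemma eventually_le_of_tendsto:
  "(f \<longlongrightarrow> (l::real)) F \<Longrightarrow> l < u \<Longrightarrow> \<forall>\<^sub>F y in F. f y \<le> u"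
  by (drule order_tendstoD(2), assumption, erule eventually_mono, simp)

text \<open>
  Continuity of \<open>y \<mapsto> U\<^sub>y(ws, a\<^sub>1(y), \<dots>, a\<^sub>k(y))\<close> in the operator norm with respect to the leading
  arguments \<open>ws\<close>, where \<open>U\<^sub>y\<close> is an \<open>m\<close>-linear map depending continuously on \<open>y\<close>.
\<close>

lemma multilinear_continuous_args:
  fixes U :: "'e::real_normed_vector \<Rightarrow> 'f::real_normed_vector list \<Rightarrow> 'g::real_normed_vector"
  assumes ml: "\<forall>\<^sub>F y in nhds x. bounded_multilinear m (U y)"
    and bd: "\<forall>\<^sub>F y in nhds x. \<forall>vs. length vs = m \<longrightarrow> norm (U y vs) \<le> K * prod_norm vs"
    and ct: "\<And>e. e > 0 \<Longrightarrow> \<forall>\<^sub>F y in nhds x. \<forall>vs. length vs = m \<longrightarrow>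
               norm (U y vs - U x vs) \<le> e * prod_norm vs"
    and cas: "\<And>a. a \<in> set as \<Longrightarrow> (a \<longlongrightarrow> a x) (nhds x)"
    and e: "e > 0"
  shows "\<forall>\<^sub>F y in nhds x. \<forall>ws. length ws + length as = m \<longrightarrow>
     norm (U y (ws @ map (\<lambda>a. a y) as) - U x (ws @ map (\<lambda>a. a x) as)) \<le> e * prod_norm ws"
  using cas e
proof (induction as arbitrary: e)
  case Nil
  then show ?case using ct[of e] by simp
next
  case (Cons a as)
  \<comment> \<open>the two error terms below are at most \<open>e / 2\<close> each with these tolerances\<close>
  define e1 where "e1 = e / 2 / (norm (a x) + 1)"
  define M where "M = (\<Prod>a\<leftarrow>as. norm (a x)) + 1"
  define e2 where "e2 = e / 2 / (\<bar>K\<bar> * M + 1)"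
  have M: "M > 0" unfolding M_def using prod_list_norm_nonneg[of "map (\<lambda>a. a x) as"]
    by (simp add: o_def)
  have e1: "e1 > 0" and e1': "e1 * norm (a x) \<le> e / 2"
    using less_divide_norm_add_one[of "e / 2" "a x"] Cons.prems(2) by (auto simp: e1_def)
  have p: "\<bar>K\<bar> * M + 1 > 0" using M by (simp add: add_nonneg_pos)
  have e2: "e2 > 0" unfolding e2_def using Cons.prems(2) p by simp
  have "\<bar>K\<bar> * M * e2 = (e / 2) * ((\<bar>K\<bar> * M) / (\<bar>K\<bar> * M + 1))"
    unfolding e2_def by simp
  also have "\<dots> \<le> (e / 2) * 1"
    by (intro mult_left_mono) (use p Cons.prems(2) in auto)
  finally have e2': "\<bar>K\<bar> * M * e2 \<le> e / 2" by simp
  have 1: "\<forall>\<^sub>F y in nhds x. \<forall>ws. length ws + length as = m \<longrightarrow>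
     norm (U y (ws @ map (\<lambda>a. a y) as) - U x (ws @ map (\<lambda>a. a x) as)) \<le> e1 * prod_norm ws"
    by (rule Cons.IH) (use Cons.prems e1 in auto)
  have 2: "\<forall>\<^sub>F y in nhds x. (\<Prod>a\<leftarrow>as. norm (a y)) \<le> M"
    by (rule eventually_le_of_tendsto[OF tendsto_prod_list_norm]) (use Cons.prems in \<open>auto simp: M_def\<close>)
  have "((\<lambda>y. norm (a y - a x)) \<longlongrightarrow> norm (a x - a x)) (nhds x)"
    by (intro tendsto_intros) (use Cons.prems in auto)
  then have 3: "\<forall>\<^sub>F y in nhds x. norm (a y - a x) \<le> e2"
    by (rule eventually_le_of_tendsto) (use e2 in auto)
  from 1 2 3 ml bd show ?case
  proof eventually_elim
    case (elim y)
    show ?case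
    proof (intro allI impI)
      fix ws :: "'f list" assume ws: "length ws + length (a # as) = m"
      let ?R = "\<lambda>y. map (\<lambda>a. a y) as"
      let ?N = "prod_norm ws"
      have N: "?N \<ge> 0" by (rule prod_list_norm_nonneg)
      have "linear (\<lambda>w. U y (ws @ w # ?R y))"
        by (rule bounded_multilinear_linear_nth) (use elim(4) ws in simp)
      then have "U y (ws @ a y # ?R y) = U y (ws @ a x # ?R y) + U y (ws @ (a y - a x) # ?R y)"
        using linear_add[of "\<lambda>w. U y (ws @ w # ?R y)" "a x" "a y - a x"] by simp
      then have "norm (U y (ws @ a y # ?R y) - U x (ws @ a x # ?R x))
        \<le> norm (U y (ws @ a x # ?R y) - U x (ws @ a x # ?R x)) + norm (U y (ws @ (a y - a x) # ?R y))"
        using norm_triangle_ineq[of "U y (ws @ a x # ?R y) - U x (ws @ a x # ?R x)" "U y (ws @ (a y -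
            a x) # ?R y)"]
        by (simp add: algebra_simps)
      also have "norm (U y (ws @ a x # ?R y) - U x (ws @ a x # ?R x)) \<le> e1 * (?N * norm (a x))"
        using elim(1)[rule_format, of "ws @ [a x]"] ws by simp
      also have "e1 * (?N * norm (a x)) \<le> e / 2 * ?N"
        using mult_right_mono[OF e1' N] by (simp add: ac_simps)
      also have "norm (U y (ws @ (a y - a x) # ?R y)) \<le> K * (?N * (norm (a y - a x) * (\<Prod>a\<leftarrow>as. norm (a y))))"
        using elim(5)[rule_format, of "ws @ (a y - a x) # ?R y"] ws by (simp add: o_def)
      also have "\<dots> \<le> \<bar>K\<bar> * (?N * (e2 * M))"
        by (intro mult_mono mult_left_mono) (use elim N e2 M prod_list_norm_nonneg[of "map (\<lambda>a. a y)
            as"] in \<open>auto simp: o_def\<close>)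
      also have "\<dots> \<le> e / 2 * ?N"
        using mult_right_mono[OF e2' N] by (simp add: ac_simps)
      finally show "norm (U y (ws @ map (\<lambda>a. a y) (a # as)) - U x (ws @ map (\<lambda>a. a x) (a # as))) \<le> e * ?N"
        by (simp add: algebra_simps)
    qed
  qed
qed

text \<open>
  The contribution of the first argument to the Leibniz rule: since \<open>a(y) - a(x)\<close> vanishes at \<open>x\<close>,
  the remaining arguments and the map \<open>U\<^sub>y\<close> need only be continuous.
\<close>

lemma multilinear_has_derivative_vanishing:
  fixes U :: "'e::real_normed_vector \<Rightarrow> 'f::real_normed_vector list \<Rightarrow> 'g::real_normed_vector"
  assumes ml: "\<forall>\<^sub>F y in nhds x. bounded_multilinear (Suc (length as)) (U y)"
    and bd: "\<forall>\<^sub>F y in nhds x. \<forall>vs. length vs = Suc (length as) \<longrightarrow> norm (U y vs) \<le> K * prod_norm vs"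
    and ct: "\<And>e. e > 0 \<Longrightarrow> \<forall>\<^sub>F y in nhds x. \<forall>vs. length vs = Suc (length as) \<longrightarrow>
               norm (U y vs - U x vs) \<le> e * prod_norm vs"
    and cas: "\<And>a. a \<in> set as \<Longrightarrow> (a \<longlongrightarrow> a x) (nhds x)"
    and a: "(a has_derivative a') (at x)"
  shows "((\<lambda>y. U y ((a y - a x) # map (\<lambda>a. a y) as)) has_derivative
           (\<lambda>h. U x (a' h # map (\<lambda>a. a x) as))) (at x)"
  unfolding has_derivative_at_eventually
proof (intro conjI allI impI)
  let ?R = "\<lambda>y. map (\<lambda>a. a y) as"
  have mlx: "bounded_multilinear (Suc (length as)) (U x)"
    using ml by (rule eventually_nhds_x_imp_x)
  have a': "bounded_linear a'" using a by (rule has_derivative_bounded_linear)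
  have blx: "bounded_linear (\<lambda>w. U x (w # ?R x))"
    by (rule bounded_multilinear_bounded_linear_hd) (use mlx in simp)
  show "bounded_linear (\<lambda>h. U x (a' h # ?R x))"
    by (rule bounded_linear_compose[OF blx a'])
  fix e :: real assume e: "e > 0"
  obtain B where B: "B > 0" "\<And>h. norm (a' h) \<le> norm h * B"
    using bounded_linear.pos_bounded[OF a'] by blast
  define M where "M = (\<Prod>a\<leftarrow>as. norm (a x)) + 1"
  \<comment> \<open>tolerances for the remainder of \<open>a\<close> and for the variation of \<open>U\<close>\<close>
  define e1 where "e1 = e / 2 / (\<bar>K\<bar> * M + 1)"
  define e2 where "e2 = e / 2 / B"
  have M: "M > 0" unfolding M_def using prod_list_norm_nonneg[of "map (\<lambda>a. a x) as"]
    by (simp add: o_def)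
  have p: "\<bar>K\<bar> * M + 1 > 0" using M by (simp add: add_nonneg_pos)
  have e1: "e1 > 0" unfolding e1_def using e p by simp
  have "\<bar>K\<bar> * M * e1 = (e / 2) * ((\<bar>K\<bar> * M) / (\<bar>K\<bar> * M + 1))"
    unfolding e1_def by simp
  also have "\<dots> \<le> (e / 2) * 1"
    by (intro mult_left_mono) (use p e in auto)
  finally have e1': "\<bar>K\<bar> * M * e1 \<le> e / 2" by simp
  have e2: "e2 > 0" unfolding e2_def using e B by simp
  have e2': "e2 * B = e / 2" unfolding e2_def using B by simp
  have 1: "\<forall>\<^sub>F y in nhds x. norm (a y - a x - a' (y - x)) \<le> e1 * norm (y - x)"
    using a e1 unfolding has_derivative_at_eventually by blast
  have 2: "\<forall>\<^sub>F y in nhds x. (\<Prod>a\<leftarrow>as. norm (a y)) \<le> M"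
    by (rule eventually_le_of_tendsto[OF tendsto_prod_list_norm]) (use cas in \<open>auto simp: M_def\<close>)
  have 3: "\<forall>\<^sub>F y in nhds x. \<forall>ws. length ws + length as = Suc (length as) \<longrightarrow>
     norm (U y (ws @ ?R y) - U x (ws @ ?R x)) \<le> e2 * prod_norm ws"
    by (rule multilinear_continuous_args[OF ml bd ct cas e2])
  from 1 2 3 ml bd show "\<forall>\<^sub>F y in nhds x. norm (U y ((a y - a x) # ?R y) - U x ((a x - a x) # ?R x) -
      U x (a' (y - x) # ?R x))
      \<le> e * norm (y - x)"
  proof eventually_elim
    case (elim y)
    let ?r = "a y - a x - a' (y - x)"
    have lin: "linear (\<lambda>w. U y (w # ?R y))"
      using bounded_multilinear_linear_nth[of "[]" "?R y" "U y"] elim(4) by simp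
    have "U x ((a x - a x) # ?R x) = 0"
      using linear_0[OF bounded_linear.linear[OF blx]] by simp
    moreover have "U y ((a y - a x) # ?R y) = U y (?r # ?R y) + U y (a' (y - x) # ?R y)"
      using linear_add[OF lin, of ?r "a' (y - x)"] by simp
    ultimately have "norm (U y ((a y - a x) # ?R y) - U x ((a x - a x) # ?R x) - U x (a' (y - x) # ?R x))
      \<le> norm (U y (?r # ?R y)) + norm (U y (a' (y - x) # ?R y) - U x (a' (y - x) # ?R x))"
      using norm_triangle_ineq[of "U y (?r # ?R y)" "U y (a' (y - x) # ?R y) - U x (a' (y - x) # ?R x)"]
      by (simp add: algebra_simps)
    also have "norm (U y (?r # ?R y)) \<le> K * (norm ?r * (\<Prod>a\<leftarrow>as. norm (a y)))"
      using elim(5)[rule_format, of "?r # ?R y"] by (simp add: o_def)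
    also have "\<dots> \<le> \<bar>K\<bar> * ((e1 * norm (y - x)) * M)"
      by (intro mult_mono mult_left_mono) (use elim e1 M prod_list_norm_nonneg[of "map (\<lambda>a. a y) as"]
          in \<open>auto simp: o_def\<close>)
    also have "\<dots> \<le> e / 2 * norm (y - x)"
      using mult_right_mono[OF e1', of "norm (y - x)"] by (simp add: ac_simps)
    also have "norm (U y (a' (y - x) # ?R y) - U x (a' (y - x) # ?R x)) \<le> e2 * norm (a' (y - x))"
      using elim(3)[rule_format, of "[a' (y - x)]"] by simp
    also have "\<dots> \<le> e2 * (norm (y - x) * B)"
      using B e2 by (intro mult_left_mono) auto
    also have "\<dots> = e / 2 * norm (y - x)"
      using e2' by (simp add: ac_simps)
    finally show ?case by (simp add: algebra_simps)
  qed
qed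

text \<open>
  Leibniz rule for \<open>y \<mapsto> U\<^sub>y(a\<^sub>1(y), \<dots>, a\<^sub>m(y))\<close>, where \<open>U' vs\<close> is the derivative of \<open>y \<mapsto> U\<^sub>y vs\<close>
  at \<open>x\<close> and \<open>d a\<close> that of the argument \<open>a\<close>.
\<close>

lemma multilinear_has_derivative:
  fixes U :: "'e::real_normed_vector \<Rightarrow> 'f::real_normed_vector list \<Rightarrow> 'g::real_normed_vector"
  assumes "\<forall>\<^sub>F y in nhds x. bounded_multilinear (length as) (U y)"
    and "\<forall>\<^sub>F y in nhds x. \<forall>vs. length vs = length as \<longrightarrow> norm (U y vs) \<le> K * prod_norm vs"
    and "\<And>e. e > 0 \<Longrightarrow> \<forall>\<^sub>F y in nhds x. \<forall>vs. length vs = length as \<longrightarrow>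
               norm (U y vs - U x vs) \<le> e * prod_norm vs"
    and "\<And>vs. length vs = length as \<Longrightarrow> ((\<lambda>y. U y vs) has_derivative U' vs) (at x)"
    and "\<And>a. a \<in> set as \<Longrightarrow> (a has_derivative d a) (at x)"
  shows "((\<lambda>y. U y (map (\<lambda>a. a y) as)) has_derivative
           (\<lambda>h. U' (map (\<lambda>a. a x) as) h +
             (\<Sum>i<length as. U x ((map (\<lambda>a. a x) as)[i := d (as ! i) h])))) (at x)"
  using assms
proof (induction as arbitrary: U U' K)
  case Nil
  then show ?case by simp
next
  case (Cons a as)
  let ?R = "\<lambda>y. map (\<lambda>a. a y) as"
  have cont: "(b \<longlongrightarrow> b x) (nhds x)" if "b \<in> set (a # as)" for b
    using has_derivative_continuous[OF Cons.prems(5)[OF that]]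
    by (simp add: continuous_within tendsto_at_iff_tendsto_nhds)
  \<comment> \<open>freeze the first argument at \<open>x\<close>; its variation is the second summand\<close>
  have 1: "((\<lambda>y. U y (a x # ?R y)) has_derivative
           (\<lambda>h. U' (a x # ?R x) h + (\<Sum>i<length as. U x (a x # (?R x)[i := d (as ! i) h])))) (at x)"
  proof (rule Cons.IH)
    show "\<forall>\<^sub>F y in nhds x. bounded_multilinear (length as) (\<lambda>vs. U y (a x # vs))"
      using Cons.prems(1) by eventually_elim (simp add: bounded_multilinear_Cons)
    show "\<forall>\<^sub>F y in nhds x. \<forall>vs. length vs = length as \<longrightarrow> norm (U y (a x # vs)) \<le>
        (K * norm (a x)) * prod_norm vs"
      using Cons.prems(2)
    proof eventually_elim
      case (elim y)
      show ?case using elim[rule_format, of "a x # _"] by (simp add: ac_simps)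
    qed
    show "\<forall>\<^sub>F y in nhds x. \<forall>vs. length vs = length as \<longrightarrow> norm (U y (a x # vs) - U x (a x # vs)) \<le>
        e * prod_norm vs"
      if e: "e > 0" for e
    proof -
      define e1 where "e1 = e / (norm (a x) + 1)"
      have e1: "e1 > 0" "e1 * norm (a x) \<le> e"
        using less_divide_norm_add_one[OF e, of "a x"] by (auto simp: e1_def)
      show ?thesis using Cons.prems(3)[OF e1(1)]
      proof eventually_elim
        case (elim y)
        show ?case
        proof (intro allI impI)
          fix vs :: "'f list" assume "length vs = length as"
          then have "norm (U y (a x # vs) - U x (a x # vs)) \<le> e1 * (norm (a x) * prod_norm vs)"
            using elim[rule_format, of "a x # vs"] by simp
          also have "\<dots> \<le> e * prod_norm vs"
            using mult_right_mono[OF e1(2) prod_list_norm_nonneg[of vs]] by (simp add: ac_simps)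
          finally show "norm (U y (a x # vs) - U x (a x # vs)) \<le> e * prod_norm vs" .
        qed
      qed
    qed
    show "((\<lambda>y. U y (a x # vs)) has_derivative U' (a x # vs)) (at x)" if "length vs = length as" for vs
      using Cons.prems(4)[of "a x # vs"] that by simp
    show "(b has_derivative d b) (at x)" if "b \<in> set as" for b
      using Cons.prems(5) that by simp
  qed
  have 2: "((\<lambda>y. U y ((a y - a x) # ?R y)) has_derivative (\<lambda>h. U x (d a h # ?R x))) (at x)"
    by (rule multilinear_has_derivative_vanishing[where K = K]) (use Cons.prems cont in auto)
  have "((\<lambda>y. U y (a x # ?R y) + U y ((a y - a x) # ?R y)) has_derivative
     (\<lambda>h. (U' (a x # ?R x) h + (\<Sum>i<length as. U x (a x # (?R x)[i := d (as ! i) h]))) +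
         U x (d a h # ?R x))) (at x)"
    by (rule has_derivative_add[OF 1 2])
  moreover have "\<forall>\<^sub>F y in nhds x. U y (a x # ?R y) + U y ((a y - a x) # ?R y) = U y (a y # ?R y)"
    using Cons.prems(1)
  proof eventually_elim
    case (elim y)
    have "linear (\<lambda>w. U y (w # ?R y))"
      using bounded_multilinear_linear_nth[of "[]" "?R y" "U y"] elim by simp
    then show ?case using linear_add[of "\<lambda>w. U y (w # ?R y)" "a x" "a y - a x"] by simp
  qed
  ultimately have "((\<lambda>y. U y (a y # ?R y)) has_derivative
     (\<lambda>h. (U' (a x # ?R x) h + (\<Sum>i<length as. U x (a x # (?R x)[i := d (as ! i) h]))) +
         U x (d a h # ?R x))) (at x)"
    by (rule has_derivative_transform_nhds)
  then show ?case
    by (simp add: sum.lessThan_Suc_shift ac_simps del: sum.lessThan_Suc)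
qed

section \<open>Smooth maps as equi-smooth singletons\<close>

text \<open>
  \<open>D k\<close> is the derivative of order \<open>k\<close> of \<open>f\<close> on \<open>S\<close>, in the sense of \<open>smooth_on\<close>.
\<close>

definition derivs_on ::
    "'e::real_normed_vector set \<Rightarrow> ('e \<Rightarrow> 'f::real_normed_vector) \<Rightarrow> (nat \<Rightarrow> 'e \<Rightarrow> 'e list \<Rightarrow> 'f) \<Rightarrow> bool" where
  "derivs_on S f D \<longleftrightarrow>
        (\<forall>x\<in>S. D 0 x [] = f x) \<and>
        (\<forall>k. \<forall>x\<in>S. bounded_multilinear k (D k x) \<and>
           (\<forall>\<epsilon>>0. \<exists>\<delta>>0. \<forall>y\<in>S. norm (y - x) < \<delta> \<longrightarrow>
              (\<forall>vs. length vs = k \<longrightarrow>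
                 norm (D k y vs - D k x vs - D (Suc k) x ((y - x) # vs))
                   \<le> \<epsilon> * norm (y - x) * prod_norm vs)))"

lemma smooth_on_iff_derivs_on: "smooth_on S f \<longleftrightarrow> (\<exists>D. derivs_on S f D)"
  unfolding smooth_on_def derivs_on_def by simp

context
  fixes S :: "'e::real_normed_vector set" and f :: "'e \<Rightarrow> 'f::real_normed_vector" and D
  assumes S: "open S" and D: "derivs_on S f D"
begin

lemma derivs_on_0: "x \<in> S \<Longrightarrow> D 0 x [] = f x"
  using D unfolding derivs_on_def by blast

lemma derivs_on_multilinear: "x \<in> S \<Longrightarrow> bounded_multilinear k (D k x)"
  using D unfolding derivs_on_def by blast

lemma derivs_on_estimate:
  assumes x: "x \<in> S" and e: "e > 0"
  shows "\<forall>\<^sub>F y in nhds x. \<forall>vs. length vs = k \<longrightarrow>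
    norm (D k y vs - D k x vs - D (Suc k) x ((y - x) # vs)) \<le> e * norm (y - x) * prod_norm vs"
proof -
  obtain d where d: "d > 0" "\<And>y vs. y \<in> S \<Longrightarrow> norm (y - x) < d \<Longrightarrow> length vs = k \<Longrightarrow>
     norm (D k y vs - D k x vs - D (Suc k) x ((y - x) # vs)) \<le> e * norm (y - x) * prod_norm vs"
    using D x e unfolding derivs_on_def by meson
  have "\<forall>\<^sub>F y in nhds x. y \<in> S" using S x by (simp add: eventually_nhds_in_open)
  moreover have "\<forall>\<^sub>F y in nhds x. norm (y - x) < d"
    using d(1) by (auto simp: eventually_nhds_metric dist_norm)
  ultimately show ?thesis by eventually_elim (use d(2) in blast)
qed

lemma derivs_on_continuous:
  assumes x: "x \<in> S" and e: "e > 0"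
  shows "\<forall>\<^sub>F y in nhds x. \<forall>vs. length vs = k \<longrightarrow> norm (D k y vs - D k x vs) \<le> e * prod_norm vs"
proof -
  obtain K where K: "\<And>vs. length vs = Suc k \<Longrightarrow> norm (D (Suc k) x vs) \<le> K * prod_norm vs"
    using derivs_on_multilinear[OF x, of "Suc k"] unfolding bounded_multilinear_def by blast
  define d where "d = e / (\<bar>K\<bar> + 1)"
  have p: "\<bar>K\<bar> + 1 > 0" by simp
  have d: "d > 0" "(1 + \<bar>K\<bar>) * d = e" unfolding d_def using e p by (auto simp: add.commute)
  have 1: "\<forall>\<^sub>F y in nhds x. norm (y - x) < d"
    using d(1) by (auto simp: eventually_nhds_metric dist_norm)
  from 1 derivs_on_estimate[OF x zero_less_one, of k] show ?thesis
  proof eventually_elim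
    case (elim y)
    show ?case
    proof (intro allI impI)
      fix vs :: "'e list" assume vs: "length vs = k"
      let ?N = "prod_norm vs"
      have N: "?N \<ge> 0" by (rule prod_list_norm_nonneg)
      have "norm (D k y vs - D k x vs) \<le> norm (D k y vs - D k x vs - D (Suc k) x ((y - x) # vs)) +
          norm (D (Suc k) x ((y - x) # vs))"
        using norm_triangle_ineq[of "D k y vs - D k x vs - D (Suc k) x ((y - x) # vs)" "D (Suc k) x
            ((y - x) # vs)"] by simp
      also have "\<dots> \<le> norm (y - x) * ?N + \<bar>K\<bar> * (norm (y - x) * ?N)"
      proof (intro add_mono)
        show "norm (D k y vs - D k x vs - D (Suc k) x ((y - x) # vs)) \<le> norm (y - x) * ?N"
          using elim(2) vs by simp
        have "norm (D (Suc k) x ((y - x) # vs)) \<le> K * (norm (y - x) * ?N)"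
          using K[of "(y - x) # vs"] vs by simp
        also have "\<dots> \<le> \<bar>K\<bar> * (norm (y - x) * ?N)"
          by (rule mult_right_mono) (use N in auto)
        finally show "norm (D (Suc k) x ((y - x) # vs)) \<le> \<bar>K\<bar> * (norm (y - x) * ?N)" .
      qed
      also have "\<dots> = (1 + \<bar>K\<bar>) * norm (y - x) * ?N" by (simp add: algebra_simps)
      also have "\<dots> \<le> (1 + \<bar>K\<bar>) * d * ?N"
        using elim N by (intro mult_right_mono mult_left_mono) auto
      finally show "norm (D k y vs - D k x vs) \<le> e * ?N" using d by simp
    qed
  qed
qed

lemma derivs_on_locally_bounded:
  assumes x: "x \<in> S"
  shows "\<exists>K. \<forall>\<^sub>F y in nhds x. \<forall>vs. length vs = k \<longrightarrow> norm (D k y vs) \<le> K * prod_norm vs"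
proof -
  obtain K where K: "\<And>vs. length vs = k \<Longrightarrow> norm (D k x vs) \<le> K * prod_norm vs"
    using derivs_on_multilinear[OF x, of k] unfolding bounded_multilinear_def by blast
  from derivs_on_continuous[OF x zero_less_one, of k]
  have "\<forall>\<^sub>F y in nhds x. \<forall>vs. length vs = k \<longrightarrow> norm (D k y vs) \<le> (K + 1) * prod_norm vs"
  proof eventually_elim
    case (elim y)
    show ?case
    proof (intro allI impI)
      fix vs :: "'e list" assume vs: "length vs = k"
      have "norm (D k y vs) \<le> norm (D k x vs) + norm (D k y vs - D k x vs)"
        using norm_triangle_ineq[of "D k x vs" "D k y vs - D k x vs"] by simp
      with elim K[OF vs] vs show "norm (D k y vs) \<le> (K + 1) * prod_norm vs"
        by (fastforce simp: distrib_right)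
    qed
  qed
  then show ?thesis by blast
qed

lemma derivs_on_has_derivative:
  assumes x: "x \<in> S" and vs: "length vs = k"
  shows "((\<lambda>y. D k y vs) has_derivative (\<lambda>h. D (Suc k) x (h # vs))) (at x)"
  unfolding has_derivative_at_eventually
proof (intro conjI allI impI)
  show "bounded_linear (\<lambda>h. D (Suc k) x (h # vs))"
    by (rule bounded_multilinear_bounded_linear_hd) (use derivs_on_multilinear[OF x, of "Suc k"] vs in simp)
  fix e :: real assume e: "e > 0"
  define e1 where "e1 = e / (norm (prod_norm vs) + 1)"
  have e1: "e1 > 0" "e1 * prod_norm vs \<le> e"
    using less_divide_norm_add_one[OF e, of "prod_norm vs"] prod_list_norm_nonneg[of vs]
    by (auto simp: e1_def)
  from derivs_on_estimate[OF x e1(1), of k]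
  show "\<forall>\<^sub>F y in nhds x. norm (D k y vs - D k x vs - D (Suc k) x ((y - x) # vs)) \<le> e * norm (y - x)"
  proof eventually_elim
    case (elim y)
    have "norm (D k y vs - D k x vs - D (Suc k) x ((y - x) # vs)) \<le> e1 * norm (y - x) * prod_norm vs"
      using elim vs by simp
    also have "\<dots> \<le> e * norm (y - x)"
      using mult_right_mono[OF e1(2), of "norm (y - x)"] by (simp add: ac_simps)
    finally show ?case .
  qed
qed

text \<open>
  The family of all \<open>x \<mapsto> D k x vs\<close> with bounded directions \<open>vs\<close> has the corresponding family of
  order \<open>k + 1\<close> as its derivative.
\<close>

lemma derivs_on_equi_C:
  "equi_C n S {\<lambda>x. D k x vs |vs. length vs = k \<and> (\<forall>v\<in>set vs. norm v \<le> r)}"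
proof (induction n arbitrary: k r)
  case (0 k r)
  show ?case
    unfolding equi_C.simps locally_bounded_def
  proof
    fix x assume "x \<in> S"
    then obtain K where K: "\<forall>\<^sub>F y in nhds x. \<forall>vs. length vs = k \<longrightarrow> norm (D k y vs) \<le> K * prod_norm vs"
      using derivs_on_locally_bounded by blast
    then have "\<forall>\<^sub>F y in nhds x. \<forall>f\<in>{\<lambda>x. D k x vs |vs. length vs = k \<and> (\<forall>v\<in>set vs. norm v \<le>
        r)}. norm (f y) \<le> \<bar>K\<bar> * \<bar>r\<bar> ^ k"
    proof eventually_elim
      case (elim y)
      have "norm (D k y vs) \<le> \<bar>K\<bar> * \<bar>r\<bar> ^ k" if "length vs = k" "\<forall>v\<in>set vs. norm v \<le> r" for vs
      proof -
        have "norm (D k y vs) \<le> K * prod_norm vs" using elim that by blast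
        also have "\<dots> \<le> \<bar>K\<bar> * \<bar>r\<bar> ^ k"
          using prod_list_norm_le_power[of vs r] that prod_list_norm_nonneg by (intro mult_mono) auto
        finally show ?thesis .
      qed
      then show ?case by blast
    qed
    then show "\<exists>K. \<forall>\<^sub>F y in nhds x. \<forall>f\<in>{\<lambda>x. D k x vs |vs. length vs = k \<and> (\<forall>v\<in>set vs. norm v \<le>
        r)}. norm (f y) \<le> K"
      by blast
  qed
next
  case (Suc n k r)
  let ?F = "\<lambda>k r. {\<lambda>x. D k x vs |vs. length vs = k \<and> (\<forall>v\<in>set vs. norm v \<le> r)}"
  have lb: "locally_bounded S (?F k r)"
    using Suc.IH by (rule equi_C_locally_bounded)
  show ?case
    unfolding equi_C.simps
  proof (intro conjI ballI allI)
    show "locally_bounded S (?F k r)" by (rule lb)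
    show "g differentiable (at x)" if "g \<in> ?F k r" "x \<in> S" for g x
      using that derivs_on_has_derivative unfolding differentiable_def by blast
    fix r'
    show "equi_C n S (dir_derivs (?F k r) r')"
    proof (rule equi_C_cong[OF S _ Suc.IH[of "Suc k" "max r r'"]])
      fix g assume "g \<in> dir_derivs (?F k r) r'"
      then obtain vs v where g: "g = (\<lambda>x. frechet_derivative (\<lambda>x. D k x vs) (at x) v)"
        "length vs = k" "\<forall>v\<in>set vs. norm v \<le> r" "norm v \<le> r'"
        by blast
      have "\<forall>x\<in>S. g x = D (Suc k) x (v # vs)"
        unfolding g using frechet_derivative_eqI[OF derivs_on_has_derivative[OF _ g(2)]] by simp
      moreover have "(\<lambda>x. D (Suc k) x (v # vs)) \<in> ?F (Suc k) (max r r')"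
        using g by (intro CollectI exI[of _ "v # vs"]) (auto simp: le_max_iff_disj)
      ultimately show "\<exists>h\<in>?F (Suc k) (max r r'). \<forall>x\<in>S. g x = h x" by (rule bexI)
    qed
  qed
qed

end

lemma smooth_on_imp_equi_C:
  assumes S: "open S" and f: "smooth_on S f"
  shows "equi_C n S {f}"
proof -
  obtain D where D: "derivs_on S f D" using f smooth_on_iff_derivs_on by blast
  show ?thesis
    by (rule equi_C_cong[OF S _ derivs_on_equi_C[OF S D, of n 0 0]]) (use derivs_on_0[OF S D] in auto)
qed

text \<open>
  A multilinear map bounded by \<open>K\<close> on the unit ball has operator norm at most \<open>K\<close>.
\<close>

lemma multilinear_bound_of_unit:
  assumes "\<And>vs i. length vs = k \<Longrightarrow> i < k \<Longrightarrow> linear (\<lambda>v. T (vs[i := v]))"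
    and "\<And>vs. length vs = k \<Longrightarrow> (\<forall>v\<in>set vs. norm v \<le> 1) \<Longrightarrow> norm (T vs) \<le> K"
    and "length vs = k"
  shows "norm (T vs) \<le> K * prod_norm vs"
  using assms
proof (induction vs arbitrary: T k)
  case Nil
  then show ?case using Nil.prems(2)[of "[]"] by simp
next
  case (Cons v vs)
  obtain j where k: "k = Suc j" and j: "length vs = j" using Cons.prems(3) by auto
  have "linear (\<lambda>w. T ((v # vs)[0 := w]))"
    by (rule Cons.prems(1)) (use k j in auto)
  then have lin: "linear (\<lambda>w. T (w # vs))" by simp
  have "norm v *\<^sub>R sgn v = v" by (cases "v = 0") (simp_all add: sgn_div_norm)
  then have eq: "T (v # vs) = norm v *\<^sub>R T (sgn v # vs)"
    using linear_scale[OF lin, of "norm v" "sgn v"] by simp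
  have "norm (T (sgn v # vs)) \<le> K * prod_norm vs"
  proof (rule Cons.IH[of j])
    show "linear (\<lambda>w. T (sgn v # us[i := w]))" if "length us = j" "i < j" for us i
      using Cons.prems(1)[of "sgn v # us" "Suc i"] that k by simp
    show "norm (T (sgn v # us)) \<le> K" if "length us = j" "\<forall>v\<in>set us. norm v \<le> 1" for us
      by (rule Cons.prems(2)) (use that k in \<open>auto simp: norm_sgn\<close>)
  qed (rule j)
  then show ?case
    unfolding eq using mult_left_mono[OF _ norm_ge_zero, of "norm (T (sgn v # vs))" _ v]
    by (fastforce simp: ac_simps)
qed

text \<open>
  Iterated directional derivative; the head of the list is the direction of the last
  differentiation.
\<close>

primrec iter_deriv :: "('e::real_normed_vector \<Rightarrow> 'f::real_normed_vector) \<Rightarrow> 'e list \<Rightarrow> 'e \<Rightarrow> 'f" where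
  "iter_deriv f [] = f"
| "iter_deriv f (v # vs) = (\<lambda>x. frechet_derivative (iter_deriv f vs) (at x) v)"

lemma norm_le_sum_list: "(v :: 'a::real_normed_vector) \<in> set vs \<Longrightarrow> norm v \<le> (\<Sum>v\<leftarrow>vs. norm v)"
proof (induction vs)
  case (Cons w vs)
  have "0 \<le> (\<Sum>v\<leftarrow>vs. norm v)" by (rule sum_list_nonneg) auto
  then show ?case using Cons by (auto intro: add_increasing)
qed simp

text \<open>
  The derivative inherits linearity in a parameter \<open>w\<close>.
\<close>

lemma linear_frechet_derivative_param:
  fixes g :: "'w::real_normed_vector \<Rightarrow> 'e::real_normed_vector \<Rightarrow> 'f::real_normed_vector"
  assumes S: "open S" "x \<in> S" and lin: "\<And>y. y \<in> S \<Longrightarrow> linear (\<lambda>w. g w y)"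
    and diff: "\<And>w. g w differentiable (at x)"
  shows "linear (\<lambda>w. frechet_derivative (g w) (at x) v)"
proof (rule linearI)
  have D: "(g w has_derivative frechet_derivative (g w) (at x)) (at x)" for w
    using diff by (simp add: frechet_derivative_works[symmetric])
  show "frechet_derivative (g (w + w')) (at x) v = frechet_derivative (g w) (at x) v +
      frechet_derivative (g w') (at x) v" for w w'
  proof -
    have "(g (w + w') has_derivative (\<lambda>v. frechet_derivative (g w) (at x) v +
        frechet_derivative (g w') (at x) v)) (at x)"
      by (rule has_derivative_transform_within_open[OF has_derivative_add[OF D[of w] D[of w']] S])
        (use linear_add[OF lin] in auto)
    from frechet_derivative_eqI[OF this] show ?thesis by simp
  qed
  show "frechet_derivative (g (c *\<^sub>R w)) (at x) v = c *\<^sub>R frechet_derivative (g w) (at x) v" for c w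
  proof -
    have "(g (c *\<^sub>R w) has_derivative (\<lambda>v. c *\<^sub>R frechet_derivative (g w) (at x) v)) (at x)"
      by (rule has_derivative_transform_within_open[OF has_derivative_scaleR_right[OF D[of w]] S])
        (use linear_scale[OF lin] in auto)
    from frechet_derivative_eqI[OF this] show ?thesis by simp
  qed
qed

context
  fixes S :: "'e::real_normed_vector set" and f :: "'e \<Rightarrow> 'f::real_normed_vector"
  assumes S: "open S" and f: "\<And>n. equi_C n S {f}"
begin

lemma iter_deriv_equi_C:
  "equi_C n S {iter_deriv f vs |vs. length vs = k \<and> (\<forall>v\<in>set vs. norm v \<le> r)}"
proof (induction k arbitrary: n)
  case 0
  show ?case by (rule equi_C_mono[OF S _ f[of n]]) auto
next
  case (Suc k)
  let ?F = "{iter_deriv f vs |vs. length vs = k \<and> (\<forall>v\<in>set vs. norm v \<le> r)}"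
  have *: "equi_C n S (dir_derivs (?F) r)"
    using Suc[of "Suc n"] by simp
  show ?case
  proof (rule equi_C_mono[OF S _ *], rule subsetI)
    fix h assume "h \<in> {iter_deriv f vs |vs. length vs = Suc k \<and> (\<forall>v\<in>set vs. norm v \<le> r)}"
    then obtain v vs where "h = iter_deriv f (v # vs)" "length vs = k" "\<forall>v\<in>set (v # vs). norm v \<le> r"
      by (auto simp: length_Suc_conv)
    then show "h \<in> dir_derivs (?F) r"
      by (intro CollectI exI[of _ "iter_deriv f vs"] exI[of _ v]) auto
  qed
qed

lemma iter_deriv_has_derivative:
  assumes "x \<in> S"
  shows "(iter_deriv f vs has_derivative (\<lambda>v. iter_deriv f (v # vs) x)) (at x)"
proof -
  have "iter_deriv f vs \<in> {iter_deriv f us |us. length us = length vs \<and> (\<forall>v\<in>set us. norm v \<le>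
      (\<Sum>v\<leftarrow>vs. norm v))}"
    using norm_le_sum_list by blast
  then have "iter_deriv f vs differentiable (at x)"
    using iter_deriv_equi_C[of "Suc 0" "length vs" "\<Sum>v\<leftarrow>vs. norm v"] assms by fastforce
  then show ?thesis by (simp add: frechet_derivative_works[symmetric])
qed

lemma iter_deriv_linear:
  "x \<in> S \<Longrightarrow> i < length vs \<Longrightarrow> linear (\<lambda>v. iter_deriv f (vs[i := v]) x)"
proof (induction vs arbitrary: i x)
  case (Cons w vs)
  show ?case
  proof (cases i)
    case 0
    show ?thesis
      using bounded_linear.linear[OF has_derivative_bounded_linear[OF iter_deriv_has_derivative[OF
          Cons.prems(1), of vs]]] 0
      by simp
  next
    case (Suc j)
    have "linear (\<lambda>v. frechet_derivative (iter_deriv f (vs[j := v])) (at x) w)"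
    proof (rule linear_frechet_derivative_param[OF S Cons.prems(1)])
      show "linear (\<lambda>v. iter_deriv f (vs[j := v]) y)" if "y \<in> S" for y
        using Cons.IH[OF that, of j] Cons.prems Suc by simp
      show "iter_deriv f (vs[j := v]) differentiable at x" for v
        using iter_deriv_has_derivative[OF Cons.prems(1)] differentiable_def by blast
    qed
    then show ?thesis using Suc by simp
  qed
qed simp

lemma iter_deriv_locally_bounded:
  assumes x: "x \<in> S"
  shows "\<exists>K\<ge>0. \<forall>\<^sub>F y in nhds x. \<forall>vs. length vs = k \<longrightarrow> norm (iter_deriv f vs y) \<le> K * prod_norm vs"
proof -
  obtain K where K: "\<forall>\<^sub>F y in nhds x. \<forall>g\<in>{iter_deriv f vs |vs. length vs = k \<and> (\<forall>v\<in>set vs. norm v \<le>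
      1)}. norm (g y) \<le> K"
    using equi_C_locally_bounded[OF iter_deriv_equi_C] x unfolding locally_bounded_def by blast
  have "\<forall>\<^sub>F y in nhds x. y \<in> S" using S x by (simp add: eventually_nhds_in_open)
  with K have "\<forall>\<^sub>F y in nhds x. \<forall>vs. length vs = k \<longrightarrow> norm (iter_deriv f vs y) \<le> \<bar>K\<bar> * prod_norm vs"
  proof eventually_elim
    case (elim y)
    show ?case
    proof (intro allI impI, rule multilinear_bound_of_unit)
      show "norm (iter_deriv f vs y) \<le> \<bar>K\<bar>" if "length vs = k" "\<forall>v\<in>set vs. norm v \<le> 1" for vs
        using elim(1) that by force
    qed (use iter_deriv_linear elim in auto)
  qed
  then show ?thesis by (intro exI[of _ "\<bar>K\<bar>"]) simp
qed

text \<open>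
  Frechet differentiability in the operator norm. It holds with a quadratic error term, by
  applying the mean value inequality twice, because the derivatives of order \<open>k + 2\<close> are bounded
  near \<open>x\<close>.
\<close>

lemma iter_deriv_estimate:
  assumes x: "x \<in> S" and e: "e > 0"
  shows "\<exists>d>0. \<forall>y\<in>S. norm (y - x) < d \<longrightarrow> (\<forall>vs. length vs = k \<longrightarrow>
    norm (iter_deriv f vs y - iter_deriv f vs x - iter_deriv f ((y - x) # vs) x) \<le>
        e * norm (y - x) * prod_norm vs)"
proof -
  obtain K where K: "K \<ge> 0" "\<forall>\<^sub>F y in nhds x. \<forall>vs. length vs = Suc (Suc k) \<longrightarrow> norm (iter_deriv f vs y)
      \<le> K * prod_norm vs"
    using iter_deriv_locally_bounded[OF x] by blast
  have "\<forall>\<^sub>F y in nhds x. y \<in> S" using S x by (simp add: eventually_nhds_in_open)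
  with K(2) have "\<forall>\<^sub>F y in nhds x. y \<in> S \<and> (\<forall>vs. length vs = Suc (Suc k) \<longrightarrow> norm (iter_deriv f vs y) \<le>
      K * prod_norm vs)"
    by eventually_elim simp
  then obtain d0 where d0: "d0 > 0" "\<And>y. dist y x < d0 \<Longrightarrow> y \<in> S"
    "\<And>y vs. dist y x < d0 \<Longrightarrow> length vs = Suc (Suc k) \<Longrightarrow> norm (iter_deriv f vs y) \<le> K * prod_norm vs"
    unfolding eventually_nhds_metric by blast
  define d where "d = min d0 (e / (K + 1))"
  have d: "d > 0" "d \<le> d0" unfolding d_def using d0 e K by auto
  have "K * d \<le> K * (e / (K + 1))" unfolding d_def using K by (intro mult_left_mono) auto
  also have "\<dots> \<le> e" using K e by (simp add: field_simps)
  finally have Kd: "K * d \<le> e" .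
  show ?thesis
  proof (intro exI[of _ d] conjI ballI allI impI d(1))
    fix y and vs :: "'e list" assume y: "y \<in> S" "norm (y - x) < d" and vs: "length vs = k"
    let ?N = "prod_norm vs"
    have N: "?N \<ge> 0" by (rule prod_list_norm_nonneg)
    define C where "C = cball x (norm (y - x))"
    have C: "convex C" "x \<in> C" "y \<in> C" unfolding C_def by (auto simp: dist_norm norm_minus_commute)
    have CS: "dist z x < d0" "z \<in> S" "norm (z - x) \<le> norm (y - x)" if "z \<in> C" for z
      using that y d d0(2)[of z] unfolding C_def by (auto simp: dist_norm norm_minus_commute)
    \<comment> \<open>first application: Lipschitz bound for the derivative\<close>
    have lip: "norm (iter_deriv f (h # vs) z - iter_deriv f (h # vs) x) \<le> K * (norm h * ?N) * norm (z - x)"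
      if "z \<in> C" for h z
    proof (rule differentiable_bound[OF C(1) _ _ that C(2)])
      fix w assume w: "w \<in> C"
      show "(iter_deriv f (h # vs) has_derivative (\<lambda>v. iter_deriv f (v # h # vs) w)) (at w within C)"
        using iter_deriv_has_derivative[OF CS(2)[OF w]] by (rule has_derivative_at_withinI)
      have "norm (iter_deriv f (v # h # vs) w) \<le> K * (norm h * ?N) * norm v" for v
        using d0(3)[OF CS(1)[OF w], of "v # h # vs"] vs by (simp add: ac_simps)
      then show "onorm (\<lambda>v. iter_deriv f (v # h # vs) w) \<le> K * (norm h * ?N)"
        using K N by (intro onorm_bound) auto
    qed
    have bl: "bounded_linear (\<lambda>v. iter_deriv f (v # vs) x)"
      using iter_deriv_has_derivative[OF x] by (rule has_derivative_bounded_linear)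
    \<comment> \<open>second application, to the difference with the linear approximation\<close>
    let ?\<phi> = "\<lambda>z. iter_deriv f vs z - iter_deriv f (z # vs) x"
    have "norm (?\<phi> y - ?\<phi> x) \<le> (K * norm (y - x) * ?N) * norm (y - x)"
    proof (rule differentiable_bound[OF C(1) _ _ C(3,2)])
      fix z assume z: "z \<in> C"
      show "(?\<phi> has_derivative (\<lambda>h. iter_deriv f (h # vs) z - iter_deriv f (h # vs) x)) (at z within C)"
        by (rule has_derivative_diff[OF has_derivative_at_withinI[OF iter_deriv_has_derivative[OF
            CS(2)[OF z]]]
              bounded_linear_imp_has_derivative[OF bl]])
      show "onorm (\<lambda>h. iter_deriv f (h # vs) z - iter_deriv f (h # vs) x) \<le> K * norm (y - x) * ?N"
      proof (rule onorm_bound)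
        show "0 \<le> K * norm (y - x) * ?N" using K N by simp
        fix h
        have "norm (iter_deriv f (h # vs) z - iter_deriv f (h # vs) x) \<le> K * (norm h * ?N) * norm (z - x)"
          by (rule lip[OF z])
        also have "\<dots> \<le> K * (norm h * ?N) * norm (y - x)"
          using CS(3)[OF z] K N by (intro mult_left_mono) auto
        finally show "norm (iter_deriv f (h # vs) z - iter_deriv f (h # vs) x) \<le>
            K * norm (y - x) * ?N * norm h"
          by (simp only: ac_simps)
      qed
    qed
    also have "?\<phi> y - ?\<phi> x = iter_deriv f vs y - iter_deriv f vs x - iter_deriv f ((y - x) # vs) x"
      using linear_diff[OF bounded_linear.linear[OF bl], of y x] by simp
    also have "K * norm (y - x) * ?N * norm (y - x) = (K * norm (y - x)) * (norm (y - x) * ?N)"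
      by simp
    also have "\<dots> \<le> e * (norm (y - x) * ?N)"
    proof (rule mult_right_mono)
      have "K * norm (y - x) \<le> K * d" using y K by (intro mult_left_mono) auto
      then show "K * norm (y - x) \<le> e" using Kd by simp
    qed (use N in auto)
    finally show "norm (iter_deriv f vs y - iter_deriv f vs x - iter_deriv f ((y - x) # vs) x) \<le>
        e * norm (y - x) * ?N"
      by (simp only: ac_simps)
  qed
qed

lemma equi_C_imp_smooth_on: "smooth_on S f"
  unfolding smooth_on_def
proof (intro exI[of _ "\<lambda>k x vs. iter_deriv f vs x"] conjI ballI allI impI)
  show "iter_deriv f [] x = f x" for x by simp
  show "bounded_multilinear k (\<lambda>vs. iter_deriv f vs x)" if "x \<in> S" for k x
    unfolding bounded_multilinear_def
  proof (intro conjI allI impI)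
    show "linear (\<lambda>v. iter_deriv f (vs[i := v]) x)" if "length vs = k" "i < k" for vs i
      using iter_deriv_linear \<open>x \<in> S\<close> that by simp
    show "\<exists>K. \<forall>vs. length vs = k \<longrightarrow> norm (iter_deriv f vs x) \<le> K * prod_norm vs"
      using iter_deriv_locally_bounded[OF that, of k] eventually_nhds_x_imp_x by blast
  qed
  show "\<exists>d>0. \<forall>y\<in>S. norm (y - x) < d \<longrightarrow> (\<forall>vs. length vs = k \<longrightarrow>
    norm (iter_deriv f vs y - iter_deriv f vs x - iter_deriv f ((y - x) # vs) x) \<le>
        e * norm (y - x) * prod_norm vs)"
    if "x \<in> S" "e > 0" for k x e
    using iter_deriv_estimate that by blast
qed

end

theorem smooth_on_iff_equi_C: "open S \<Longrightarrow> smooth_on S f \<longleftrightarrow> (\<forall>n. equi_C n S {f})"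
  using smooth_on_imp_equi_C equi_C_imp_smooth_on by blast

section \<open>Composition, derivatives and germs of smooth maps\<close>

lemma equi_C_singleton_has_derivative:
  assumes "equi_C (Suc n) S {f}" "x \<in> S"
  shows "(f has_derivative frechet_derivative f (at x)) (at x)"
  using assms by (simp add: frechet_derivative_works[symmetric])

lemma has_derivative_tendsto_nhds: "(f has_derivative f') (at x) \<Longrightarrow> (f \<longlongrightarrow> f x) (nhds x)"
  by (drule has_derivative_continuous) (simp add: continuous_within tendsto_at_iff_tendsto_nhds)

context
  fixes S :: "'e::real_normed_vector set" and T :: "'f::real_normed_vector set"
    and f :: "'e \<Rightarrow> 'f" and g :: "'f \<Rightarrow> 'g::real_normed_vector" and D
  assumes S: "open S" and T: "open T" and D: "derivs_on T g D"
    and f: "\<And>n. equi_C n S {f}" and fT: "f ` S \<subseteq> T"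
begin

lemma compose_args_locally_bounded:
  assumes A: "locally_bounded S A"
  shows "locally_bounded S {\<lambda>x. D m (f x) (map (\<lambda>a. a x) as) |as. length as = m \<and> set as \<subseteq> A}"
  unfolding locally_bounded_def
proof
  fix x assume x: "x \<in> S"
  have tends: "(f \<longlongrightarrow> f x) (nhds x)"
    by (rule has_derivative_tendsto_nhds[OF equi_C_singleton_has_derivative[OF f x]])
  obtain K where "\<forall>\<^sub>F z in nhds (f x). \<forall>vs. length vs = m \<longrightarrow> norm (D m z vs) \<le> K * prod_norm vs"
    using derivs_on_locally_bounded[OF T D, of "f x"] x fT by blast
  then have 1: "\<forall>\<^sub>F y in nhds x. \<forall>vs. length vs = m \<longrightarrow> norm (D m (f y) vs) \<le> K * prod_norm vs"
    by (rule eventually_compose_filterlim[OF _ tends])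
  obtain L where 2: "\<forall>\<^sub>F y in nhds x. \<forall>a\<in>A. norm (a y) \<le> L"
    using A x unfolding locally_bounded_def by blast
  from 1 2 have "\<forall>\<^sub>F y in nhds x. \<forall>h\<in>{\<lambda>x. D m (f x) (map (\<lambda>a. a x) as) |as. length as = m \<and> set as \<subseteq>
      A}. norm (h y) \<le> \<bar>K\<bar> * \<bar>L\<bar> ^ m"
  proof eventually_elim
    case (elim y)
    have "norm (D m (f y) (map (\<lambda>a. a y) as)) \<le> \<bar>K\<bar> * \<bar>L\<bar> ^ m" if as: "length as = m" "set as \<subseteq> A" for as
    proof -
      let ?vs = "map (\<lambda>a. a y) as"
      have "norm (D m (f y) ?vs) \<le> K * prod_norm ?vs"
        using elim(1)[rule_format, of ?vs] as(1) by simp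
      also have "\<dots> \<le> \<bar>K\<bar> * \<bar>L\<bar> ^ m"
      proof (intro mult_mono)
        show "prod_norm ?vs \<le> \<bar>L\<bar> ^ m"
          using prod_list_norm_le_power[of ?vs L] elim(2) as by auto
      qed (use prod_list_norm_nonneg[of ?vs] in auto)
      finally show ?thesis .
    qed
    then show ?case by blast
  qed
  then show "\<exists>K. \<forall>\<^sub>F y in nhds x. \<forall>h\<in>{\<lambda>x. D m (f x) (map (\<lambda>a. a x) as) |as. length as = m \<and> set as \<subseteq>
      A}. norm (h y) \<le> K"
    by blast
qed

lemma compose_args_has_derivative:
  assumes x: "x \<in> S" and d: "\<And>a. a \<in> set as \<Longrightarrow> (a has_derivative d a) (at x)"
  shows "((\<lambda>y. D (length as) (f y) (map (\<lambda>a. a y) as)) has_derivative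
     (\<lambda>h. D (Suc (length as)) (f x) (frechet_derivative f (at x) h # map (\<lambda>a. a x) as) +
       (\<Sum>i<length as. D (length as) (f x) ((map (\<lambda>a. a x) as)[i := d (as ! i) h])))) (at x)"
proof -
  let ?m = "length as"
  have fx: "f x \<in> T" using x fT by blast
  have df: "(f has_derivative frechet_derivative f (at x)) (at x)"
    by (rule equi_C_singleton_has_derivative[OF f x])
  have tends: "(f \<longlongrightarrow> f x) (nhds x)" by (rule has_derivative_tendsto_nhds[OF df])
  obtain K where K: "\<forall>\<^sub>F z in nhds (f x). \<forall>vs. length vs = ?m \<longrightarrow> norm (D ?m z vs) \<le> K * prod_norm vs"
    using derivs_on_locally_bounded[OF T D fx] by blast
  have "\<forall>\<^sub>F z in nhds (f x). z \<in> T" using T fx by (simp add: eventually_nhds_in_open)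
  then have "\<forall>\<^sub>F z in nhds (f x). bounded_multilinear ?m (D ?m z)"
    by eventually_elim (rule derivs_on_multilinear[OF T D])
  from eventually_compose_filterlim[OF this tends]
  show ?thesis
  proof (rule multilinear_has_derivative)
    show "\<forall>\<^sub>F y in nhds x. \<forall>vs. length vs = ?m \<longrightarrow> norm (D ?m (f y) vs) \<le> K * prod_norm vs"
      by (rule eventually_compose_filterlim[OF K tends])
    show "\<forall>\<^sub>F y in nhds x. \<forall>vs. length vs = ?m \<longrightarrow> norm (D ?m (f y) vs - D ?m (f x) vs) \<le> e * prod_norm vs"
      if "e > 0" for e
      by (rule eventually_compose_filterlim[OF derivs_on_continuous[OF T D fx that] tends])
    show "((\<lambda>y. D ?m (f y) vs) has_derivative (\<lambda>h. D (Suc ?m) (f x) (frechet_derivative f (at x) h #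
        vs))) (at x)"
      if "length vs = ?m" for vs
      using has_derivative_compose[OF df derivs_on_has_derivative[OF T D fx that]] .
  qed (fact d)
qed

text \<open>
  The heart of the chain rule for all orders. The maps \<open>x \<mapsto> D\<^sup>mg(f(x))(a\<^sub>1(x), \<dots>, a\<^sub>m(x))\<close> with
  \<open>a\<^sub>i\<close> in an equi-smooth family \<open>A\<close> are equi-smooth: a derivative of such a map is a sum of
  \<open>m + 1\<close> maps of the same kind, of which one has order \<open>m + 1\<close>, and whose arguments lie in \<open>A\<close> or
  are derivatives of members of \<open>A\<close> or of \<open>f\<close>. The composite \<open>g \<circ> f\<close> itself is the case \<open>m = 0\<close>.
\<close>

lemma compose_args_equi_C:
  "equi_C n S A \<Longrightarrow> equi_C n S {\<lambda>x. D m (f x) (map (\<lambda>a. a x) as) |as. length as = m \<and> set as \<subseteq> A}"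
proof (induction n arbitrary: m A)
  case 0
  then show ?case using compose_args_locally_bounded by simp
next
  case (Suc n)
  let ?C = "\<lambda>m A. {\<lambda>x. D m (f x) (map (\<lambda>a. a x) as) |as. length as = m \<and> set as \<subseteq> A}"
  let ?d = "\<lambda>a x. frechet_derivative a (at x)"
  have d: "(a has_derivative ?d a x) (at x)" if "a \<in> A" "x \<in> S" for a x
    using Suc.prems that by (simp add: frechet_derivative_works[symmetric])
  have der: "((\<lambda>y. D m (f y) (map (\<lambda>a. a y) as)) has_derivative
     (\<lambda>h. D (Suc m) (f x) (?d f x h # map (\<lambda>a. a x) as) +
       (\<Sum>i<m. D m (f x) ((map (\<lambda>a. a x) as)[i := ?d (as ! i) x h])))) (at x)"
    if "x \<in> S" "length as = m" "set as \<subseteq> A" for x as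
    using compose_args_has_derivative[OF that(1), of as "\<lambda>a. ?d a x"] d that by blast
  show ?case
    unfolding equi_C.simps
  proof (intro conjI ballI allI)
    show "locally_bounded S (?C m A)"
      by (rule compose_args_locally_bounded[OF equi_C_locally_bounded[OF Suc.prems]])
    show "h differentiable (at x)" if "h \<in> ?C m A" "x \<in> S" for h x
      using that der unfolding differentiable_def by blast
    fix r
    \<comment> \<open>all arguments that occur after one differentiation\<close>
    define A' where "A' = A \<union> {\<lambda>x. ?d a x v |a v. a \<in> A \<and> norm v \<le> r} \<union> {\<lambda>x. ?d a x v |a v. a \<in> {f} \<and>
        norm v \<le> r}"
    have A': "equi_C n S A'"
      unfolding A'_def using Suc.prems equi_C_SucD[OF Suc.prems] f[of "Suc n"]
      by (intro equi_C_Un[OF S]) auto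
    show "equi_C n S (dir_derivs (?C m A) r)"
    proof (rule equi_C_cong[OF S _ equi_C_add[OF S Suc.IH[OF A', of "Suc m"] equi_C_sum[OF S Suc.IH[OF
        A', of m], of m]]])
      fix k assume "k \<in> dir_derivs (?C m A) r"
      then obtain as v where k: "k = (\<lambda>x. frechet_derivative (\<lambda>x. D m (f x) (map (\<lambda>a. a x) as)) (at x) v)"
        and as: "length as = m" "set as \<subseteq> A" and v: "norm v \<le> r"
        by blast
      let ?k1 = "\<lambda>x. D (Suc m) (f x) (map (\<lambda>a. a x) ((\<lambda>x. ?d f x v) # as))"
      let ?k2 = "\<lambda>i x. D m (f x) (map (\<lambda>a. a x) (as[i := (\<lambda>x. ?d (as ! i) x v)]))"
      have "\<forall>x\<in>S. k x = ?k1 x + (\<Sum>i<m. ?k2 i x)"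
        unfolding k using frechet_derivative_eqI[OF der[OF _ as]] by (simp add: map_update)
      moreover have k1: "?k1 \<in> ?C (Suc m) A'"
      proof (intro CollectI exI conjI)
        show "set ((\<lambda>x. ?d f x v) # as) \<subseteq> A'" using as v unfolding A'_def by auto
      qed (use as in auto)
      have k2: "?k2 i \<in> ?C m A'" if "i < m" for i
      proof (intro CollectI exI conjI)
        have "(\<lambda>x. ?d (as ! i) x v) \<in> A'" using as v that nth_mem[of i as] unfolding A'_def by blast
        then show "set (as[i := (\<lambda>x. ?d (as ! i) x v)]) \<subseteq> A'"
          using as set_update_subset_insert[of as i] unfolding A'_def by blast
      qed (use as in auto)
      have "(\<lambda>x. \<Sum>i<m. ?k2 i x) \<in> {\<lambda>x. \<Sum>i<m. h i x |h. \<forall>i<m. h i \<in> ?C m A'}"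
        by (rule CollectI, rule exI[of _ ?k2]) (use k2 in blast)
      from pointwise_add_memI[OF k1 this]
      have "(\<lambda>x. ?k1 x + (\<Sum>i<m. ?k2 i x)) \<in> {\<lambda>x. f x + g x |f g. f \<in> ?C (Suc m) A' \<and>
          g \<in> {\<lambda>x. \<Sum>i<m. h i x |h. \<forall>i<m. h i \<in> ?C m A'}}" .
      ultimately show "\<exists>g\<in>{\<lambda>x. f x + g x |f g. f \<in> ?C (Suc m) A' \<and> g \<in> {\<lambda>x. \<Sum>i<m. h i x |h. \<forall>i<m. h i
          \<in> ?C m A'}}. \<forall>x\<in>S. k x = g x"
        by (rule bexI)
    qed
  qed
qed

end

theorem smooth_on_compose:
  fixes f :: "'e::real_normed_vector \<Rightarrow> 'f::real_normed_vector" and g :: "'f \<Rightarrow> 'g::real_normed_vector"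
  assumes S: "open S" and T: "open T" and f: "smooth_on S f" and g: "smooth_on T g" and fT: "f ` S \<subseteq> T"
  shows "smooth_on S (\<lambda>x. g (f x))"
proof -
  obtain D where D: "derivs_on T g D" using g smooth_on_iff_derivs_on by blast
  have f': "equi_C n S {f}" for n by (rule smooth_on_imp_equi_C[OF S f])
  have e: "equi_C n S ({} :: ('e \<Rightarrow> 'f) set)" for n by (rule equi_C_mono[OF S _ f']) simp
  have "equi_C n S {\<lambda>x. g (f x)}" for n
    by (rule equi_C_cong[OF S _ compose_args_equi_C[OF S T D f' fT e, of n 0]])
      (use derivs_on_0[OF T D] fT in auto)
  then show ?thesis using smooth_on_iff_equi_C[OF S] by blast
qed

text \<open>
  If \<open>D k\<close> are the derivatives of \<open>f\<close>, those of \<open>f'\<close> are \<open>vs \<mapsto> (v \<mapsto> D (k + 1) x (vs, v))\<close>: the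
  argument of the operator comes last.
\<close>

theorem smooth_on_derivative:
  fixes f :: "'e::real_normed_vector \<Rightarrow> 'f::real_normed_vector"
  assumes S: "open S" and f: "smooth_on S f"
  shows "smooth_on S (\<lambda>x. Blinfun (frechet_derivative f (at x)))"
proof -
  obtain D where D: "derivs_on S f D" using f smooth_on_iff_derivs_on by blast
  let ?D = "\<lambda>k x vs. Blinfun (\<lambda>v. D (Suc k) x (vs @ [v]))"
  have bl: "bounded_linear (\<lambda>v. D (Suc k) x (vs @ [v]))" if "x \<in> S" "length vs = k" for k x vs
    using bounded_multilinear_bounded_linear_nth[of vs "[]" "D (Suc k) x"] derivs_on_multilinear[OF S
        D that(1)] that(2)
    by simp
  note app = bounded_linear_Blinfun_apply[OF bl]
  show ?thesis
    unfolding smooth_on_def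
  proof (intro exI[of _ ?D] conjI ballI allI impI)
    show "?D 0 x [] = Blinfun (frechet_derivative f (at x))" if x: "x \<in> S" for x
    proof -
      have "(f has_derivative (\<lambda>v. D (Suc 0) x [v])) (at x)"
        by (rule has_derivative_transform_within_open[OF derivs_on_has_derivative[OF S D x, of "[]" 0] S x])
          (use derivs_on_0[OF S D] in auto)
      then show ?thesis using frechet_derivative_eqI by force
    qed
  next
    fix k x assume x: "x \<in> S"
    note ml = derivs_on_multilinear[OF S D x, of "Suc k"]
    show "bounded_multilinear k (?D k x)"
      unfolding bounded_multilinear_def
    proof (intro conjI allI impI)
      fix vs :: "'e list" and i assume vs: "length vs = k" "i < k"
      have lin: "linear (\<lambda>v. D (Suc k) x (vs[i := v] @ [w]))" for w
      proof -
        have "linear (\<lambda>v. D (Suc k) x ((vs @ [w])[i := v]))"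
          using ml vs unfolding bounded_multilinear_def by (auto simp del: list_update_append)
        then show ?thesis using vs by (simp add: list_update_append1)
      qed
      show "linear (\<lambda>v. ?D k x (vs[i := v]))"
      proof -
        have A: "blinfun_apply (?D k x (vs[i := u])) w = D (Suc k) x (vs[i := u] @ [w])" for u w
          by (rule fun_cong[OF app[OF x, of "vs[i := u]" k]]) (simp add: vs)
        show ?thesis
          by (rule linearI; rule blinfun_eqI;
              simp only: A blinfun.add_left blinfun.scaleR_left;
              simp only: linear_add[OF lin] linear_scale[OF lin])
      qed
    next
      obtain K where K: "\<And>vs. length vs = Suc k \<Longrightarrow> norm (D (Suc k) x vs) \<le> K * prod_norm vs"
        using ml unfolding bounded_multilinear_def by blast
      have "norm (?D k x vs) \<le> \<bar>K\<bar> * prod_norm vs" if vs: "length vs = k" for vs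
      proof (rule norm_blinfun_bound)
        show "0 \<le> \<bar>K\<bar> * prod_norm vs" using prod_list_norm_nonneg[of vs] by simp
        fix w
        have "norm (D (Suc k) x (vs @ [w])) \<le> K * (prod_norm vs * norm w)"
          using K[of "vs @ [w]"] vs by simp
        also have "\<dots> \<le> \<bar>K\<bar> * (prod_norm vs * norm w)"
          using prod_list_norm_nonneg[of vs] by (intro mult_right_mono) auto
        finally show "norm (blinfun_apply (?D k x vs) w) \<le> \<bar>K\<bar> * prod_norm vs * norm w"
          by (simp add: app x vs ac_simps)
      qed
      then show "\<exists>K. \<forall>vs. length vs = k \<longrightarrow> norm (?D k x vs) \<le> K * prod_norm vs" by blast
    qed
  next
    fix k x and e :: real assume x: "x \<in> S" and e: "e > 0"
    obtain d where d: "d > 0" "\<And>y vs. y \<in> S \<Longrightarrow> norm (y - x) < d \<Longrightarrow> length vs = Suc k \<Longrightarrow>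
        norm (D (Suc k) y vs - D (Suc k) x vs - D (Suc (Suc k)) x ((y - x) # vs)) \<le>
            e * norm (y - x) * prod_norm vs"
      using D x e unfolding derivs_on_def by meson
    show "\<exists>d>0. \<forall>y\<in>S. norm (y - x) < d \<longrightarrow> (\<forall>vs. length vs = k \<longrightarrow>
        norm (?D k y vs - ?D k x vs - ?D (Suc k) x ((y - x) # vs)) \<le> e * norm (y - x) * prod_norm vs)"
    proof (intro exI[of _ d] conjI ballI allI impI d(1))
      fix y and vs :: "'e list" assume y: "y \<in> S" "norm (y - x) < d" and vs: "length vs = k"
      show "norm (?D k y vs - ?D k x vs - ?D (Suc k) x ((y - x) # vs)) \<le> e * norm (y - x) * prod_norm vs"
      proof (rule norm_blinfun_bound)
        show "0 \<le> e * norm (y - x) * prod_norm vs" using e prod_list_norm_nonneg[of vs] by simp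
        fix w
        show "norm (blinfun_apply (?D k y vs - ?D k x vs - ?D (Suc k) x ((y - x) # vs)) w)
           \<le> e * norm (y - x) * prod_norm vs * norm w"
          using d(2)[OF y, of "vs @ [w]"] vs app[OF x, of "(y - x) # vs" "Suc k"]
          by (simp add: app x y vs blinfun.diff_left ac_simps)
      qed
    qed
  qed
qed

lemma derivs_on_subset:
  assumes D: "derivs_on S f D" and "T \<subseteq> S" "\<And>x. x \<in> T \<Longrightarrow> f x = g x"
  shows "derivs_on T g D"
  unfolding derivs_on_def
proof (intro conjI allI ballI impI)
  fix k x assume x: "x \<in> T"
  then have xS: "x \<in> S" using assms by blast
  show "D 0 x [] = g x" using D x xS assms(3) unfolding derivs_on_def by simp
  show "bounded_multilinear k (D k x)" using D xS unfolding derivs_on_def by blast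
  fix e :: real assume "e > 0"
  then obtain d where d: "d > 0" "\<forall>y\<in>S. norm (y - x) < d \<longrightarrow> (\<forall>vs. length vs = k \<longrightarrow>
        norm (D k y vs - D k x vs - D (Suc k) x ((y - x) # vs)) \<le> e * norm (y - x) * prod_norm vs)"
    using D xS unfolding derivs_on_def by blast
  show "\<exists>d>0. \<forall>y\<in>T. norm (y - x) < d \<longrightarrow> (\<forall>vs. length vs = k \<longrightarrow>
        norm (D k y vs - D k x vs - D (Suc k) x ((y - x) # vs)) \<le> e * norm (y - x) * prod_norm vs)"
    using d assms(2) by (intro exI[of _ d]) auto
qed

lemma smooth_on_subset: "smooth_on S f \<Longrightarrow> T \<subseteq> S \<Longrightarrow> smooth_on T f"
  unfolding smooth_on_iff_derivs_on using derivs_on_subset by metis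

lemma smooth_on_cong: "smooth_on S f \<Longrightarrow> (\<And>x. x \<in> S \<Longrightarrow> f x = g x) \<Longrightarrow> smooth_on S g"
  unfolding smooth_on_iff_derivs_on using derivs_on_subset[OF _ order_refl] by metis

lemma locally_bounded_locally:
  assumes "\<And>x. x \<in> S \<Longrightarrow> \<exists>T. x \<in> T \<and> locally_bounded T F"
  shows "locally_bounded S F"
  unfolding locally_bounded_def
proof
  fix x assume "x \<in> S"
  then obtain T where x: "x \<in> T" and T: "locally_bounded T F" using assms by blast
  show "\<exists>K. \<forall>\<^sub>F y in nhds x. \<forall>f\<in>F. norm (f y) \<le> K"
    by (rule bspec[OF T[unfolded locally_bounded_def] x])
qed

text \<open>
  Unlike the definition of smoothness by a sequence of derivatives, \<open>equi_C\<close> is visibly local.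
\<close>

lemma equi_C_locally:
  assumes "\<And>x. x \<in> S \<Longrightarrow> \<exists>T. x \<in> T \<and> equi_C n T F"
  shows "equi_C n S F"
  using assms
proof (induction n arbitrary: F)
  case 0
  then show ?case unfolding equi_C.simps by (rule locally_bounded_locally)
next
  case (Suc n)
  show ?case
    unfolding equi_C.simps
  proof (intro conjI ballI allI)
    show "locally_bounded S F"
    proof (rule locally_bounded_locally)
      fix x assume "x \<in> S"
      then obtain T where "x \<in> T" "equi_C (Suc n) T F" using Suc.prems[OF \<open>x \<in> S\<close>] by (elim exE conjE)
      then show "\<exists>T. x \<in> T \<and> locally_bounded T F" using equi_C_locally_bounded by (intro exI conjI)
    qed
    show "f differentiable (at x)" if fF: "f \<in> F" and xS: "x \<in> S" for f x
    proof -
      obtain T where "x \<in> T" "equi_C (Suc n) T F" using Suc.prems[OF xS] by (elim exE conjE)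
      then show ?thesis using fF by simp
    qed
    show "equi_C n S (dir_derivs F r)" for r
    proof (rule Suc.IH)
      fix x assume "x \<in> S"
      then obtain T where T: "x \<in> T" "equi_C (Suc n) T F" using Suc.prems[OF \<open>x \<in> S\<close>] by (elim exE conjE)
      then have "equi_C n T (dir_derivs F r)"
        by simp
      with T(1) show "\<exists>T. x \<in> T \<and> equi_C n T (dir_derivs F r)"
        by (intro exI conjI)
    qed
  qed
qed

text \<open>
  The germ of \<open>f\<close> at \<open>x\<close> is smooth.
\<close>

definition smooth_near :: "('e::real_normed_vector \<Rightarrow> 'f::real_normed_vector) \<Rightarrow> 'e \<Rightarrow> bool" where
  "smooth_near f x \<longleftrightarrow> (\<exists>S. open S \<and> x \<in> S \<and> smooth_on S f)"

lemma smooth_on_iff_smooth_near: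
  assumes S: "open S"
  shows "smooth_on S f \<longleftrightarrow> (\<forall>x\<in>S. smooth_near f x)"
proof
  assume *: "\<forall>x\<in>S. smooth_near f x"
  have "equi_C n S {f}" for n
  proof (rule equi_C_locally)
    fix x assume "x \<in> S"
    then obtain T where "open T" "x \<in> T" "smooth_on T f" using * unfolding smooth_near_def by blast
    then show "\<exists>T. x \<in> T \<and> equi_C n T {f}" using smooth_on_imp_equi_C by blast
  qed
  then show "smooth_on S f" using smooth_on_iff_equi_C[OF S] by blast
qed (use S in \<open>auto simp: smooth_near_def\<close>)

lemma eventually_smooth_near: "smooth_near f x \<Longrightarrow> \<forall>\<^sub>F y in nhds x. smooth_near f y"
  unfolding smooth_near_def eventually_nhds by blast

lemma smooth_near_cong:
  assumes "smooth_near f x" "\<forall>\<^sub>F y in nhds x. f y = g y"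
  shows "smooth_near g x"
proof -
  obtain S T where "open S" "x \<in> S" "smooth_on S f" "open T" "x \<in> T" "\<forall>y\<in>T. f y = g y"
    using assms unfolding smooth_near_def eventually_nhds by blast
  then have "open (S \<inter> T)" "x \<in> S \<inter> T" "smooth_on (S \<inter> T) g"
    using smooth_on_cong[OF smooth_on_subset[of S f "S \<inter> T"]] by auto
  then show ?thesis unfolding smooth_near_def by blast
qed

lemma smooth_near_has_derivative:
  assumes "smooth_near f x"
  shows "(f has_derivative frechet_derivative f (at x)) (at x)"
proof -
  obtain S where S: "open S" "x \<in> S" "smooth_on S f" using assms unfolding smooth_near_def by blast
  show ?thesis by (rule equi_C_singleton_has_derivative[OF smooth_on_imp_equi_C[OF S(1,3)] S(2)])
qed

lemma smooth_near_tendsto: "smooth_near f x \<Longrightarrow> (f \<longlongrightarrow> f x) (nhds x)"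
  by (rule has_derivative_tendsto_nhds[OF smooth_near_has_derivative])

lemma smooth_near_compose:
  assumes f: "smooth_near f x" and g: "smooth_near g (f x)"
  shows "smooth_near (\<lambda>y. g (f y)) x"
proof -
  obtain S where S: "open S" "x \<in> S" "smooth_on S f" using f unfolding smooth_near_def by blast
  obtain T where T: "open T" "f x \<in> T" "smooth_on T g" using g unfolding smooth_near_def by blast
  have "\<forall>\<^sub>F y in nhds x. f y \<in> T"
    using smooth_near_tendsto[OF f] T by (simp add: tendsto_def)
  then obtain R where R: "open R" "x \<in> R" "\<forall>y\<in>R. f y \<in> T" unfolding eventually_nhds by blast
  have o: "open (S \<inter> R)" using S R by blast
  have "smooth_on (S \<inter> R) (\<lambda>y. g (f y))"
    by (rule smooth_on_compose[OF o T(1) smooth_on_subset[OF S(3)] T(3)]) (use R in auto)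
  then show ?thesis unfolding smooth_near_def using o S R by blast
qed

lemma smooth_near_bounded_linear:
  assumes L: "bounded_linear L"
  shows "smooth_near L x"
proof -
  obtain B where B: "B \<ge> 0" "\<And>x. norm (L x) \<le> norm x * B"
    using bounded_linear.nonneg_bounded[OF L] by blast
  have lb: "locally_bounded UNIV {L}"
    unfolding locally_bounded_def
  proof
    fix x
    have "\<forall>\<^sub>F y in nhds x. norm (L y) \<le> norm (L x) + 1"
      using eventually_le_of_tendsto[OF tendsto_norm[OF has_derivative_tendsto_nhds[OF
          bounded_linear_imp_has_derivative[OF L]]], of x]
      by simp
    then show "\<exists>K. \<forall>\<^sub>F y in nhds x. \<forall>f\<in>{L}. norm (f y) \<le> K" by auto
  qed
  have "equi_C n UNIV {L}" for n
  proof (cases n)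
    case (Suc m)
    have "equi_C (Suc m) UNIV {L}"
    proof (rule equi_C_SucI[OF open_UNIV lb, where f' = "\<lambda>f x. L"])
      show "(f has_derivative L) (at x)" if "f \<in> {L}" for f x
        using that bounded_linear_imp_has_derivative[OF L] by simp
      fix r
      have "norm (L v) \<le> r * B" if "norm v \<le> r" for v
        using B(2)[of v] mult_right_mono[OF that B(1)] by linarith
      then show "equi_C m UNIV {\<lambda>x. L v |f v. f \<in> {L} \<and> norm v \<le> r}"
        by (intro equi_C_mono[OF open_UNIV _ equi_C_const[OF open_UNIV, of m "r * B"]]) auto
    qed
    then show ?thesis using Suc by simp
  qed (use lb in simp)
  then have "smooth_on UNIV L" using smooth_on_iff_equi_C[OF open_UNIV] by blast
  then show ?thesis unfolding smooth_near_def by blast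
qed

lemma smooth_near_ident: "smooth_near (\<lambda>x. x) x"
  by (rule smooth_near_bounded_linear[OF bounded_linear_ident])

lemma smooth_near_const: "smooth_near (\<lambda>x. c) x"
proof -
  have "equi_C n UNIV {\<lambda>x. c}" for n
    by (rule equi_C_mono[OF open_UNIV _ equi_C_const[OF open_UNIV, of n "norm c"]]) auto
  then show ?thesis unfolding smooth_near_def using smooth_on_iff_equi_C[OF open_UNIV] by blast
qed

lemma smooth_near_bilinear:
  assumes b: "bounded_bilinear b" and f: "smooth_near f x" and g: "smooth_near g x"
  shows "smooth_near (\<lambda>y. b (f y) (g y)) x"
proof -
  obtain S where S: "open S" "x \<in> S" "smooth_on S f" using f unfolding smooth_near_def by blast
  obtain T where T: "open T" "x \<in> T" "smooth_on T g" using g unfolding smooth_near_def by blast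
  have o: "open (S \<inter> T)" using S T by blast
  have "equi_C n (S \<inter> T) {\<lambda>y. b (f y) (g y)}" for n
    by (rule equi_C_mono[OF o _ equi_C_bilinear[OF o b smooth_on_imp_equi_C[OF o,
        of f] smooth_on_imp_equi_C[OF o, of g]]])
      (use S T in \<open>auto intro: smooth_on_subset\<close>)
  then show ?thesis unfolding smooth_near_def using smooth_on_iff_equi_C[OF o] o S T by blast
qed

lemma smooth_near_add:
  assumes f: "smooth_near f x" and g: "smooth_near g x"
  shows "smooth_near (\<lambda>y. f y + g y) x"
proof -
  obtain S where S: "open S" "x \<in> S" "smooth_on S f" using f unfolding smooth_near_def by blast
  obtain T where T: "open T" "x \<in> T" "smooth_on T g" using g unfolding smooth_near_def by blast
  have o: "open (S \<inter> T)" using S T by blast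
  have "equi_C n (S \<inter> T) {\<lambda>y. f y + g y}" for n
    by (rule equi_C_mono[OF o _ equi_C_add[OF o smooth_on_imp_equi_C[OF o,
        of f] smooth_on_imp_equi_C[OF o, of g]]])
      (use S T in \<open>auto intro: smooth_on_subset\<close>)
  then show ?thesis unfolding smooth_near_def using smooth_on_iff_equi_C[OF o] o S T by blast
qed

lemma smooth_near_Pair:
  assumes f: "smooth_near f x" and g: "smooth_near g x"
  shows "smooth_near (\<lambda>y. (f y, g y)) x"
proof -
  have "smooth_near (\<lambda>y. (f y, 0) + (0, g y)) x"
    by (intro smooth_near_add smooth_near_compose[OF f, of "\<lambda>z. (z, 0)"] smooth_near_compose[OF g,
        of "\<lambda>z. (0, z)"]
          smooth_near_bounded_linear bounded_linear_Pair bounded_linear_ident bounded_linear_zero)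
  then show ?thesis by simp
qed

lemma smooth_near_derivative:
  assumes "smooth_near f x"
  shows "smooth_near (\<lambda>y. Blinfun (frechet_derivative f (at y))) x"
proof -
  obtain S where "open S" "x \<in> S" "smooth_on S f" using assms unfolding smooth_near_def by blast
  then show ?thesis unfolding smooth_near_def by (intro exI[of _ S]) (simp add: smooth_on_derivative)
qed

lemma Blinfun_derivative_apply:
  "smooth_near f x \<Longrightarrow> blinfun_apply (Blinfun (frechet_derivative f (at x))) v =
      frechet_derivative f (at x) v"
  by (rule fun_cong[OF bounded_linear_Blinfun_apply[OF has_derivative_bounded_linear[OF
      smooth_near_has_derivative]]])

text \<open>
  The partial derivative in the second variable, evaluated along a smooth map \<open>z\<close>, is a smooth
  operator-valued map.
\<close>

lemma smooth_near_partial_derivative: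
  fixes K :: "'a::real_normed_vector \<times> 'b::real_normed_vector \<Rightarrow> 'c::real_normed_vector"
  assumes K: "smooth_near K (y0, z y0)" and z: "smooth_near z y0"
  shows "\<forall>\<^sub>F y in nhds y0. smooth_near (\<lambda>w. K (y, w)) (z y)"
    and "smooth_near (\<lambda>y. Blinfun (frechet_derivative (\<lambda>w. K (y, w)) (at (z y)))) y0"
proof -
  have yz: "smooth_near (\<lambda>y. (y, z y)) y0" by (rule smooth_near_Pair[OF smooth_near_ident z])
  have K': "\<forall>\<^sub>F y in nhds y0. smooth_near K (y, z y)"
    using eventually_compose_filterlim[OF eventually_smooth_near[OF K] smooth_near_tendsto[OF yz]] .
  have part: "smooth_near (\<lambda>w. (y, w)) w" for y :: 'a and w :: 'b
    by (rule smooth_near_Pair[OF smooth_near_const smooth_near_ident])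
  from K' show "\<forall>\<^sub>F y in nhds y0. smooth_near (\<lambda>w. K (y, w)) (z y)"
    by eventually_elim (rule smooth_near_compose[OF part])
  let ?j = "Blinfun (\<lambda>v :: 'b. (0 :: 'a, v))"
  have j: "bounded_linear (\<lambda>v :: 'b. (0 :: 'a, v))"
    by (intro bounded_linear_Pair bounded_linear_zero bounded_linear_ident)
  have "smooth_near (\<lambda>y. Blinfun (frechet_derivative K (at (y, z y))) o\<^sub>L ?j) y0"
    by (intro smooth_near_bilinear[OF bounded_bilinear_blinfun_compose] smooth_near_const
         smooth_near_compose[OF yz] smooth_near_derivative K)
  moreover from K' have "\<forall>\<^sub>F y in nhds y0. Blinfun (frechet_derivative K (at (y, z y))) o\<^sub>L ?j =
     Blinfun (frechet_derivative (\<lambda>w. K (y, w)) (at (z y)))"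
  proof eventually_elim
    case (elim y)
    have "((\<lambda>w. (y, w)) has_derivative (\<lambda>v. (0, v))) (at (z y))"
      by (intro has_derivative_Pair has_derivative_const has_derivative_ident)
    from has_derivative_compose[OF this smooth_near_has_derivative[OF elim]]
    have "frechet_derivative (\<lambda>w. K (y, w)) (at (z y)) = (\<lambda>v. frechet_derivative K (at (y, z y)) (0, v))"
      by (rule frechet_derivative_eqI)
    moreover have "Blinfun (frechet_derivative (\<lambda>w. K (y, w)) (at (z y))) v =
        frechet_derivative (\<lambda>w. K (y, w)) (at (z y)) v" for v
      by (rule Blinfun_derivative_apply[OF smooth_near_compose[OF part elim]])
    ultimately show ?case
      by (intro blinfun_eqI) (simp add: Blinfun_derivative_apply[OF elim]
          bounded_linear_Blinfun_apply[OF j])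
  qed
  ultimately show "smooth_near (\<lambda>y. Blinfun (frechet_derivative (\<lambda>w. K (y, w)) (at (z y)))) y0"
    by (rule smooth_near_cong)
qed

section \<open>Smooth maps between manifolds at a point\<close>

text \<open>
  The charts are injective with open image; nothing is required of the coordinate changes.
\<close>

definition local_charts :: "('a, 'e::banach) atlas \<Rightarrow> bool" where
  "local_charts M \<longleftrightarrow> (\<forall>c\<in>M. inj_on (snd c) (fst c) \<and> open (snd c ` fst c))"

text \<open>
  \<open>f\<close> is smooth on a neighbourhood of \<open>x\<close>. The condition is imposed for all charts; the first part
  expresses continuity at \<open>x\<close>.
\<close>

definition smooth_map_at ::
    "('a, 'e::banach) atlas \<Rightarrow> ('b, 'f::banach) atlas \<Rightarrow> ('a \<Rightarrow> 'b) \<Rightarrow> 'a \<Rightarrow> bool" where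
  "smooth_map_at M N f x \<longleftrightarrow> x \<in> points M \<and> f x \<in> points N \<and>
     (\<forall>c\<in>charts_at M x. \<forall>d\<in>charts_at N (f x).
        (\<forall>\<^sub>F y in nhds (snd c x). f (chart_inv c y) \<in> fst d) \<and> smooth_near (coord_rep c d f) (snd c x))"

text \<open>
  Atlases with smooth coordinate changes, in terms of germs: the identity is smooth at every
  point. Every Banach manifold is of this kind, and so are products of two such atlases.
\<close>

definition smooth_atlas :: "('a, 'e::banach) atlas \<Rightarrow> bool" where
  "smooth_atlas M \<longleftrightarrow> local_charts M \<and> (\<forall>x\<in>points M. smooth_map_at M M (\<lambda>x. x) x)"

text \<open>
  \<open>P\<close> holds on a neighbourhood of \<open>x\<close> in the manifold.
\<close>

definition eventually_at_point :: "('a, 'e::banach) atlas \<Rightarrow> 'a \<Rightarrow> ('a \<Rightarrow> bool) \<Rightarrow> bool" where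
  "eventually_at_point M x P \<longleftrightarrow> (\<forall>c\<in>charts_at M x. \<forall>\<^sub>F y in nhds (snd c x). P (chart_inv c y))"

lemma smooth_map_at_points: "smooth_map_at M N f x \<Longrightarrow> x \<in> points M" "smooth_map_at M N f x \<Longrightarrow> f x \<in> points N"
  unfolding smooth_map_at_def by simp_all

lemma smooth_map_atD:
  assumes "smooth_map_at M N f x" "c \<in> charts_at M x" "d \<in> charts_at N (f x)"
  shows "\<forall>\<^sub>F y in nhds (snd c x). f (chart_inv c y) \<in> fst d" "smooth_near (coord_rep c d f) (snd c x)"
  using assms unfolding smooth_map_at_def by simp_all

lemma smooth_atlas_local_charts: "smooth_atlas M \<Longrightarrow> local_charts M"
  by (simp add: smooth_atlas_def)

lemma smooth_map_at_ident: "smooth_atlas M \<Longrightarrow> x \<in> points M \<Longrightarrow> smooth_map_at M M (\<lambda>x. x) x"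
  by (simp add: smooth_atlas_def)

lemma charts_atD: "c \<in> charts_at M x \<Longrightarrow> c \<in> M" "c \<in> charts_at M x \<Longrightarrow> x \<in> fst c"
  by (auto simp: charts_at_def)

lemma charts_at_nonempty: "x \<in> points M \<Longrightarrow> \<exists>c. c \<in> charts_at M x"
  by (auto simp: points_def charts_at_def)

lemma charts_at_points: "c \<in> charts_at M x \<Longrightarrow> x \<in> points M"
  by (auto simp: points_def charts_at_def)

lemma chart_inv_left: "local_charts M \<Longrightarrow> c \<in> M \<Longrightarrow> x \<in> fst c \<Longrightarrow> chart_inv c (snd c x) = x"
  by (simp add: chart_inv_def local_charts_def)

lemma chart_inv_at: "local_charts M \<Longrightarrow> c \<in> charts_at M x \<Longrightarrow> chart_inv c (snd c x) = x"
  by (simp add: charts_at_def chart_inv_left)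

lemma eventually_chart_image:
  "local_charts M \<Longrightarrow> c \<in> charts_at M x \<Longrightarrow> \<forall>\<^sub>F y in nhds (snd c x). y \<in> snd c ` fst c"
  by (rule eventually_nhds_in_open) (auto simp: local_charts_def charts_at_def)

lemma coord_rep_at: "local_charts M \<Longrightarrow> c \<in> charts_at M x \<Longrightarrow> coord_rep c d f (snd c x) = snd d (f x)"
  by (simp add: coord_rep_def chart_inv_at)

lemma eventually_at_point_self:
  assumes "local_charts M" "x \<in> points M" "eventually_at_point M x P"
  shows "P x"
proof -
  obtain c where c: "c \<in> charts_at M x" using charts_at_nonempty[OF assms(2)] by blast
  then have "\<forall>\<^sub>F y in nhds (snd c x). P (chart_inv c y)"
    using assms(3) unfolding eventually_at_point_def by blast
  then show ?thesis using eventually_nhds_x_imp_x chart_inv_at[OF assms(1) c] by fastforce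
qed

lemma eventually_at_point_points:
  assumes "local_charts M" and P: "\<And>z. z \<in> points M \<Longrightarrow> P z"
  shows "eventually_at_point M x P"
  unfolding eventually_at_point_def
proof
  fix c assume c: "c \<in> charts_at M x"
  from eventually_chart_image[OF assms(1) c] show "\<forall>\<^sub>F y in nhds (snd c x). P (chart_inv c y)"
  proof eventually_elim
    case (elim y)
    then obtain z where z: "z \<in> fst c" "y = snd c z" by blast
    then have "z \<in> points M" using charts_atD(1)[OF c] unfolding points_def by blast
    then show ?case using P z chart_inv_left[OF assms(1) charts_atD(1)[OF c]] by simp
  qed
qed

lemma eventually_at_point_mono:
  assumes "local_charts M" "eventually_at_point M x P" "\<And>z. z \<in> points M \<Longrightarrow> P z \<Longrightarrow> Q z"
  shows "eventually_at_point M x Q"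
  unfolding eventually_at_point_def
proof
  fix c assume c: "c \<in> charts_at M x"
  have "eventually_at_point M x (\<lambda>z. z \<in> points M)"
    by (rule eventually_at_point_points[OF assms(1)])
  with assms(2) c have "\<forall>\<^sub>F y in nhds (snd c x). P (chart_inv c y)" "\<forall>\<^sub>F y in nhds (snd c x).
      chart_inv c y \<in> points M"
    unfolding eventually_at_point_def by blast+
  then show "\<forall>\<^sub>F y in nhds (snd c x). Q (chart_inv c y)"
    by eventually_elim (rule assms(3))
qed

lemma smooth_map_imp_smooth_map_at:
  assumes M: "local_charts M" and f: "smooth_map M N f" and x: "x \<in> points M"
  shows "smooth_map_at M N f x"
  unfolding smooth_map_at_def
proof (intro conjI ballI x)
  show "f x \<in> points N" using f x unfolding smooth_map_def by blast
  fix c d assume c: "c \<in> charts_at M x" and d: "d \<in> charts_at N (f x)"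
  let ?O = "snd c ` {x \<in> fst c. f x \<in> fst d}"
  have O: "open ?O" "smooth_on ?O (coord_rep c d f)"
    using f charts_atD(1)[OF c] charts_atD(1)[OF d] unfolding smooth_map_def by blast+
  have xO: "snd c x \<in> ?O" using charts_atD(2)[OF c] charts_atD(2)[OF d] by blast
  show "smooth_near (coord_rep c d f) (snd c x)" unfolding smooth_near_def using O xO by blast
  show "\<forall>\<^sub>F y in nhds (snd c x). f (chart_inv c y) \<in> fst d"
    using eventually_nhds_in_open[OF O(1) xO]
    by eventually_elim (use chart_inv_left[OF M charts_atD(1)[OF c]] in auto)
qed

lemma banach_manifold_local_charts: "banach_manifold M \<Longrightarrow> local_charts M"
  by (simp add: banach_manifold_def local_charts_def)

lemma banach_manifold_smooth_atlas:
  assumes M: "banach_manifold M"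
  shows "smooth_atlas M"
proof -
  note lc = banach_manifold_local_charts[OF M]
  have "smooth_map M M (\<lambda>x. x)"
    unfolding smooth_map_def
  proof (intro conjI ballI)
    fix c d assume "c \<in> M" "d \<in> M"
    moreover have "{x \<in> fst c. x \<in> fst d} = fst c \<inter> fst d" by blast
    ultimately show "open (snd c ` {x \<in> fst c. x \<in> fst d})"
      "smooth_on (snd c ` {x \<in> fst c. x \<in> fst d}) (coord_rep c d (\<lambda>x. x))"
      using M unfolding banach_manifold_def by simp_all
  qed simp
  then show ?thesis
    unfolding smooth_atlas_def by (intro conjI ballI lc smooth_map_imp_smooth_map_at[OF lc])
qed

lemma eventually_coord_rep_compose:
  assumes M: "local_charts M" and N: "local_charts N" and f: "smooth_map_at M N f x"
    and c: "c \<in> charts_at M x" and d: "d \<in> charts_at N (f x)"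
  shows "\<forall>\<^sub>F y in nhds (snd c x). coord_rep d e g (coord_rep c d f y) = coord_rep c e (\<lambda>z. g (f z)) y"
proof -
  have "\<forall>\<^sub>F y in nhds (snd c x). f (chart_inv c y) \<in> fst d"
    using smooth_map_atD[OF f c d] by simp_all
  then show ?thesis
    by eventually_elim (simp add: coord_rep_def chart_inv_left[OF N charts_atD(1)[OF d]])
qed

lemma smooth_map_at_compose:
  assumes M: "local_charts M" and N: "local_charts N"
    and f: "smooth_map_at M N f x" and g: "smooth_map_at N L g (f x)"
  shows "smooth_map_at M L (\<lambda>z. g (f z)) x"
  unfolding smooth_map_at_def
proof (intro conjI ballI)
  show "x \<in> points M" using smooth_map_at_points[OF f] by simp
  show "g (f x) \<in> points L" using smooth_map_at_points[OF g] by simp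
  fix c e assume c: "c \<in> charts_at M x" and e: "e \<in> charts_at L (g (f x))"
  obtain d where d: "d \<in> charts_at N (f x)"
    using charts_at_nonempty[OF smooth_map_at_points(2)[OF f]] by blast
  have f': "\<forall>\<^sub>F y in nhds (snd c x). f (chart_inv c y) \<in> fst d" "smooth_near (coord_rep c d f) (snd c x)"
    using smooth_map_atD[OF f c d] by simp_all
  have g': "\<forall>\<^sub>F y in nhds (snd d (f x)). g (chart_inv d y) \<in> fst e" "smooth_near (coord_rep d e g)
      (snd d (f x))"
    using smooth_map_atD[OF g d e] by simp_all
  note eq = coord_rep_at[OF M c, of d f]
  show "smooth_near (coord_rep c e (\<lambda>z. g (f z))) (snd c x)"
    by (rule smooth_near_cong[OF smooth_near_compose[OF f'(2)] eventually_coord_rep_compose[OF M N f c d]])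
      (use g' eq in simp)
  have "\<forall>\<^sub>F y in nhds (snd c x). g (chart_inv d (coord_rep c d f y)) \<in> fst e"
    by (rule eventually_compose_filterlim[OF g'(1)]) (use smooth_near_tendsto[OF f'(2)] eq in simp)
  with f'(1) show "\<forall>\<^sub>F y in nhds (snd c x). g (f (chart_inv c y)) \<in> fst e"
    by eventually_elim (simp add: coord_rep_def chart_inv_left[OF N charts_atD(1)[OF d]])
qed

lemma smooth_map_at_cong:
  assumes M: "local_charts M" and f: "smooth_map_at M N f x" and eq: "eventually_at_point M x (\<lambda>z. f z
      = g z)"
  shows "smooth_map_at M N g x"
proof -
  have x: "x \<in> points M" using smooth_map_at_points[OF f] by simp
  have fx: "f x = g x" by (rule eventually_at_point_self[OF M x eq])
  show ?thesis
    unfolding smooth_map_at_def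
  proof (intro conjI ballI x)
    show "g x \<in> points N" using smooth_map_at_points[OF f] fx by simp
    fix c d assume c: "c \<in> charts_at M x" and d: "d \<in> charts_at N (g x)"
    have f': "\<forall>\<^sub>F y in nhds (snd c x). f (chart_inv c y) \<in> fst d" "smooth_near (coord_rep c d f) (snd c x)"
      using smooth_map_atD[OF f c, of d] d fx by simp_all
    have ev: "\<forall>\<^sub>F y in nhds (snd c x). f (chart_inv c y) = g (chart_inv c y)"
      using eq c unfolding eventually_at_point_def by blast
    from ev f'(1) show "\<forall>\<^sub>F y in nhds (snd c x). g (chart_inv c y) \<in> fst d"
      by eventually_elim simp
    show "smooth_near (coord_rep c d g) (snd c x)"
      by (rule smooth_near_cong[OF f'(2)]) (use ev in \<open>eventually_elim, simp add: coord_rep_def\<close>)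
  qed
qed

lemma smooth_map_at_const: "x \<in> points M \<Longrightarrow> y \<in> points N \<Longrightarrow> smooth_map_at M N (\<lambda>x. y) x"
  unfolding smooth_map_at_def coord_rep_def comp_def charts_at_def by (simp add: smooth_near_const)

text \<open>
  The charts of \<open>prod_atlas\<close>.
\<close>

definition prod_chart :: "('a, 'e) chart \<Rightarrow> ('b, 'f) chart \<Rightarrow> ('a \<times> 'b, 'e \<times> 'f) chart" where
  "prod_chart c d = (fst c \<times> fst d, map_prod (snd c) (snd d))"

lemma prod_chart_in_prod_atlas: "c \<in> M \<Longrightarrow> d \<in> N \<Longrightarrow> prod_chart c d \<in> prod_atlas M N"
  unfolding prod_atlas_def prod_chart_def by (rule image_eqI[of _ _ "(c, d)"]) simp_all

lemma prod_atlasE: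
  assumes "k \<in> prod_atlas M N"
  obtains c d where "k = prod_chart c d" "c \<in> M" "d \<in> N"
  using assms unfolding prod_atlas_def prod_chart_def by force

lemma prod_chart_in_charts_at:
  "c \<in> charts_at M x \<Longrightarrow> d \<in> charts_at N y \<Longrightarrow> prod_chart c d \<in> charts_at (prod_atlas M N) (x, y)"
  unfolding charts_at_def by (simp add: prod_chart_in_prod_atlas) (simp add: prod_chart_def)

lemma charts_at_prod_atlasE:
  assumes "k \<in> charts_at (prod_atlas M N) (x, y)"
  obtains c d where "k = prod_chart c d" "c \<in> charts_at M x" "d \<in> charts_at N y"
proof -
  have "k \<in> prod_atlas M N" "(x, y) \<in> fst k" using charts_atD[OF assms] by simp_all
  moreover from this(1) obtain c d where "k = prod_chart c d" "c \<in> M" "d \<in> N" by (rule prod_atlasE)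
  ultimately show ?thesis using that[of c d] by (simp add: charts_at_def prod_chart_def)
qed

lemma points_prod_atlas: "points (prod_atlas M N) = points M \<times> points N"
proof (rule Set.set_eqI)
  fix z :: "'a \<times> 'b"
  obtain x y where z: "z = (x, y)" by (cases z)
  show "z \<in> points (prod_atlas M N) \<longleftrightarrow> z \<in> points M \<times> points N"
  proof
    assume "z \<in> points (prod_atlas M N)"
    then obtain k where "k \<in> charts_at (prod_atlas M N) (x, y)"
      using charts_at_nonempty[of "(x, y)" "prod_atlas M N"] z by blast
    then show "z \<in> points M \<times> points N"
      unfolding z by (rule charts_at_prod_atlasE) (simp add: charts_at_points)
  next
    assume "z \<in> points M \<times> points N"
    then obtain c d where "c \<in> charts_at M x" "d \<in> charts_at N y"
      using charts_at_nonempty[of x M] charts_at_nonempty[of y N] z by blast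
    then show "z \<in> points (prod_atlas M N)"
      unfolding z by (rule charts_at_points[OF prod_chart_in_charts_at])
  qed
qed

lemma local_charts_prod_atlas:
  assumes "local_charts M" "local_charts N"
  shows "local_charts (prod_atlas M N)"
  unfolding local_charts_def
proof
  fix k assume "k \<in> prod_atlas M N"
  then obtain c d where k: "k = prod_chart c d" "c \<in> M" "d \<in> N" by (rule prod_atlasE)
  have "inj_on (snd c) (fst c)" "inj_on (snd d) (fst d)" "open (snd c ` fst c)" "open (snd d ` fst d)"
    using assms k by (auto simp: local_charts_def)
  moreover have "map_prod (snd c) (snd d) ` (fst c \<times> fst d) = snd c ` fst c \<times> snd d ` fst d"
    by (simp add: map_prod_image)
  ultimately show "inj_on (snd k) (fst k) \<and> open (snd k ` fst k)"
    by (auto simp: k prod_chart_def map_prod_inj_on open_Times)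
qed

lemma eventually_chart_inv_prod_chart:
  assumes M: "local_charts M" and N: "local_charts N" and c: "c \<in> charts_at M x" and d: "d \<in> charts_at N y"
  shows "\<forall>\<^sub>F w in nhds (snd c x, snd d y).
    chart_inv (prod_chart c d) w = (chart_inv c (fst w), chart_inv d (snd w)) \<and>
    chart_inv c (fst w) \<in> fst c \<and> chart_inv d (snd w) \<in> fst d"
proof -
  have k: "prod_chart c d \<in> charts_at (prod_atlas M N) (x, y)" by (rule prod_chart_in_charts_at[OF c d])
  note lc = local_charts_prod_atlas[OF M N]
  have "\<forall>\<^sub>F w in nhds (snd (prod_chart c d) (x, y)). w \<in> snd (prod_chart c d) ` fst (prod_chart c d)"
    by (rule eventually_chart_image[OF lc k])
  then have "\<forall>\<^sub>F w in nhds (snd c x, snd d y). w \<in> snd (prod_chart c d) ` fst (prod_chart c d)"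
    by (simp add: prod_chart_def)
  then show ?thesis
  proof eventually_elim
    case (elim w)
    then obtain a b where w: "w = (snd c a, snd d b)" "a \<in> fst c" "b \<in> fst d"
      by (auto simp: prod_chart_def)
    have "chart_inv (prod_chart c d) (snd (prod_chart c d) (a, b)) = (a, b)"
      by (rule chart_inv_left[OF lc charts_atD(1)[OF k]]) (use w in \<open>simp add: prod_chart_def\<close>)
    then show ?case
      using w chart_inv_left[OF M charts_atD(1)[OF c] w(2)] chart_inv_left[OF N charts_atD(1)[OF d] w(3)]
      by (simp add: prod_chart_def)
  qed
qed

lemma coord_rep_Pair:
  "coord_rep c (prod_chart d e) (\<lambda>z. (a z, b z)) = (\<lambda>y. (coord_rep c d a y, coord_rep c e b y))"
  by (auto simp: coord_rep_def prod_chart_def)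

lemma smooth_map_at_Pair:
  assumes a: "smooth_map_at S M a x" and b: "smooth_map_at S N b x"
  shows "smooth_map_at S (prod_atlas M N) (\<lambda>z. (a z, b z)) x"
  unfolding smooth_map_at_def
proof (intro conjI ballI)
  show "x \<in> points S" using smooth_map_at_points[OF a] by simp
  show "(a x, b x) \<in> points (prod_atlas M N)" using smooth_map_at_points[OF a] smooth_map_at_points[OF
      b] by (simp add: points_prod_atlas)
  fix c k assume c: "c \<in> charts_at S x" and k0: "k \<in> charts_at (prod_atlas M N) (a x, b x)"
  obtain d e where k: "k = prod_chart d e" "d \<in> charts_at M (a x)" "e \<in> charts_at N (b x)"
    using k0 by (rule charts_at_prod_atlasE)
  have a': "\<forall>\<^sub>F y in nhds (snd c x). a (chart_inv c y) \<in> fst d" "smooth_near (coord_rep c d a) (snd c x)"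
    using smooth_map_atD[OF a c k(2)] by simp_all
  have b': "\<forall>\<^sub>F y in nhds (snd c x). b (chart_inv c y) \<in> fst e" "smooth_near (coord_rep c e b) (snd c x)"
    using smooth_map_atD[OF b c k(3)] by simp_all
  from a'(1) b'(1) show "\<forall>\<^sub>F y in nhds (snd c x). (a (chart_inv c y), b (chart_inv c y)) \<in> fst k"
    by eventually_elim (simp add: k prod_chart_def)
  show "smooth_near (coord_rep c k (\<lambda>z. (a z, b z))) (snd c x)"
    unfolding k coord_rep_Pair by (rule smooth_near_Pair[OF a'(2) b'(2)])
qed

lemma smooth_map_at_fst:
  assumes M: "smooth_atlas M" and N: "local_charts N" and "x \<in> points M" "y \<in> points N"
  shows "smooth_map_at (prod_atlas M N) M fst (x, y)"
  unfolding smooth_map_at_def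
proof (intro conjI ballI)
  show "(x, y) \<in> points (prod_atlas M N)" "fst (x, y) \<in> points M"
    using assms by (auto simp: points_prod_atlas)
  fix k c' assume k0: "k \<in> charts_at (prod_atlas M N) (x, y)" and c': "c' \<in> charts_at M (fst (x, y))"
  obtain c d where k: "k = prod_chart c d" and c: "c \<in> charts_at M x" and d: "d \<in> charts_at N y"
    using k0 by (rule charts_at_prod_atlasE)
  have kx: "snd (prod_chart c d) (x, y) = (snd c x, snd d y)" by (simp add: prod_chart_def)
  have id: "\<forall>\<^sub>F y in nhds (snd c x). chart_inv c y \<in> fst c'" "smooth_near (coord_rep c c' (\<lambda>x. x))
      (snd c x)"
    using smooth_map_atD[OF smooth_map_at_ident[OF M assms(3)] c, of c'] c' by simp_all
  have f: "smooth_near fst (snd c x, snd d y)" by (rule smooth_near_bounded_linear[OF bounded_linear_fst])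
  note ev = eventually_chart_inv_prod_chart[OF smooth_atlas_local_charts[OF M] N c d]
  have "\<forall>\<^sub>F w in nhds (snd c x, snd d y). chart_inv c (fst w) \<in> fst c'"
    by (rule eventually_compose_filterlim[OF id(1)]) (use smooth_near_tendsto[OF f] in simp)
  with ev show "\<forall>\<^sub>F w in nhds (snd k (x, y)). fst (chart_inv k w) \<in> fst c'"
    unfolding k kx by eventually_elim simp
  have "smooth_near (\<lambda>w. coord_rep c c' (\<lambda>x. x) (fst w)) (snd c x, snd d y)"
    by (rule smooth_near_compose[OF f]) (use id(2) in simp)
  then show "smooth_near (coord_rep k c' fst) (snd k (x, y))"
    unfolding k kx
    by (rule smooth_near_cong) (use ev in \<open>eventually_elim, simp add: coord_rep_def\<close>)
qed

lemma smooth_map_at_snd: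
  assumes M: "local_charts M" and N: "smooth_atlas N" and "x \<in> points M" "y \<in> points N"
  shows "smooth_map_at (prod_atlas M N) N snd (x, y)"
  unfolding smooth_map_at_def
proof (intro conjI ballI)
  show "(x, y) \<in> points (prod_atlas M N)" "snd (x, y) \<in> points N"
    using assms by (auto simp: points_prod_atlas)
  fix k d' assume k0: "k \<in> charts_at (prod_atlas M N) (x, y)" and d': "d' \<in> charts_at N (snd (x, y))"
  obtain c d where k: "k = prod_chart c d" and c: "c \<in> charts_at M x" and d: "d \<in> charts_at N y"
    using k0 by (rule charts_at_prod_atlasE)
  have kx: "snd (prod_chart c d) (x, y) = (snd c x, snd d y)" by (simp add: prod_chart_def)
  have id: "\<forall>\<^sub>F w in nhds (snd d y). chart_inv d w \<in> fst d'" "smooth_near (coord_rep d d' (\<lambda>x. x))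
      (snd d y)"
    using smooth_map_atD[OF smooth_map_at_ident[OF N assms(4)] d, of d'] d' by simp_all
  have f: "smooth_near snd (snd c x, snd d y)" by (rule smooth_near_bounded_linear[OF bounded_linear_snd])
  note ev = eventually_chart_inv_prod_chart[OF M smooth_atlas_local_charts[OF N] c d]
  have "\<forall>\<^sub>F w in nhds (snd c x, snd d y). chart_inv d (snd w) \<in> fst d'"
    by (rule eventually_compose_filterlim[OF id(1)]) (use smooth_near_tendsto[OF f] in simp)
  with ev show "\<forall>\<^sub>F w in nhds (snd k (x, y)). snd (chart_inv k w) \<in> fst d'"
    unfolding k kx by eventually_elim simp
  have "smooth_near (\<lambda>w. coord_rep d d' (\<lambda>x. x) (snd w)) (snd c x, snd d y)"
    by (rule smooth_near_compose[OF f]) (use id(2) in simp)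
  then show "smooth_near (coord_rep k d' snd) (snd k (x, y))"
    unfolding k kx
    by (rule smooth_near_cong) (use ev in \<open>eventually_elim, simp add: coord_rep_def\<close>)
qed

lemma smooth_atlas_prod_atlas:
  assumes M: "smooth_atlas M" and N: "smooth_atlas N"
  shows "smooth_atlas (prod_atlas M N)"
  unfolding smooth_atlas_def
proof (intro conjI ballI)
  show "local_charts (prod_atlas M N)" using M N
      by (simp add: local_charts_prod_atlas smooth_atlas_local_charts)
  fix z assume "z \<in> points (prod_atlas M N)"
  then obtain x y where z: "z = (x, y)" "x \<in> points M" "y \<in> points N" by (auto simp: points_prod_atlas)
  have "smooth_map_at (prod_atlas M N) (prod_atlas M N) (\<lambda>z. (fst z, snd z)) (x, y)"
    using M N z by (intro smooth_map_at_Pair smooth_map_at_fst smooth_map_at_snd smooth_atlas_local_charts)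
  then show "smooth_map_at (prod_atlas M N) (prod_atlas M N) (\<lambda>z. z) z" using z by simp
qed

lemma points_restrict_atlas: "W \<subseteq> points M \<Longrightarrow> points (restrict_atlas M W) = W"
  by (auto simp: points_def restrict_atlas_def)

lemma charts_at_restrict_atlasE:
  assumes "k \<in> charts_at (restrict_atlas M W) x"
  obtains c where "k = (fst c \<inter> W, snd c)" "c \<in> charts_at M x"
  using assms unfolding charts_at_def restrict_atlas_def by auto

lemma local_charts_restrict_atlas:
  assumes "local_charts M" "open_in_manifold M W"
  shows "local_charts (restrict_atlas M W)"
  unfolding local_charts_def restrict_atlas_def
proof
  fix k assume "k \<in> (\<lambda>c. (fst c \<inter> W, snd c)) ` M"
  then obtain c where c: "k = (fst c \<inter> W, snd c)" "c \<in> M" by (rule imageE)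
  then have "inj_on (snd c) (fst c \<inter> W)" "open (snd c ` (fst c \<inter> W))"
    using assms inj_on_subset[of "snd c" "fst c" "fst c \<inter> W"]
        by (auto simp: local_charts_def open_in_manifold_def)
  then show "inj_on (snd k) (fst k) \<and> open (snd k ` fst k)" using c by simp
qed

lemma open_in_manifold_eventually:
  assumes M: "local_charts M" and W: "open_in_manifold M W" and x: "x \<in> W"
  shows "eventually_at_point M x (\<lambda>z. z \<in> W)"
  unfolding eventually_at_point_def
proof
  fix c assume c: "c \<in> charts_at M x"
  have "\<forall>\<^sub>F y in nhds (snd c x). y \<in> snd c ` (fst c \<inter> W)"
    by (rule eventually_nhds_in_open) (use W c x in \<open>auto simp: open_in_manifold_def charts_at_def\<close>)
  then show "\<forall>\<^sub>F y in nhds (snd c x). chart_inv c y \<in> W"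
    by eventually_elim (use chart_inv_left[OF M charts_atD(1)[OF c]] in auto)
qed

lemma eventually_chart_inv_restrict_atlas:
  assumes M: "local_charts M" and W: "open_in_manifold M W" and x: "x \<in> W" and c: "c \<in> charts_at M x"
  shows "\<forall>\<^sub>F y in nhds (snd c x). chart_inv (fst c \<inter> W, snd c) y = chart_inv c y \<and> chart_inv c y \<in> W"
proof -
  have "\<forall>\<^sub>F y in nhds (snd c x). y \<in> snd c ` (fst c \<inter> W)"
    by (rule eventually_nhds_in_open) (use W c x in \<open>auto simp: open_in_manifold_def charts_at_def\<close>)
  then show ?thesis
  proof eventually_elim
    case (elim y)
    then obtain z where z: "z \<in> fst c" "z \<in> W" "y = snd c z" by blast
    have "(fst c \<inter> W, snd c) \<in> restrict_atlas M W"
      unfolding restrict_atlas_def using charts_atD(1)[OF c] by (rule imageI)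
    from chart_inv_left[OF local_charts_restrict_atlas[OF M W] this] z
    show ?case using chart_inv_left[OF M charts_atD(1)[OF c]] by simp
  qed
qed

text \<open>
  Maps defined on an open submanifold are related to the ambient manifold through the identity map
  in both directions; no tangent vector of a restricted atlas, which is a function on a different
  set of charts, is needed.
\<close>

lemma smooth_map_at_from_restrict_atlas:
  assumes M: "smooth_atlas M" and W: "open_in_manifold M W" and x: "x \<in> W"
  shows "smooth_map_at (restrict_atlas M W) M (\<lambda>x. x) x"
  unfolding smooth_map_at_def
proof (intro conjI ballI)
  have Wp: "W \<subseteq> points M" using W by (simp add: open_in_manifold_def)
  show "x \<in> points (restrict_atlas M W)" "x \<in> points M" using x Wp by (auto simp: points_restrict_atlas)
  fix k d assume k0: "k \<in> charts_at (restrict_atlas M W) x" and d: "d \<in> charts_at M x"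
  obtain c where k: "k = (fst c \<inter> W, snd c)" and c: "c \<in> charts_at M x"
    using k0 by (rule charts_at_restrict_atlasE)
  have id: "\<forall>\<^sub>F y in nhds (snd c x). chart_inv c y \<in> fst d" "smooth_near (coord_rep c d (\<lambda>x. x)) (snd c x)"
    using smooth_map_atD[OF smooth_map_at_ident[OF M subsetD[OF Wp x]] c d] by simp_all
  note ev = eventually_chart_inv_restrict_atlas[OF smooth_atlas_local_charts[OF M] W x c]
  from ev id(1) show "\<forall>\<^sub>F y in nhds (snd k x). chart_inv k y \<in> fst d"
    unfolding k snd_conv by eventually_elim simp
  show "smooth_near (coord_rep k d (\<lambda>x. x)) (snd k x)"
    unfolding k snd_conv
    by (rule smooth_near_cong[OF id(2)]) (use ev in \<open>eventually_elim, simp add: coord_rep_def\<close>)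
qed

lemma smooth_map_at_to_restrict_atlas:
  assumes M: "smooth_atlas M" and W: "open_in_manifold M W" and x: "x \<in> W"
  shows "smooth_map_at M (restrict_atlas M W) (\<lambda>x. x) x"
  unfolding smooth_map_at_def
proof (intro conjI ballI)
  have Wp: "W \<subseteq> points M" using W by (simp add: open_in_manifold_def)
  show "x \<in> points (restrict_atlas M W)" "x \<in> points M" using x Wp by (auto simp: points_restrict_atlas)
  fix c k assume c: "c \<in> charts_at M x" and k0: "k \<in> charts_at (restrict_atlas M W) x"
  obtain d where k: "k = (fst d \<inter> W, snd d)" and d: "d \<in> charts_at M x"
    using k0 by (rule charts_at_restrict_atlasE)
  have id: "\<forall>\<^sub>F y in nhds (snd c x). chart_inv c y \<in> fst d" "smooth_near (coord_rep c d (\<lambda>x. x)) (snd c x)"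
    using smooth_map_atD[OF smooth_map_at_ident[OF M subsetD[OF Wp x]] c d] by simp_all
  have "\<forall>\<^sub>F y in nhds (snd c x). chart_inv c y \<in> W"
    using open_in_manifold_eventually[OF smooth_atlas_local_charts[OF M] W x] c
        unfolding eventually_at_point_def by blast
  with id(1) show "\<forall>\<^sub>F y in nhds (snd c x). chart_inv c y \<in> fst k"
    unfolding k by eventually_elim simp
  show "smooth_near (coord_rep c k (\<lambda>x. x)) (snd c x)"
    using id(2) by (simp add: k coord_rep_def)
qed

lemma eventually_at_point_compose:
  assumes M: "local_charts M" and N: "local_charts N" and f: "smooth_map_at M N f x"
    and P: "eventually_at_point N (f x) P"
  shows "eventually_at_point M x (\<lambda>z. P (f z))"
  unfolding eventually_at_point_def
proof
  fix c assume c: "c \<in> charts_at M x"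
  obtain d where d: "d \<in> charts_at N (f x)"
    using charts_at_nonempty[OF smooth_map_at_points(2)[OF f]] by blast
  have f': "\<forall>\<^sub>F y in nhds (snd c x). f (chart_inv c y) \<in> fst d" "smooth_near (coord_rep c d f) (snd c x)"
    using smooth_map_atD[OF f c d] by simp_all
  have "\<forall>\<^sub>F w in nhds (snd d (f x)). P (chart_inv d w)" using P d unfolding eventually_at_point_def by blast
  then have "\<forall>\<^sub>F y in nhds (snd c x). P (chart_inv d (coord_rep c d f y))"
    by (rule eventually_compose_filterlim) (use smooth_near_tendsto[OF f'(2)] coord_rep_at[OF M c,
        of d f] in simp)
  with f'(1) show "\<forall>\<^sub>F y in nhds (snd c x). P (f (chart_inv c y))"
    by eventually_elim (simp add: coord_rep_def chart_inv_left[OF N charts_atD(1)[OF d]])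
qed

section \<open>Tangent maps\<close>

lemma coord_rep_compose_derivative:
  assumes M: "local_charts M" and N: "local_charts N"
    and f: "smooth_map_at M N f x" and g: "smooth_map_at N L g (f x)"
    and c: "c \<in> charts_at M x" and d: "d \<in> charts_at N (f x)" and e: "e \<in> charts_at L (g (f x))"
  shows "frechet_derivative (coord_rep c e (\<lambda>z. g (f z))) (at (snd c x)) v =
    frechet_derivative (coord_rep d e g) (at (snd d (f x))) (frechet_derivative (coord_rep c d f) (at
        (snd c x)) v)"
proof -
  have f': "smooth_near (coord_rep c d f) (snd c x)" and g': "smooth_near (coord_rep d e g) (snd d (f x))"
    using smooth_map_atD[OF f c d] smooth_map_atD[OF g d e] by simp_all
  have g'': "(coord_rep d e g has_derivative frechet_derivative (coord_rep d e g) (at (snd d (f x))))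
      (at (coord_rep c d f (snd c x)))"
    using smooth_near_has_derivative[OF g'] coord_rep_at[OF M c, of d f] by simp
  have "((\<lambda>y. coord_rep d e g (coord_rep c d f y)) has_derivative
     (\<lambda>v. frechet_derivative (coord_rep d e g) (at (snd d (f x))) (frechet_derivative (coord_rep c d
         f) (at (snd c x)) v))) (at (snd c x))"
    by (rule has_derivative_compose[OF smooth_near_has_derivative[OF f'] g''])
  from frechet_derivative_eqI[OF has_derivative_transform_nhds[OF this eventually_coord_rep_compose[OF
      M N f c d]]]
  show ?thesis by simp
qed

lemma tangent_spaceD:
  "u \<in> tangent_space M x \<Longrightarrow> c \<in> charts_at M x \<Longrightarrow> d \<in> charts_at M x \<Longrightarrow>
     u d = frechet_derivative (coord_rep c d (\<lambda>y. y)) (at (snd c x)) (u c)"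
  "u \<in> tangent_space M x \<Longrightarrow> c \<notin> charts_at M x \<Longrightarrow> u c = 0"
  unfolding tangent_space_def by blast+

lemma tangent_spaceI:
  assumes "\<And>c d. c \<in> charts_at M x \<Longrightarrow> d \<in> charts_at M x \<Longrightarrow>
     u d = frechet_derivative (coord_rep c d (\<lambda>y. y)) (at (snd c x)) (u c)"
    and "\<And>c. c \<notin> charts_at M x \<Longrightarrow> u c = 0"
  shows "u \<in> tangent_space M x"
  unfolding tangent_space_def using assms by blast

text \<open>
  The tangent map can be computed in any chart \<open>c\<close>, not only in the one selected by its
  definition.
\<close>

lemma tangent_map_apply:
  assumes M: "smooth_atlas M" and f: "smooth_map_at M N f x" and u: "u \<in> tangent_space M x"
    and c: "c \<in> charts_at M x" and d: "d \<in> charts_at N (f x)"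
  shows "tangent_map M N f x u d = frechet_derivative (coord_rep c d f) (at (snd c x)) (u c)"
proof -
  define c0 where "c0 = (SOME c. c \<in> charts_at M x)"
  have c0: "c0 \<in> charts_at M x" unfolding c0_def using c by (rule someI)
  note lc = smooth_atlas_local_charts[OF M]
  have id: "smooth_map_at M M (\<lambda>x. x) x" by (rule smooth_map_at_ident[OF M charts_at_points[OF c]])
  have "tangent_map M N f x u d = frechet_derivative (coord_rep c0 d f) (at (snd c0 x)) (u c0)"
    using d by (simp add: tangent_map_def c0_def Let_def)
  also have "\<dots> = frechet_derivative (coord_rep c d f) (at (snd c x))
      (frechet_derivative (coord_rep c0 c (\<lambda>x. x)) (at (snd c0 x)) (u c0))"
    using coord_rep_compose_derivative[OF lc lc id f c0 c d] by simp
  also have "\<dots> = frechet_derivative (coord_rep c d f) (at (snd c x)) (u c)"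
    using tangent_spaceD(1)[OF u c0 c] by simp
  finally show ?thesis .
qed

lemma tangent_map_outside: "d \<notin> charts_at N (f x) \<Longrightarrow> tangent_map M N f x u d = 0"
  by (simp add: tangent_map_def Let_def)

lemma tangent_map_in_tangent_space:
  assumes M: "smooth_atlas M" and N: "smooth_atlas N" and f: "smooth_map_at M N f x"
      and u: "u \<in> tangent_space M x"
  shows "tangent_map M N f x u \<in> tangent_space N (f x)"
proof -
  obtain c where c: "c \<in> charts_at M x" using charts_at_nonempty[OF smooth_map_at_points(1)[OF f]] by blast
  have id: "smooth_map_at N N (\<lambda>x. x) (f x)"
      by (rule smooth_map_at_ident[OF N smooth_map_at_points(2)[OF f]])
  show ?thesis
  proof (rule tangent_spaceI)
    fix d e assume d: "d \<in> charts_at N (f x)" and e: "e \<in> charts_at N (f x)"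
    show "tangent_map M N f x u e = frechet_derivative (coord_rep d e (\<lambda>y. y)) (at (snd d (f x)))
        (tangent_map M N f x u d)"
      unfolding tangent_map_apply[OF M f u c d] tangent_map_apply[OF M f u c e]
      using coord_rep_compose_derivative[OF smooth_atlas_local_charts[OF M]
          smooth_atlas_local_charts[OF N] f id c d e] .
  qed (rule tangent_map_outside)
qed

lemma tangent_map_compose:
  assumes M: "smooth_atlas M" and N: "smooth_atlas N"
    and f: "smooth_map_at M N f x" and g: "smooth_map_at N L g (f x)" and u: "u \<in> tangent_space M x"
  shows "tangent_map M L (\<lambda>z. g (f z)) x u = tangent_map N L g (f x) (tangent_map M N f x u)"
proof
  fix e
  obtain c where c: "c \<in> charts_at M x" using charts_at_nonempty[OF smooth_map_at_points(1)[OF f]] by blast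
  obtain d where d: "d \<in> charts_at N (f x)" using charts_at_nonempty[OF smooth_map_at_points(2)[OF f]]
      by blast
  note lc = smooth_atlas_local_charts[OF M] smooth_atlas_local_charts[OF N]
  show "tangent_map M L (\<lambda>z. g (f z)) x u e = tangent_map N L g (f x) (tangent_map M N f x u) e"
  proof (cases "e \<in> charts_at L (g (f x))")
    case True
    show ?thesis
      using tangent_map_apply[OF M smooth_map_at_compose[OF lc f g] u c, of e]
        tangent_map_apply[OF N g tangent_map_in_tangent_space[OF M N f u] d True]
        tangent_map_apply[OF M f u c d] coord_rep_compose_derivative[OF lc f g c d True] True
      by simp
  qed (simp add: tangent_map_outside)
qed

lemma tangent_map_cong:
  assumes M: "smooth_atlas M" and f: "smooth_map_at M N f x" and eq: "eventually_at_point M x (\<lambda>z. f z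
      = g z)"
    and u: "u \<in> tangent_space M x"
  shows "tangent_map M N f x u = tangent_map M N g x u"
proof
  fix d
  note lc = smooth_atlas_local_charts[OF M]
  have x: "x \<in> points M" by (rule smooth_map_at_points[OF f])
  have fx: "f x = g x" by (rule eventually_at_point_self[OF lc x eq])
  obtain c where c: "c \<in> charts_at M x" using charts_at_nonempty[OF x] by blast
  have g: "smooth_map_at M N g x" by (rule smooth_map_at_cong[OF lc f eq])
  show "tangent_map M N f x u d = tangent_map M N g x u d"
  proof (cases "d \<in> charts_at N (f x)")
    case True
    have "smooth_near (coord_rep c d f) (snd c x)" by (rule smooth_map_atD[OF f c True])
    moreover have "\<forall>\<^sub>F y in nhds (snd c x). f (chart_inv c y) = g (chart_inv c y)"
      using eq c unfolding eventually_at_point_def by blast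
    then have "\<forall>\<^sub>F y in nhds (snd c x). coord_rep c d f y = coord_rep c d g y"
      by eventually_elim (simp add: coord_rep_def)
    ultimately have "(coord_rep c d g has_derivative frechet_derivative (coord_rep c d f) (at (snd c
        x))) (at (snd c x))"
      using has_derivative_transform_nhds[OF smooth_near_has_derivative] by blast
    from frechet_derivative_eqI[OF this] show ?thesis
      using tangent_map_apply[OF M f u c, of d] tangent_map_apply[OF M g u c, of d] True fx by simp
  qed (use fx in \<open>simp add: tangent_map_outside\<close>)
qed

lemma linear_coord_rep_derivative:
  assumes "smooth_map_at M N f x" "c \<in> charts_at M x" "d \<in> charts_at N (f x)"
  shows "linear (frechet_derivative (coord_rep c d f) (at (snd c x)))"
  by (rule bounded_linear.linear[OF has_derivative_bounded_linear[OF smooth_near_has_derivative[OF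
      smooth_map_atD(2)[OF assms]]]])

lemma tangent_space_add:
  assumes M: "smooth_atlas M" and x: "x \<in> points M" and u: "u \<in> tangent_space M x"
      and v: "v \<in> tangent_space M x"
  shows "(\<lambda>c. u c + v c) \<in> tangent_space M x"
proof -
  have "linear (frechet_derivative (coord_rep c d (\<lambda>y. y)) (at (snd c x)))"
      if "c \<in> charts_at M x" "d \<in> charts_at M x" for c d
    by (rule linear_coord_rep_derivative[OF smooth_map_at_ident[OF M x]]) (use that in auto)
  then show ?thesis
    by (intro tangent_spaceI) (simp_all add: linear_add tangent_spaceD(2)[OF u] tangent_spaceD(2)[OF v]
      flip: tangent_spaceD(1)[OF u] tangent_spaceD(1)[OF v])
qed

lemma tangent_space_zero:
  assumes M: "smooth_atlas M" and x: "x \<in> points M"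
  shows "(\<lambda>c. 0) \<in> tangent_space M x"
proof -
  have "linear (frechet_derivative (coord_rep c d (\<lambda>y. y)) (at (snd c x)))"
      if "c \<in> charts_at M x" "d \<in> charts_at M x" for c d
    by (rule linear_coord_rep_derivative[OF smooth_map_at_ident[OF M x]]) (use that in auto)
  then show ?thesis by (intro tangent_spaceI) (simp_all add: linear_0)
qed

lemma tangent_map_add:
  assumes M: "smooth_atlas M" and f: "smooth_map_at M N f x" and u: "u \<in> tangent_space M x"
      and v: "v \<in> tangent_space M x"
  shows "tangent_map M N f x (\<lambda>c. u c + v c) = (\<lambda>d. tangent_map M N f x u d + tangent_map M N f x v d)"
proof
  fix d
  have x: "x \<in> points M" by (rule smooth_map_at_points[OF f])
  obtain c where c: "c \<in> charts_at M x" using charts_at_nonempty[OF x] by blast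
  show "tangent_map M N f x (\<lambda>c. u c + v c) d = tangent_map M N f x u d + tangent_map M N f x v d"
  proof (cases "d \<in> charts_at N (f x)")
    case True
    show ?thesis
      using tangent_map_apply[OF M f u c True] tangent_map_apply[OF M f v c True]
        tangent_map_apply[OF M f tangent_space_add[OF M x u v] c True]
        linear_add[OF linear_coord_rep_derivative[OF f c True]] by simp
  qed (simp add: tangent_map_outside)
qed

lemma tangent_map_zero:
  assumes M: "smooth_atlas M" and f: "smooth_map_at M N f x"
  shows "tangent_map M N f x (\<lambda>c. 0) = (\<lambda>d. 0)"
proof
  fix d
  have x: "x \<in> points M" by (rule smooth_map_at_points[OF f])
  obtain c where c: "c \<in> charts_at M x" using charts_at_nonempty[OF x] by blast
  show "tangent_map M N f x (\<lambda>c. 0) d = 0"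
  proof (cases "d \<in> charts_at N (f x)")
    case True
    show ?thesis
      using tangent_map_apply[OF M f tangent_space_zero[OF M x] c True]
        linear_0[OF linear_coord_rep_derivative[OF f c True]] by simp
  qed (simp add: tangent_map_outside)
qed

lemma tangent_map_ident:
  assumes M: "smooth_atlas M" and x: "x \<in> points M" and u: "u \<in> tangent_space M x"
  shows "tangent_map M M (\<lambda>z. z) x u = u"
proof
  fix d
  obtain c where c: "c \<in> charts_at M x" using charts_at_nonempty[OF x] by blast
  show "tangent_map M M (\<lambda>z. z) x u d = u d"
  proof (cases "d \<in> charts_at M x")
    case True
    show ?thesis
      using tangent_map_apply[OF M smooth_map_at_ident[OF M x] u c True] tangent_spaceD(1)[OF u c
          True] by simp
  qed (use tangent_spaceD(2)[OF u] in \<open>simp add: tangent_map_outside\<close>)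
qed

lemma tangent_map_const: 
  shows "tangent_map M N (\<lambda>z. y) x u = (\<lambda>d. 0)"
  by (auto simp: tangent_map_def coord_rep_def comp_def Let_def)

lemma tangent_map_Pair:
  assumes S: "smooth_atlas S" and a: "smooth_map_at S M a x" and b: "smooth_map_at S N b x"
    and u: "u \<in> tangent_space S x" and d: "d \<in> charts_at M (a x)" and e: "e \<in> charts_at N (b x)"
  shows "tangent_map S (prod_atlas M N) (\<lambda>z. (a z, b z)) x u (prod_chart d e) =
    (tangent_map S M a x u d, tangent_map S N b x u e)"
proof -
  obtain c where c: "c \<in> charts_at S x" using charts_at_nonempty[OF smooth_map_at_points(1)[OF a]] by blast
  have k: "prod_chart d e \<in> charts_at (prod_atlas M N) (a x, b x)" by (rule prod_chart_in_charts_at[OF d e])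
  have a': "smooth_near (coord_rep c d a) (snd c x)" and b': "smooth_near (coord_rep c e b) (snd c x)"
    using smooth_map_atD[OF a c d] smooth_map_atD[OF b c e] by simp_all
  have "frechet_derivative (coord_rep c (prod_chart d e) (\<lambda>z. (a z, b z))) (at (snd c x)) =
    (\<lambda>v. (frechet_derivative (coord_rep c d a) (at (snd c x)) v, frechet_derivative (coord_rep c e b)
        (at (snd c x)) v))"
    unfolding coord_rep_Pair
    by (rule frechet_derivative_eqI[OF has_derivative_Pair[OF smooth_near_has_derivative[OF a']
        smooth_near_has_derivative[OF b']]])
  then show ?thesis
    using tangent_map_apply[OF S smooth_map_at_Pair[OF a b] u c k] tangent_map_apply[OF S a u c d]
        tangent_map_apply[OF S b u c e]
    by simp
qed

text \<open>
  The tangent vector of \<open>z \<mapsto> (a(z), b(z))\<close> is the sum of those of \<open>z \<mapsto> (a(z), b(x))\<close> and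
  \<open>z \<mapsto> (a(x), b(z))\<close>.
\<close>

lemma tangent_map_leibniz:
  fixes \<mu> :: "'m \<Rightarrow> 'n \<Rightarrow> 'l"
  assumes S: "smooth_atlas S" and M: "smooth_atlas M" and N: "smooth_atlas N"
    and a: "smooth_map_at S M a x" and b: "smooth_map_at S N b x"
    and \<mu>: "smooth_map_at (prod_atlas M N) L (\<lambda>(m, n). \<mu> m n) (a x, b x)"
    and u: "u \<in> tangent_space S x"
  shows "tangent_map S L (\<lambda>z. \<mu> (a z) (b z)) x u =
    (\<lambda>d. tangent_map M L (\<lambda>m. \<mu> m (b x)) (a x) (tangent_map S M a x u) d +
         tangent_map N L (\<lambda>n. \<mu> (a x) n) (b x) (tangent_map S N b x u) d)"
proof -
  let ?P = "prod_atlas M N"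
  let ?\<mu> = "\<lambda>(m, n). \<mu> m n"
  let ?t = "tangent_map S ?P (\<lambda>z. (a z, b z)) x u"
  let ?ua = "tangent_map S M a x u"
  let ?ub = "tangent_map S N b x u"
  let ?t1 = "tangent_map M ?P (\<lambda>m. (m, b x)) (a x) ?ua"
  let ?t2 = "tangent_map N ?P (\<lambda>n. (a x, n)) (b x) ?ub"
  have P: "smooth_atlas ?P" by (rule smooth_atlas_prod_atlas[OF M N])
  have ax: "a x \<in> points M" and bx: "b x \<in> points N"
      using smooth_map_at_points(2)[OF a] smooth_map_at_points(2)[OF b] by simp_all
  have ab: "smooth_map_at S ?P (\<lambda>z. (a z, b z)) x" by (rule smooth_map_at_Pair[OF a b])
  note idM = smooth_map_at_ident[OF M ax] and idN = smooth_map_at_ident[OF N bx]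
  note cM = smooth_map_at_const[OF ax bx] and cN = smooth_map_at_const[OF bx ax]
  note i1 = smooth_map_at_Pair[OF idM cM] and i2 = smooth_map_at_Pair[OF cN idN]
  have ua: "?ua \<in> tangent_space M (a x)" by (rule tangent_map_in_tangent_space[OF S M a u])
  have ub: "?ub \<in> tangent_space N (b x)" by (rule tangent_map_in_tangent_space[OF S N b u])
  have t1: "?t1 \<in> tangent_space ?P (a x, b x)" by (rule tangent_map_in_tangent_space[OF M P i1 ua])
  have t2: "?t2 \<in> tangent_space ?P (a x, b x)" by (rule tangent_map_in_tangent_space[OF N P i2 ub])
  have "?t k = ?t1 k + ?t2 k" for k
  proof (cases "k \<in> charts_at ?P (a x, b x)")
    case True
    then obtain d e where k: "k = prod_chart d e" and d: "d \<in> charts_at M (a x)"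
        and e: "e \<in> charts_at N (b x)"
      by (rule charts_at_prod_atlasE)
    have "?t k = (?ua d, ?ub e)" unfolding k by (rule tangent_map_Pair[OF S a b u d e])
    moreover have "?t1 k = (?ua d, 0)"
      using tangent_map_Pair[OF M idM cM ua d e] tangent_map_ident[OF M ax ua]
          by (simp add: k tangent_map_const)
    moreover have "?t2 k = (0, ?ub e)"
      using tangent_map_Pair[OF N cN idN ub d e] tangent_map_ident[OF N bx ub]
          by (simp add: k tangent_map_const)
    ultimately show ?thesis by simp
  qed (simp add: tangent_map_outside)
  then have t: "?t = (\<lambda>k. ?t1 k + ?t2 k)" by blast
  have "tangent_map S L (\<lambda>z. \<mu> (a z) (b z)) x u = tangent_map ?P L ?\<mu> (a x, b x) ?t"
    using tangent_map_compose[OF S P ab \<mu> u] by simp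
  also have "\<dots> = (\<lambda>d. tangent_map ?P L ?\<mu> (a x, b x) ?t1 d + tangent_map ?P L ?\<mu> (a x, b x) ?t2 d)"
    unfolding t by (rule tangent_map_add[OF P \<mu> t1 t2])
  also have "tangent_map ?P L ?\<mu> (a x, b x) ?t1 = tangent_map M L (\<lambda>m. \<mu> m (b x)) (a x) ?ua"
    using tangent_map_compose[OF M P i1 \<mu> ua] by simp
  also have "tangent_map ?P L ?\<mu> (a x, b x) ?t2 = tangent_map N L (\<lambda>n. \<mu> (a x) n) (b x) ?ub"
    using tangent_map_compose[OF N P i2 \<mu> ub] by simp
  finally show ?thesis .
qed

text \<open>
  Hence the operator that represents a form in a chart is determined by the form.
\<close>

lemma tangent_vector_exists:
  assumes M: "smooth_atlas M" and c: "c \<in> charts_at M x"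
  shows "\<exists>u\<in>tangent_space M x. u c = v"
proof -
  have x: "x \<in> points M" by (rule charts_at_points[OF c])
  note lc = smooth_atlas_local_charts[OF M] and id = smooth_map_at_ident[OF M x]
  define u where "u d = (if d \<in> charts_at M x then frechet_derivative (coord_rep c d (\<lambda>y. y)) (at (snd
      c x)) v else 0)" for d
  have "u \<in> tangent_space M x"
  proof (rule tangent_spaceI)
    fix d e assume d: "d \<in> charts_at M x" and e: "e \<in> charts_at M x"
    show "u e = frechet_derivative (coord_rep d e (\<lambda>y. y)) (at (snd d x)) (u d)"
      using coord_rep_compose_derivative[OF lc lc id id c d e] d e by (simp add: u_def)
  qed (simp add: u_def)
  moreover have "u c = v"
  proof -
    from eventually_chart_image[OF lc c] have "\<forall>\<^sub>F y in nhds (snd c x). y = coord_rep c c (\<lambda>y. y) y"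
      by eventually_elim (auto simp: coord_rep_def chart_inv_left[OF lc charts_atD(1)[OF c]])
    from frechet_derivative_eqI[OF has_derivative_transform_nhds[OF has_derivative_ident this]]
    show ?thesis using c by (simp add: u_def)
  qed
  ultimately show ?thesis by blast
qed

section \<open>Principal bundles: local sections and the decomposition of a connection\<close>

lemma smooth_map_at_eventually_points:
  assumes "smooth_map_at M N f x"
  shows "eventually_at_point M x (\<lambda>z. f z \<in> points N)"
  unfolding eventually_at_point_def
proof
  fix c assume c: "c \<in> charts_at M x"
  obtain d where d: "d \<in> charts_at N (f x)" using charts_at_nonempty[OF smooth_map_at_points(2)[OF
      assms]] by blast
  from smooth_map_atD(1)[OF assms c d] show "\<forall>\<^sub>F y in nhds (snd c x). f (chart_inv c y) \<in> points N"
    by eventually_elim (use charts_atD(1)[OF d] in \<open>auto simp: points_def\<close>)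
qed

lemma eventually_at_point_conj:
  "eventually_at_point M x P \<Longrightarrow> eventually_at_point M x R \<Longrightarrow> eventually_at_point M x (\<lambda>z. P z \<and> R z)"
  unfolding eventually_at_point_def by (simp add: eventually_conj_iff)

lemma open_in_manifold_vimage:
  assumes M: "local_charts M" and N: "local_charts N" and f: "smooth_map M N f"
      and U: "open_in_manifold N U"
  shows "open_in_manifold M {x \<in> points M. f x \<in> U}"
  unfolding open_in_manifold_def
proof (intro conjI ballI)
  fix c assume c: "c \<in> M"
  let ?O = "snd c ` (fst c \<inter> {x \<in> points M. f x \<in> U})"
  show "open ?O"
  proof (subst open_subopen, intro ballI)
    fix y assume "y \<in> ?O"
    then obtain x where x: "x \<in> fst c" "x \<in> points M" "f x \<in> U" and y: "y = snd c x" by blast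
    have cx: "c \<in> charts_at M x" using c x by (simp add: charts_at_def)
    have "eventually_at_point M x (\<lambda>z. f z \<in> U)"
      by (rule eventually_at_point_compose[OF M N smooth_map_imp_smooth_map_at[OF M f x(2)]
          open_in_manifold_eventually[OF N U x(3)]])
    then have "\<forall>\<^sub>F y in nhds (snd c x). f (chart_inv c y) \<in> U"
      using cx unfolding eventually_at_point_def by blast
    with eventually_chart_image[OF M cx] have "\<forall>\<^sub>F y in nhds (snd c x). y \<in> ?O"
    proof eventually_elim
      case (elim y)
      then obtain z where z: "z \<in> fst c" "y = snd c z" by blast
      moreover have "z \<in> points M" using z c unfolding points_def by blast
      ultimately show ?case using elim(2) chart_inv_left[OF M c z(1)] by auto
    qed
    then show "\<exists>T. open T \<and> y \<in> T \<and> T \<subseteq> ?O" unfolding y eventually_nhds by blast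
  qed
qed blast

lemma banach_lie_group_smooth_atlas: "banach_lie_group G \<Longrightarrow> smooth_atlas (atlas G)"
  unfolding banach_lie_group_def by (simp add: banach_manifold_smooth_atlas)

lemma banach_lie_group_points: "banach_lie_group G \<Longrightarrow> points (atlas G) = carrier G"
  unfolding banach_lie_group_def by simp

lemma smooth_map_at_mult:
  assumes G: "banach_lie_group G" and S: "local_charts S"
    and a: "smooth_map_at S (atlas G) a x" and b: "smooth_map_at S (atlas G) b x"
  shows "smooth_map_at S (atlas G) (\<lambda>z. a z \<otimes>\<^bsub>G\<^esub> b z) x"
proof -
  have lc: "local_charts (prod_atlas (atlas G) (atlas G))"
    using banach_lie_group_smooth_atlas[OF G]
        by (simp add: local_charts_prod_atlas smooth_atlas_local_charts)
  have "smooth_map_at (prod_atlas (atlas G) (atlas G)) (atlas G) (\<lambda>(g, h). g \<otimes>\<^bsub>G\<^esub> h) (a x, b x)"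
    by (rule smooth_map_imp_smooth_map_at[OF lc])
      (use G smooth_map_at_points(2)[OF a] smooth_map_at_points(2)[OF b]
          in \<open>auto simp: banach_lie_group_def points_prod_atlas\<close>)
  from smooth_map_at_compose[OF S lc smooth_map_at_Pair[OF a b] this] show ?thesis by simp
qed

lemma smooth_map_at_inv:
  assumes G: "banach_lie_group G" and S: "local_charts S" and a: "smooth_map_at S (atlas G) a x"
  shows "smooth_map_at S (atlas G) (\<lambda>z. inv\<^bsub>G\<^esub> a z) x"
proof -
  have lc: "local_charts (atlas G)"
    using banach_lie_group_smooth_atlas[OF G] by (simp add: smooth_atlas_local_charts)
  have "smooth_map_at (atlas G) (atlas G) (\<lambda>g. inv\<^bsub>G\<^esub> g) (a x)"
    by (rule smooth_map_imp_smooth_map_at[OF lc])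
      (use G smooth_map_at_points(2)[OF a] in \<open>auto simp: banach_lie_group_def\<close>)
  from smooth_map_at_compose[OF S lc a this] show ?thesis by simp
qed

text \<open>
  A principal bundle with total space \<open>P\<close>, structure group \<open>G\<close> and base \<open>B\<close>.
\<close>

locale smooth_principal_bundle =
  fixes P :: "('p, 'ep::banach) atlas" and G :: "('g, 'eg::banach) lie_group"
      and B :: "('b, 'eb::banach) atlas"
    and pr :: "'p \<Rightarrow> 'b" and act :: "'p \<Rightarrow> 'g \<Rightarrow> 'p"
  assumes pb: "principal_bundle P G B pr act"
begin

lemma smooth_atlas_total: "smooth_atlas P" and structure_group: "banach_lie_group G"
    and smooth_atlas_base: "smooth_atlas B"
  using pb unfolding principal_bundle_def by (auto intro: banach_manifold_smooth_atlas)

lemma group_G: "group G"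
  using structure_group unfolding banach_lie_group_def by blast

sublocale group G by (rule group_G)

lemma smooth_atlas_lie: "smooth_atlas (atlas G)"
  by (rule banach_lie_group_smooth_atlas[OF structure_group])

lemmas local_charts_total = smooth_atlas_local_charts[OF smooth_atlas_total]
  and local_charts_base = smooth_atlas_local_charts[OF smooth_atlas_base]
  and local_charts_lie = smooth_atlas_local_charts[OF smooth_atlas_lie]
  and points_lie = banach_lie_group_points[OF structure_group]

lemma pr_smooth: "smooth_map P B pr"
  using pb unfolding principal_bundle_def by blast

lemma pr_smooth_at: "p \<in> points P \<Longrightarrow> smooth_map_at P B pr p"
  by (rule smooth_map_imp_smooth_map_at[OF local_charts_total pr_smooth])

lemma pr_points: "p \<in> points P \<Longrightarrow> pr p \<in> points B"
  by (rule smooth_map_at_points(2)[OF pr_smooth_at])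

lemma act_smooth_pair:
  assumes "p \<in> points P" "g \<in> carrier G"
  shows "smooth_map_at (prod_atlas P (atlas G)) P (\<lambda>(p, g). act p g) (p, g)"
proof (rule smooth_map_imp_smooth_map_at)
  show "local_charts (prod_atlas P (atlas G))"
    by (rule local_charts_prod_atlas[OF local_charts_total local_charts_lie])
  show "smooth_map (prod_atlas P (atlas G)) P (\<lambda>(p, g). act p g)"
    using pb unfolding principal_bundle_def by blast
qed (use assms in \<open>simp add: points_prod_atlas points_lie\<close>)

lemma act_smooth_at:
  assumes S: "local_charts S" and a: "smooth_map_at S P a x" and b: "smooth_map_at S (atlas G) b x"
  shows "smooth_map_at S P (\<lambda>z. act (a z) (b z)) x"
proof -
  have "a x \<in> points P" "b x \<in> carrier G"
    using smooth_map_at_points(2)[OF a] smooth_map_at_points(2)[OF b] points_lie by auto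
  from smooth_map_at_compose[OF S local_charts_prod_atlas[OF local_charts_total local_charts_lie]
      smooth_map_at_Pair[OF a b] act_smooth_pair[OF this]]
  show ?thesis by simp
qed

lemma act_points: "p \<in> points P \<Longrightarrow> g \<in> carrier G \<Longrightarrow> act p g \<in> points P"
  using smooth_map_at_points(2)[OF act_smooth_pair] by simp

lemma act_one: "p \<in> points P \<Longrightarrow> act p \<one>\<^bsub>G\<^esub> = p"
  using pb unfolding principal_bundle_def by blast

lemma act_act: "p \<in> points P \<Longrightarrow> g \<in> carrier G \<Longrightarrow> h \<in> carrier G \<Longrightarrow> act (act p g) h = act p (g \<otimes>\<^bsub>G\<^esub> h)"
  using pb unfolding principal_bundle_def by blast

lemma smooth_at_translation: "p \<in> points P \<Longrightarrow> g \<in> carrier G \<Longrightarrow> smooth_map_at P P (\<lambda>q. act q g) p"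
  by (intro act_smooth_at local_charts_total smooth_map_at_ident smooth_atlas_total
      smooth_map_at_const) (simp_all add: points_lie)

lemma smooth_at_orbit: "p \<in> points P \<Longrightarrow> g \<in> carrier G \<Longrightarrow> smooth_map_at (atlas G) P (\<lambda>g. act p g) g"
  by (intro act_smooth_at local_charts_lie smooth_map_at_ident smooth_atlas_lie smooth_map_at_const)
      (simp_all add: points_lie)

lemma lie_algebra_eq: "lie_algebra G = tangent_space (atlas G) \<one>\<^bsub>G\<^esub>"
  by (rule lie_algebra_def)

lemma one_points: "\<one>\<^bsub>G\<^esub> \<in> points (atlas G)"
  by (simp add: points_lie)

text \<open>
  A local trivialization \<open>\<Phi>\<close> gives the section \<open>s(x) = \<Phi>(x, 1)\<close> and the equivariant \<open>G\<close>-component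
  \<open>k\<close> of the inverse of \<open>\<Phi>\<close>.
\<close>

lemma local_section:
  assumes b: "b \<in> points B"
  shows "\<exists>U s k. open_in_manifold B U \<and> b \<in> U \<and>
    (\<forall>x\<in>U. s x \<in> points P \<and> pr (s x) = x \<and> smooth_map_at B P s x) \<and>
    (\<forall>p\<in>points P. pr p \<in> U \<longrightarrow> k p \<in> carrier G \<and> smooth_map_at P (atlas G) k p \<and>
       p = act (s (pr p)) (k p) \<and> (\<forall>g\<in>carrier G. k (act p g) = k p \<otimes>\<^bsub>G\<^esub> g \<and> pr (act p g) = pr p))"
proof -
  have "\<exists>U \<Phi>. open_in_manifold B U \<and> b \<in> U \<and>
        diffeomorphism (prod_atlas (restrict_atlas B U) (atlas G)) (restrict_atlas P {p \<in> points P. pr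
            p \<in> U}) \<Phi> \<and>
        (\<forall>x\<in>U. \<forall>g\<in>carrier G. pr (\<Phi> (x, g)) = x) \<and>
        (\<forall>x\<in>U. \<forall>g\<in>carrier G. \<forall>h\<in>carrier G. \<Phi> (x, g \<otimes>\<^bsub>G\<^esub> h) = act (\<Phi> (x, g)) h)"
    using pb b unfolding principal_bundle_def by blast
  then obtain U \<Phi> where U: "open_in_manifold B U" and bU: "b \<in> U"
    and \<Phi>: "diffeomorphism (prod_atlas (restrict_atlas B U) (atlas G)) (restrict_atlas P {p \<in> points
        P. pr p \<in> U}) \<Phi>"
    and pr\<Phi>: "\<And>x g. x \<in> U \<Longrightarrow> g \<in> carrier G \<Longrightarrow> pr (\<Phi> (x, g)) = x"
    and \<Phi>act: "\<And>x g h. x \<in> U \<Longrightarrow> g \<in> carrier G \<Longrightarrow> h \<in> carrier G \<Longrightarrow> \<Phi> (x, g \<otimes>\<^bsub>G\<^esub> h) = act (\<Phi> (x, g)) h"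
    by blast
  define V where "V = {p \<in> points P. pr p \<in> U}"
  have V: "open_in_manifold P V"
    unfolding V_def by (rule open_in_manifold_vimage[OF local_charts_total local_charts_base pr_smooth U])
  let ?BU = "restrict_atlas B U" and ?PV = "restrict_atlas P V"
  have UB: "U \<subseteq> points B" using U unfolding open_in_manifold_def by blast
  have pts: "points (prod_atlas ?BU (atlas G)) = U \<times> carrier G" "points ?PV = V"
    using UB by (auto simp: points_prod_atlas points_restrict_atlas points_lie V_def)
  note lcB = local_charts_restrict_atlas[OF local_charts_base U]
    and lcP = local_charts_restrict_atlas[OF local_charts_total V]
  note lcx = local_charts_prod_atlas[OF lcB local_charts_lie]
  obtain \<Psi> where \<Phi>s: "smooth_map (prod_atlas ?BU (atlas G)) ?PV \<Phi>" and \<Psi>s: "smooth_map ?PV (prod_atlas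
      ?BU (atlas G)) \<Psi>"
    and \<Psi>\<Phi>: "\<And>z. z \<in> U \<times> carrier G \<Longrightarrow> \<Psi> (\<Phi> z) = z" and \<Phi>\<Psi>: "\<And>p. p \<in> V \<Longrightarrow> \<Phi> (\<Psi> p) = p"
    using \<Phi> unfolding diffeomorphism_def V_def[symmetric] pts by blast
  have \<Phi>V: "\<Phi> z \<in> V" if "z \<in> U \<times> carrier G" for z
    using \<Phi>s that unfolding smooth_map_def pts by blast
  have \<Psi>U: "\<Psi> p \<in> U \<times> carrier G" if "p \<in> V" for p
    using \<Psi>s that unfolding smooth_map_def pts by blast
  \<comment> \<open>the section through the unit and the group component of the trivialization\<close>
  define s where "s x = \<Phi> (x, \<one>\<^bsub>G\<^esub>)" for x
  define k where "k p = snd (\<Psi> p)" for p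
  show ?thesis
  proof (intro exI[of _ U] exI[of _ s] exI[of _ k] conjI[OF U] conjI[OF bU] conjI[of "Ball _ _"] ballI impI)
    fix x assume x: "x \<in> U"
    have "smooth_map_at B ?BU (\<lambda>x. x) x" by (rule smooth_map_at_to_restrict_atlas[OF smooth_atlas_base U x])
    then have 1: "smooth_map_at B (prod_atlas ?BU (atlas G)) (\<lambda>x. (x, \<one>\<^bsub>G\<^esub>)) x"
      by (rule smooth_map_at_Pair[OF _ smooth_map_at_const]) (use x UB one_points in auto)
    have 2: "smooth_map_at (prod_atlas ?BU (atlas G)) ?PV \<Phi> (x, \<one>\<^bsub>G\<^esub>)"
      by (rule smooth_map_imp_smooth_map_at[OF lcx \<Phi>s]) (use x pts in auto)
    have 3: "smooth_map_at ?PV P (\<lambda>x. x) (\<Phi> (x, \<one>\<^bsub>G\<^esub>))"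
      by (rule smooth_map_at_from_restrict_atlas[OF smooth_atlas_total V \<Phi>V]) (use x in auto)
    have "smooth_map_at B P s x"
      unfolding s_def
      by (rule smooth_map_at_compose[OF local_charts_base lcP smooth_map_at_compose[OF
          local_charts_base lcx 1 2] 3])
    then show "s x \<in> points P \<and> pr (s x) = x \<and> smooth_map_at B P s x"
      using pr\<Phi>[OF x one_closed] smooth_map_at_points(2) by (fastforce simp: s_def)
  next
    fix p assume p: "p \<in> points P" "pr p \<in> U"
    then have pV: "p \<in> V" unfolding V_def by blast
    obtain x g where xg: "\<Psi> p = (x, g)" "x \<in> U" "g \<in> carrier G" using \<Psi>U[OF pV] by blast
    then have p_eq: "p = \<Phi> (x, g)" using \<Phi>\<Psi>[OF pV] by simp
    then have x: "x = pr p" using pr\<Phi>[OF xg(2,3)] by simp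
    have k: "k p = g" by (simp add: k_def xg)
    have 1: "smooth_map_at P ?PV (\<lambda>x. x) p" by (rule smooth_map_at_to_restrict_atlas[OF
        smooth_atlas_total V pV])
    have 2: "smooth_map_at ?PV (prod_atlas ?BU (atlas G)) \<Psi> p"
      by (rule smooth_map_imp_smooth_map_at[OF lcP \<Psi>s]) (use pV pts in auto)
    have 3: "smooth_map_at (prod_atlas ?BU (atlas G)) (atlas G) snd (\<Psi> p)"
      unfolding xg by (rule smooth_map_at_snd[OF lcB smooth_atlas_lie]) (use xg UB
          in \<open>auto simp: points_restrict_atlas points_lie\<close>)
    have "smooth_map_at P (atlas G) k p"
      unfolding k_def
      by (rule smooth_map_at_compose[OF local_charts_total lcx smooth_map_at_compose[OF
          local_charts_total lcP 1 2] 3])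
    moreover have "act (s x) g = p"
      using \<Phi>act[OF xg(2) one_closed xg(3)] xg(3) p_eq by (simp add: s_def)
    then have "p = act (s (pr p)) (k p)" using k x by simp
    moreover have "k (act p h) = k p \<otimes>\<^bsub>G\<^esub> h \<and> pr (act p h) = pr p" if h: "h \<in> carrier G" for h
    proof -
      have gh: "g \<otimes>\<^bsub>G\<^esub> h \<in> carrier G" using xg(3) h by simp
      have "act p h = \<Phi> (x, g \<otimes>\<^bsub>G\<^esub> h)" using \<Phi>act[OF xg(2,3) h] p_eq by simp
      then show ?thesis using \<Psi>\<Phi>[of "(x, g \<otimes>\<^bsub>G\<^esub> h)"] pr\<Phi>[OF xg(2) gh] gh xg(2) k x by (simp add: k_def)
    qed
    ultimately show "k p \<in> carrier G \<and> smooth_map_at P (atlas G) k p \<and>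
       p = act (s (pr p)) (k p) \<and> (\<forall>g\<in>carrier G. k (act p g) = k p \<otimes>\<^bsub>G\<^esub> g \<and> pr (act p g) = pr p)"
      using xg(3) k by blast
  qed
qed

lemma pr_act:
  assumes "p \<in> points P" "g \<in> carrier G"
  shows "pr (act p g) = pr p"
proof -
  obtain U k where "pr p \<in> U"
    "\<forall>p\<in>points P. pr p \<in> U \<longrightarrow> (\<forall>g\<in>carrier G. k (act p g) = k p \<otimes>\<^bsub>G\<^esub> g \<and> pr (act p g) = pr p)"
    using local_section[OF pr_points[OF assms(1)]] by blast
  then show ?thesis using assms by blast
qed

lemma act_inv_right: "p \<in> points P \<Longrightarrow> g \<in> carrier G \<Longrightarrow> act (act p g) (inv\<^bsub>G\<^esub> g) = p"
  by (simp add: act_act act_one)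

text \<open>
  If \<open>p' = S(p') \<gamma>(p')\<close> near \<open>p\<close>, the Leibniz rule writes a tangent vector \<open>u\<close> at \<open>p\<close> as the
  translate by \<open>\<gamma>(p)\<close> of \<open>TS u\<close> plus a vertical vector, which is the value at \<open>p\<close> of the
  fundamental vector field of \<open>T(p' \<mapsto> \<gamma>(p)\<^sup>-\<^sup>1 \<gamma>(p')) u\<close>. The properties of a connection are
  required only where they are used, so that the lemma applies to forms that are not known to be
  smooth.
\<close>

lemma connection_decomposition:
  assumes p: "p \<in> points P" and S: "smooth_map_at P P S p" and \<gamma>: "smooth_map_at P (atlas G) \<gamma> p"
    and eq: "eventually_at_point P p (\<lambda>p'. act (S p') (\<gamma> p') = p')" and u: "u \<in> tangent_space P p"
    and add: "\<And>u v. u \<in> tangent_space P p \<Longrightarrow> v \<in> tangent_space P p \<Longrightarrow>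
       \<omega> p (\<lambda>c. u c + v c) = (\<lambda>d. \<omega> p u d + \<omega> p v d)"
    and fund: "\<And>X. X \<in> lie_algebra G \<Longrightarrow> \<omega> p (fundamental_vector_field P G act X p) = X"
    and equiv: "\<And>v. v \<in> tangent_space P (S p) \<Longrightarrow>
       \<omega> (act (S p) (\<gamma> p)) (tangent_map P P (\<lambda>q. act q (\<gamma> p)) (S p) v) = Ad G (inv\<^bsub>G\<^esub> \<gamma> p) (\<omega> (S p) v)"
  shows "\<omega> p u = (\<lambda>d. Ad G (inv\<^bsub>G\<^esub> \<gamma> p) (\<omega> (S p) (tangent_map P P S p u)) d +
      tangent_map P (atlas G) (\<lambda>p'. inv\<^bsub>G\<^esub> \<gamma> p \<otimes>\<^bsub>G\<^esub> \<gamma> p') p u d)"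
proof -
  have Sp: "S p \<in> points P" and \<gamma>p: "\<gamma> p \<in> carrier G"
    using smooth_map_at_points(2)[OF S] smooth_map_at_points(2)[OF \<gamma>] points_lie by auto
  have p_eq: "act (S p) (\<gamma> p) = p" by (rule eventually_at_point_self[OF local_charts_total p eq])
  let ?X = "tangent_map P (atlas G) (\<lambda>p'. inv\<^bsub>G\<^esub> \<gamma> p \<otimes>\<^bsub>G\<^esub> \<gamma> p') p u"
  let ?h = "tangent_map P P (\<lambda>q. act q (\<gamma> p)) (S p) (tangent_map P P S p u)"
  let ?v = "tangent_map (atlas G) P (\<lambda>g. act (S p) g) (\<gamma> p) (tangent_map P (atlas G) \<gamma> p u)"
  have Su: "tangent_map P P S p u \<in> tangent_space P (S p)" by (rule tangent_map_in_tangent_space[OF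
      smooth_atlas_total smooth_atlas_total S u])
  have lmul: "smooth_map_at P (atlas G) (\<lambda>p'. inv\<^bsub>G\<^esub> \<gamma> p \<otimes>\<^bsub>G\<^esub> \<gamma> p') p"
    by (intro smooth_map_at_mult[OF structure_group local_charts_total] \<gamma> smooth_map_at_const p) (use
        \<gamma>p points_lie in auto)
  have one: "inv\<^bsub>G\<^esub> \<gamma> p \<otimes>\<^bsub>G\<^esub> \<gamma> p = \<one>\<^bsub>G\<^esub>" using \<gamma>p by simp
  have X: "?X \<in> lie_algebra G"
    using tangent_map_in_tangent_space[OF smooth_atlas_total smooth_atlas_lie lmul u]
        by (simp add: lie_algebra_eq one)
  have h: "?h \<in> tangent_space P p"
    using tangent_map_in_tangent_space[OF smooth_atlas_total smooth_atlas_total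
        smooth_at_translation[OF Sp \<gamma>p] Su] p_eq by simp
  have v: "?v \<in> tangent_space P p"
    using tangent_map_in_tangent_space[OF smooth_atlas_lie smooth_atlas_total smooth_at_orbit[OF Sp
        \<gamma>p] tangent_map_in_tangent_space[OF smooth_atlas_total smooth_atlas_lie \<gamma> u]] p_eq
    by simp
  have "u = tangent_map P P (\<lambda>p'. p') p u" by (rule tangent_map_ident[OF smooth_atlas_total p u, symmetric])
  also have "\<dots> = tangent_map P P (\<lambda>p'. act (S p') (\<gamma> p')) p u"
    by (rule tangent_map_cong[OF smooth_atlas_total act_smooth_at[OF local_charts_total S \<gamma>] eq u,
        symmetric])
  also have "\<dots> = (\<lambda>c. ?h c + ?v c)"
    by (rule tangent_map_leibniz[OF smooth_atlas_total smooth_atlas_total smooth_atlas_lie S \<gamma>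
        act_smooth_pair[OF Sp \<gamma>p] u])
  finally have u_eq: "u = (\<lambda>c. ?h c + ?v c)" .
  have orb: "smooth_map_at (atlas G) P (\<lambda>g. act p g) (inv\<^bsub>G\<^esub> \<gamma> p \<otimes>\<^bsub>G\<^esub> \<gamma> p)"
    by (rule smooth_at_orbit[OF p]) (simp add: \<gamma>p)
  have "fundamental_vector_field P G act ?X p = tangent_map P P (\<lambda>p'. act p (inv\<^bsub>G\<^esub> \<gamma> p \<otimes>\<^bsub>G\<^esub> \<gamma> p')) p u"
    unfolding fundamental_vector_field_def
    using tangent_map_compose[OF smooth_atlas_total smooth_atlas_lie lmul orb u] one by simp
  also have "\<dots> = tangent_map P P (\<lambda>p'. act (S p) (\<gamma> p')) p u"
  proof (rule tangent_map_cong[OF smooth_atlas_total smooth_map_at_compose[OF local_charts_total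
      local_charts_lie lmul orb] _ u])
    have "act p (inv\<^bsub>G\<^esub> \<gamma> p) = S p" using act_inv_right[OF Sp \<gamma>p] p_eq by simp
    then have "act p (inv\<^bsub>G\<^esub> \<gamma> p \<otimes>\<^bsub>G\<^esub> g) = act (S p) g" if "g \<in> carrier G" for g
      using act_act[OF p _ that, of "inv\<^bsub>G\<^esub> \<gamma> p"] \<gamma>p by simp
    then show "eventually_at_point P p (\<lambda>p'. act p (inv\<^bsub>G\<^esub> \<gamma> p \<otimes>\<^bsub>G\<^esub> \<gamma> p') = act (S p) (\<gamma> p'))"
      using eventually_at_point_mono[OF local_charts_total smooth_map_at_eventually_points[OF \<gamma>]]
          points_lie by simp
  qed
  also have "\<dots> = ?v"
    by (rule tangent_map_compose[OF smooth_atlas_total smooth_atlas_lie \<gamma> smooth_at_orbit[OF Sp \<gamma>p] u])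
  finally have v_eq: "\<omega> p ?v = ?X" using fund[OF X] by simp
  have h_eq: "\<omega> p ?h = Ad G (inv\<^bsub>G\<^esub> \<gamma> p) (\<omega> (S p) (tangent_map P P S p u))"
    using equiv[OF Su] p_eq by simp
  have "\<omega> p u = \<omega> p (\<lambda>c. ?h c + ?v c)" using u_eq by simp
  also have "\<dots> = (\<lambda>d. \<omega> p ?h d + \<omega> p ?v d)" by (rule add[OF h v])
  finally show ?thesis unfolding h_eq v_eq .
qed

lemma Ad_smooth_at:
  assumes k: "k \<in> carrier G"
  shows "smooth_map_at (atlas G) (atlas G) (\<lambda>h. k \<otimes>\<^bsub>G\<^esub> h \<otimes>\<^bsub>G\<^esub> inv\<^bsub>G\<^esub> k) \<one>\<^bsub>G\<^esub>"
  by (intro smooth_map_at_mult[OF structure_group local_charts_lie] smooth_map_at_const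
      smooth_map_at_ident smooth_atlas_lie)
    (use k points_lie in auto)

text \<open>
  The adjoint action on a tangent vector at the unit that is given as the image under a smooth map
  \<open>a\<close>.
\<close>

lemma Ad_tangent_map:
  assumes S: "smooth_atlas S" and a: "smooth_map_at S (atlas G) a x" and ax: "a x = \<one>\<^bsub>G\<^esub>"
      and k: "k \<in> carrier G" and u: "u \<in> tangent_space S x"
  shows "Ad G k (tangent_map S (atlas G) a x u) = tangent_map S (atlas G) (\<lambda>z. k \<otimes>\<^bsub>G\<^esub> a z \<otimes>\<^bsub>G\<^esub> inv\<^bsub>G\<^esub>
      k) x u"
  unfolding Ad_def lie_algebra_map_def
  using tangent_map_compose[OF S smooth_atlas_lie a _ u, of "atlas G" "\<lambda>h. k \<otimes>\<^bsub>G\<^esub> h \<otimes>\<^bsub>G\<^esub> inv\<^bsub>G\<^esub> k"]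
      Ad_smooth_at[OF k] ax by simp

lemma Ad_add:
  assumes "k \<in> carrier G" "X \<in> lie_algebra G" "Y \<in> lie_algebra G"
  shows "Ad G k (\<lambda>d. X d + Y d) = (\<lambda>d. Ad G k X d + Ad G k Y d)"
  unfolding Ad_def lie_algebra_map_def
  by (rule tangent_map_add[OF smooth_atlas_lie Ad_smooth_at]) (use assms in \<open>auto simp: lie_algebra_eq\<close>)

lemma lie_algebra_add: "X \<in> lie_algebra G \<Longrightarrow> Y \<in> lie_algebra G \<Longrightarrow> (\<lambda>d. X d + Y d) \<in> lie_algebra G"
  unfolding lie_algebra_eq by (rule tangent_space_add[OF smooth_atlas_lie one_points])

lemma smooth_lie_form_values:
  assumes "smooth_lie_form P G \<omega>" "p \<in> points P" "u \<in> tangent_space P p"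
  shows "\<omega> p u \<in> lie_algebra G"
  using assms unfolding smooth_lie_form_def by (auto simp: PiE_iff)

lemma smooth_lie_form_add:
  assumes \<omega>: "smooth_lie_form P G \<omega>" and p: "p \<in> points P" and u: "u \<in> tangent_space P p"
      and v: "v \<in> tangent_space P p"
  shows "\<omega> p (\<lambda>c. u c + v c) = (\<lambda>d. \<omega> p u d + \<omega> p v d)"
proof
  fix d
  have uv: "(\<lambda>c. u c + v c) \<in> tangent_space P p" by (rule tangent_space_add[OF smooth_atlas_total p u v])
  note vals = smooth_lie_form_values[OF \<omega> p u] smooth_lie_form_values[OF \<omega> p v]
      smooth_lie_form_values[OF \<omega> p uv]
  show "\<omega> p (\<lambda>c. u c + v c) d = \<omega> p u d + \<omega> p v d"
  proof (cases "d \<in> charts_at (atlas G) \<one>\<^bsub>G\<^esub>")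
    case True
    obtain c where c: "c \<in> charts_at P p" using charts_at_nonempty[OF p] by blast
    obtain A :: "'ep \<Rightarrow> 'ep \<Rightarrow>\<^sub>L 'eg" where A: "\<And>p u. p \<in> fst c \<Longrightarrow> u \<in> tangent_space P p \<Longrightarrow> \<omega> p u d =
        blinfun_apply (A (snd c p)) (u c)"
      using \<omega> charts_atD(1)[OF c] True unfolding smooth_lie_form_def by meson
    show ?thesis
      unfolding A[OF charts_atD(2)[OF c] u] A[OF charts_atD(2)[OF c] v] A[OF charts_atD(2)[OF c] uv]
      by (rule blinfun.add_right)
  next
    case False
    from vals[unfolded lie_algebra_eq, THEN tangent_spaceD(2), OF this] show ?thesis by simp
  qed
qed

end

section \<open>Frames adapted to a bundle morphism\<close>

text \<open>
  A morphism \<open>(f, \<phi>)\<close> of principal bundles over \<open>B\<close> and a connection form \<open>\<omega>\<close> on its source.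
\<close>

locale connection_transfer =
  P: smooth_principal_bundle P G B pr act + Q: smooth_principal_bundle Q H B pr' act'
  for P :: "('p, 'ep::banach) atlas" and G :: "('g, 'eg::banach) lie_group"
    and B :: "('b, 'eb::banach) atlas" and pr :: "'p \<Rightarrow> 'b" and act :: "'p \<Rightarrow> 'g \<Rightarrow> 'p"
    and Q :: "('q, 'eq::banach) atlas" and H :: "('h, 'eh::banach) lie_group"
    and pr' :: "'q \<Rightarrow> 'b" and act' :: "'q \<Rightarrow> 'h \<Rightarrow> 'q" +
  fixes f :: "'p \<Rightarrow> 'q" and \<phi> :: "'g \<Rightarrow> 'h" and \<omega> :: "('p, 'ep, 'g, 'eg) lie_form"
  assumes mor: "principal_bundle_morphism P G pr act Q H pr' act' f \<phi>"
    and conn: "connection_form P G act \<omega>"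
begin

lemma hom: "\<phi> \<in> hom G H"
  using mor unfolding principal_bundle_morphism_def lie_group_hom_def by blast

sublocale \<phi>: group_hom G H \<phi>
  by unfold_locales (rule hom)

lemma f_smooth_at: "p \<in> points P \<Longrightarrow> smooth_map_at P Q f p"
  using mor unfolding principal_bundle_morphism_def
  by (intro smooth_map_imp_smooth_map_at[OF P.local_charts_total]) blast+

lemma f_points: "p \<in> points P \<Longrightarrow> f p \<in> points Q"
  by (rule smooth_map_at_points(2)[OF f_smooth_at])

lemma \<phi>_smooth_at: "g \<in> carrier G \<Longrightarrow> smooth_map_at (atlas G) (atlas H) \<phi> g"
  using mor P.points_lie unfolding principal_bundle_morphism_def lie_group_hom_def
  by (intro smooth_map_imp_smooth_map_at[OF P.local_charts_lie]) blast+

lemma pr_f: "p \<in> points P \<Longrightarrow> pr' (f p) = pr p"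
  using mor unfolding principal_bundle_morphism_def by blast

lemma f_act: "p \<in> points P \<Longrightarrow> g \<in> carrier G \<Longrightarrow> f (act p g) = act' (f p) (\<phi> g)"
  using mor unfolding principal_bundle_morphism_def by blast

lemma form: "smooth_lie_form P G \<omega>"
  using conn unfolding connection_form_def by blast

lemmas \<omega>_values = P.smooth_lie_form_values[OF form] and \<omega>_add = P.smooth_lie_form_add[OF form]

lemma \<omega>_fund: "X \<in> lie_algebra G \<Longrightarrow> p \<in> points P \<Longrightarrow> \<omega> p (fundamental_vector_field P G act X p) = X"
  using conn unfolding connection_form_def by blast

lemma \<omega>_equiv: "g \<in> carrier G \<Longrightarrow> p \<in> points P \<Longrightarrow> u \<in> tangent_space P p \<Longrightarrow>
    \<omega> (act p g) (tangent_map P P (\<lambda>q. act q g) p u) = Ad G (inv\<^bsub>G\<^esub> g) (\<omega> p u)"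
  using conn unfolding connection_form_def by blast

lemma \<omega>_zero:
  assumes p: "p \<in> points P"
  shows "\<omega> p (\<lambda>c. 0) = (\<lambda>d. 0)"
proof
  fix d
  have z: "(\<lambda>c. 0) \<in> tangent_space P p" by (rule tangent_space_zero[OF P.smooth_atlas_total p])
  have "\<omega> p (\<lambda>c. 0) d = \<omega> p (\<lambda>c. 0) d + \<omega> p (\<lambda>c. 0) d"
    using fun_cong[OF \<omega>_add[OF p z z], of d] by simp
  then show "\<omega> p (\<lambda>c. 0) d = 0" by simp
qed

text \<open>
  \<open>\<phi>\<close> followed by conjugation with \<open>k\<^sup>-\<^sup>1\<close>; its tangent map at the unit is the Lie algebra map of
  \<open>\<phi>\<close> followed by \<open>Ad(k\<^sup>-\<^sup>1)\<close>.
\<close>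

definition twisted :: "'h \<Rightarrow> 'g \<Rightarrow> 'h" where
  "twisted k g = inv\<^bsub>H\<^esub> k \<otimes>\<^bsub>H\<^esub> \<phi> g \<otimes>\<^bsub>H\<^esub> k"

text \<open>
  The tangent map of \<open>twisted k\<close> at the unit.
\<close>

abbreviation twisted_map :: "'h \<Rightarrow> ('g, 'eg) tangent_vector \<Rightarrow> ('h, 'eh) tangent_vector" where
  "twisted_map k \<equiv> tangent_map (atlas G) (atlas H) (twisted k) \<one>\<^bsub>G\<^esub>"

lemma twisted_one: "k \<in> carrier H \<Longrightarrow> twisted k \<one>\<^bsub>G\<^esub> = \<one>\<^bsub>H\<^esub>"
  by (simp add: twisted_def)

lemma twisted_smooth_at:
  assumes "k \<in> carrier H"
  shows "smooth_map_at (atlas G) (atlas H) (twisted k) \<one>\<^bsub>G\<^esub>"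
  unfolding twisted_def
  by (intro smooth_map_at_mult[OF Q.structure_group P.local_charts_lie] smooth_map_at_const \<phi>_smooth_at)
    (use assms P.points_lie Q.points_lie in auto)

lemma twisted_in_lie_algebra:
  assumes "k \<in> carrier H" "X \<in> lie_algebra G"
  shows "twisted_map k X \<in> lie_algebra H"
  using tangent_map_in_tangent_space[OF P.smooth_atlas_lie Q.smooth_atlas_lie twisted_smooth_at[OF
      assms(1)]] assms twisted_one
  by (simp add: lie_algebra_def)

lemma Ad_twisted:
  assumes k: "k \<in> carrier H" and h: "h \<in> carrier H" and X: "X \<in> lie_algebra G"
  shows "Ad H (inv\<^bsub>H\<^esub> h) (twisted_map k X) =
    twisted_map (k \<otimes>\<^bsub>H\<^esub> h) X"
proof -
  have X': "X \<in> tangent_space (atlas G) \<one>\<^bsub>G\<^esub>" using X by (simp add: lie_algebra_def)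
  have h': "inv\<^bsub>H\<^esub> h \<in> carrier H" using h by simp
  have kh: "k \<otimes>\<^bsub>H\<^esub> h \<in> carrier H" using k h by simp
  have eq: "inv\<^bsub>H\<^esub> h \<otimes>\<^bsub>H\<^esub> twisted k g \<otimes>\<^bsub>H\<^esub> inv\<^bsub>H\<^esub> (inv\<^bsub>H\<^esub> h) = twisted (k \<otimes>\<^bsub>H\<^esub> h) g"
      if "g \<in> carrier G" for g
    using that k h by (simp add: twisted_def Q.inv_mult_group Q.m_assoc)
  have "Ad H (inv\<^bsub>H\<^esub> h) (twisted_map k X) =
    tangent_map (atlas G) (atlas H) (\<lambda>g. inv\<^bsub>H\<^esub> h \<otimes>\<^bsub>H\<^esub> twisted k g \<otimes>\<^bsub>H\<^esub> inv\<^bsub>H\<^esub> (inv\<^bsub>H\<^esub> h)) \<one>\<^bsub>G\<^esub> X"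
    by (rule Q.Ad_tangent_map[OF P.smooth_atlas_lie twisted_smooth_at[OF k] twisted_one[OF k] h' X'])
  also have "\<dots> = twisted_map (k \<otimes>\<^bsub>H\<^esub> h) X"
    by (rule tangent_map_cong[OF P.smooth_atlas_lie twisted_smooth_at[OF kh] _ X', symmetric],
        rule eventually_at_point_points[OF P.local_charts_lie]) (use eq P.points_lie in auto)
  finally show ?thesis .
qed

lemma lie_algebra_map_twisted:
  assumes X: "X \<in> lie_algebra G"
  shows "lie_algebra_map G H \<phi> X = twisted_map \<one>\<^bsub>H\<^esub> X"
  unfolding lie_algebra_map_def
proof (rule tangent_map_cong[OF P.smooth_atlas_lie \<phi>_smooth_at])
  show "eventually_at_point (atlas G) \<one>\<^bsub>G\<^esub> (\<lambda>z. \<phi> z = twisted \<one>\<^bsub>H\<^esub> z)"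
    by (rule eventually_at_point_points[OF P.local_charts_lie]) (simp add: P.points_lie twisted_def)
qed (use X in \<open>auto simp: lie_algebra_def\<close>)

lemma twisted_\<phi>:
  assumes g: "g \<in> carrier G" and X: "X \<in> lie_algebra G"
  shows "twisted_map (\<phi> g) X = lie_algebra_map G H \<phi> (Ad G (inv\<^bsub>G\<^esub> g) X)"
proof -
  let ?c = "\<lambda>h. inv\<^bsub>G\<^esub> g \<otimes>\<^bsub>G\<^esub> h \<otimes>\<^bsub>G\<^esub> inv\<^bsub>G\<^esub> (inv\<^bsub>G\<^esub> g)"
  have X': "X \<in> tangent_space (atlas G) \<one>\<^bsub>G\<^esub>" using X by (simp add: lie_algebra_def)
  have g': "inv\<^bsub>G\<^esub> g \<in> carrier G" using g by simp
  have c1: "?c \<one>\<^bsub>G\<^esub> = \<one>\<^bsub>G\<^esub>" using g by simp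
  have \<phi>c: "smooth_map_at (atlas G) (atlas H) \<phi> (?c \<one>\<^bsub>G\<^esub>)" by (rule \<phi>_smooth_at) (use g in simp)
  have "lie_algebra_map G H \<phi> (Ad G (inv\<^bsub>G\<^esub> g) X) = tangent_map (atlas G) (atlas H) (\<lambda>h. \<phi> (?c h)) \<one>\<^bsub>G\<^esub> X"
    using tangent_map_compose[OF P.smooth_atlas_lie P.smooth_atlas_lie P.Ad_smooth_at[OF g'] \<phi>c X'] c1
    by (simp add: lie_algebra_map_def Ad_def)
  also have "\<dots> = twisted_map (\<phi> g) X"
  proof (rule tangent_map_cong[OF P.smooth_atlas_lie smooth_map_at_compose[OF P.local_charts_lie
      P.local_charts_lie P.Ad_smooth_at[OF g'] \<phi>c] _ X'])
    show "eventually_at_point (atlas G) \<one>\<^bsub>G\<^esub> (\<lambda>h. \<phi> (?c h) = twisted (\<phi> g) h)"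
      by (rule eventually_at_point_points[OF P.local_charts_lie]) (use g
          in \<open>simp add: P.points_lie twisted_def\<close>)
  qed
  finally show ?thesis by simp
qed

text \<open>
  \<open>s\<close> is a section of \<open>P\<close> over a neighbourhood \<open>W\<close> of each of its points, and \<open>\<gamma>\<close> and \<open>\<tau>\<close> are the
  group components with respect to the sections \<open>s\<close> of \<open>P\<close> and \<open>f \<circ> s\<close> of \<open>Q\<close>. The values of the
  three maps outside of \<open>W\<close> and the fibres over it are arbitrary.
\<close>

definition frame :: "'b set \<Rightarrow> ('b \<Rightarrow> 'p) \<Rightarrow> ('p \<Rightarrow> 'g) \<Rightarrow> ('q \<Rightarrow> 'h) \<Rightarrow> bool" where
  "frame W s \<gamma> \<tau> \<longleftrightarrow>
     (\<forall>x\<in>W. eventually_at_point B x (\<lambda>z. z \<in> W) \<and> s x \<in> points P \<and> pr (s x) = x \<and> smooth_map_at B P s x) \<and>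
     (\<forall>p\<in>points P. pr p \<in> W \<longrightarrow> \<gamma> p \<in> carrier G \<and> smooth_map_at P (atlas G) \<gamma> p \<and>
        act (s (pr p)) (\<gamma> p) = p \<and> \<tau> (f p) = \<phi> (\<gamma> p)) \<and>
     (\<forall>q\<in>points Q. pr' q \<in> W \<longrightarrow> \<tau> q \<in> carrier H \<and> smooth_map_at Q (atlas H) \<tau> q \<and>
        act' (f (s (pr' q))) (\<tau> q) = q \<and> (\<forall>h\<in>carrier H. \<tau> (act' q h) = \<tau> q \<otimes>\<^bsub>H\<^esub> h))"

text \<open>
  \<open>\<tau>\<close> is the group component \<open>k\<close> of a trivialization of \<open>Q\<close>, normalized to be \<open>1\<close> on the section
  \<open>f \<circ> s\<close>.
\<close>

lemma frame_exists:
  assumes b: "b \<in> points B"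
  shows "\<exists>W s \<gamma> \<tau>. b \<in> W \<and> frame W s \<gamma> \<tau>"
proof -
  obtain U s \<gamma> where U: "open_in_manifold B U" "b \<in> U"
    and s: "\<forall>x\<in>U. s x \<in> points P \<and> pr (s x) = x \<and> smooth_map_at B P s x"
    and \<gamma>: "\<forall>p\<in>points P. pr p \<in> U \<longrightarrow> \<gamma> p \<in> carrier G \<and> smooth_map_at P (atlas G) \<gamma> p \<and>
       p = act (s (pr p)) (\<gamma> p) \<and> (\<forall>g\<in>carrier G. \<gamma> (act p g) = \<gamma> p \<otimes>\<^bsub>G\<^esub> g \<and> pr (act p g) = pr p)"
    using P.local_section[OF b] by blast
  note s = s[rule_format] and \<gamma> = bspec[OF \<gamma>, THEN mp]
  obtain U' t k where U': "open_in_manifold B U'" "b \<in> U'"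
    and t: "\<forall>x\<in>U'. t x \<in> points Q \<and> pr' (t x) = x \<and> smooth_map_at B Q t x"
    and k: "\<forall>q\<in>points Q. pr' q \<in> U' \<longrightarrow> k q \<in> carrier H \<and> smooth_map_at Q (atlas H) k q \<and>
       q = act' (t (pr' q)) (k q) \<and> (\<forall>h\<in>carrier H. k (act' q h) = k q \<otimes>\<^bsub>H\<^esub> h \<and> pr' (act' q h) = pr' q)"
    using Q.local_section[OF b] by blast
  note t = t[rule_format] and k = bspec[OF k, THEN mp]
  \<comment> \<open>both bundles are trivial over \<open>W\<close>\<close>
  define W where "W = U \<inter> U'"
  define \<tau> where "\<tau> q = inv\<^bsub>H\<^esub> (k (f (s (pr' q)))) \<otimes>\<^bsub>H\<^esub> k q" for q
  have fs: "f (s x) \<in> points Q" "pr' (f (s x)) = x" if "x \<in> W" for x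
    using that s[of x] f_points pr_f by (auto simp: W_def)
  have kfs: "k (f (s x)) \<in> carrier H" if "x \<in> W" for x
    using k[OF fs(1)[OF that]] fs(2)[OF that] that by (simp add: W_def)
  have "frame W s \<gamma> \<tau>"
    unfolding frame_def
  proof (intro conjI ballI impI)
    fix x assume x: "x \<in> W"
    then show "s x \<in> points P" "pr (s x) = x" "smooth_map_at B P s x" using s by (auto simp: W_def)
    show "eventually_at_point B x (\<lambda>z. z \<in> W)"
      using eventually_at_point_conj[OF open_in_manifold_eventually[OF P.local_charts_base U(1), of x]
          open_in_manifold_eventually[OF P.local_charts_base U'(1), of x]] x
      by (simp add: W_def)
  next
    fix p assume p: "p \<in> points P" "pr p \<in> W"
    then have pU: "pr p \<in> U" by (simp add: W_def)
    note g = \<gamma>[OF p(1) pU]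
    show "\<gamma> p \<in> carrier G" "smooth_map_at P (atlas G) \<gamma> p" "act (s (pr p)) (\<gamma> p) = p" using g by simp_all
    have "f p = act' (f (s (pr p))) (\<phi> (\<gamma> p))"
      using f_act[of "s (pr p)" "\<gamma> p"] g s[OF pU] by simp
    then have "k (f p) = k (f (s (pr p))) \<otimes>\<^bsub>H\<^esub> \<phi> (\<gamma> p)"
      using k[OF fs(1)[OF p(2)]] fs(2)[OF p(2)] p(2) g by (simp add: W_def)
    then show "\<tau> (f p) = \<phi> (\<gamma> p)"
      using kfs[OF p(2)] g by (simp add: \<tau>_def pr_f[OF p(1)] flip: Q.m_assoc)
  next
    fix q assume q: "q \<in> points Q" "pr' q \<in> W"
    then have qU: "pr' q \<in> U'" "pr' q \<in> U" by (simp_all add: W_def)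
    note kq = k[OF q(1) qU(1)] and fsq = fs[OF q(2)] and kfsq = kfs[OF q(2)]
    note ks = k[OF fsq(1), unfolded fsq(2), OF qU(1)]
    let ?x = "pr' q"
    show \<tau>q: "\<tau> q \<in> carrier H" using kq kfsq by (simp add: \<tau>_def)
    have "smooth_map_at Q P (\<lambda>q. s (pr' q)) q"
      by (rule smooth_map_at_compose[OF Q.local_charts_total P.local_charts_base Q.pr_smooth_at[OF q(1)]])
        (use s[OF qU(2)] in simp)
    then have "smooth_map_at Q Q (\<lambda>q. f (s (pr' q))) q"
      by (rule smooth_map_at_compose[OF Q.local_charts_total P.local_charts_total _ f_smooth_at]) (use
          s[OF qU(2)] in simp)
    then have "smooth_map_at Q (atlas H) (\<lambda>q. k (f (s (pr' q)))) q"
      by (rule smooth_map_at_compose[OF Q.local_charts_total Q.local_charts_total]) (use ks in simp)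
    then show "smooth_map_at Q (atlas H) \<tau> q"
      unfolding \<tau>_def
      by (intro smooth_map_at_mult[OF Q.structure_group Q.local_charts_total] smooth_map_at_inv[OF
          Q.structure_group Q.local_charts_total])
        (use kq in auto)
    have "act' (f (s ?x)) (\<tau> q) = act' (act' (t ?x) (k (f (s ?x)))) (\<tau> q)" using ks by simp
    also have "\<dots> = act' (t ?x) (k q)"
      using Q.act_act[of "t ?x" "k (f (s ?x))" "\<tau> q"] t[OF qU(1)] kfsq \<tau>q kq
      by (simp add: \<tau>_def flip: Q.m_assoc)
    finally show "act' (f (s ?x)) (\<tau> q) = q" using kq by simp
    show "\<tau> (act' q h) = \<tau> q \<otimes>\<^bsub>H\<^esub> h" if "h \<in> carrier H" for h
      using kq kfsq that by (simp add: \<tau>_def Q.m_assoc)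
  qed
  then show ?thesis using U(2) U'(2) unfolding W_def by blast
qed

text \<open>
  The tangent map of \<open>s \<circ> pr'\<close>; meaningful over the domain of the section \<open>s\<close>.
\<close>

abbreviation section_map ::
    "('b \<Rightarrow> 'p) \<Rightarrow> 'q \<Rightarrow> ('q, 'eq) tangent_vector \<Rightarrow> ('p, 'ep) tangent_vector" where
  "section_map s \<equiv> tangent_map Q P (\<lambda>q. s (pr' q))"

text \<open>
  The tangent map of \<open>log_at \<tau> q\<close> at \<open>q\<close> is the logarithmic derivative \<open>\<tau>\<^sup>-\<^sup>1 d\<tau>\<close>.
\<close>

abbreviation log_at :: "('q \<Rightarrow> 'h) \<Rightarrow> 'q \<Rightarrow> 'q \<Rightarrow> 'h" where
  "log_at \<tau> q \<equiv> \<lambda>q'. inv\<^bsub>H\<^esub> \<tau> q \<otimes>\<^bsub>H\<^esub> \<tau> q'"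

text \<open>
  The form \<open>Ad(\<tau>\<^sup>-\<^sup>1) \<phi>\<^sub>*(s\<^sup>*\<omega>) + \<tau>\<^sup>-\<^sup>1 d\<tau>\<close> on the part of \<open>Q\<close> over the domain of the frame. It is
  defined for all arguments, but meaningful only there.
\<close>

definition gauge_form :: "('b \<Rightarrow> 'p) \<Rightarrow> ('q \<Rightarrow> 'h) \<Rightarrow> ('q, 'eq, 'h, 'eh) lie_form" where
  "gauge_form s \<tau> q v = (\<lambda>d.
     twisted_map (\<tau> q)
       (\<omega> (s (pr' q)) (section_map s q v)) d +
     tangent_map Q (atlas H) (log_at \<tau> q) q v d)"

end

section \<open>The gauge form of a frame\<close>

text \<open>
  A morphism, a connection and a frame for the morphism.
\<close>

locale connection_transfer_frame = connection_transfer P G B pr act Q H pr' act' f \<phi> \<omega>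
  for P :: "('p, 'ep::banach) atlas" and G :: "('g, 'eg::banach) lie_group"
    and B :: "('b, 'eb::banach) atlas" and pr :: "'p \<Rightarrow> 'b" and act :: "'p \<Rightarrow> 'g \<Rightarrow> 'p"
    and Q :: "('q, 'eq::banach) atlas" and H :: "('h, 'eh::banach) lie_group"
    and pr' :: "'q \<Rightarrow> 'b" and act' :: "'q \<Rightarrow> 'h \<Rightarrow> 'q"
    and f :: "'p \<Rightarrow> 'q" and \<phi> :: "'g \<Rightarrow> 'h" and \<omega> :: "('p, 'ep, 'g, 'eg) lie_form" +
  fixes W s \<gamma> \<tau>
  assumes frame: "frame W s \<gamma> \<tau>"
begin

lemma W_eventually: "x \<in> W \<Longrightarrow> eventually_at_point B x (\<lambda>z. z \<in> W)"
  and s_points: "x \<in> W \<Longrightarrow> s x \<in> points P"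
  and s_smooth_at: "x \<in> W \<Longrightarrow> smooth_map_at B P s x"
  using frame unfolding frame_def by blast+

lemma \<gamma>_carrier: "p \<in> points P \<Longrightarrow> pr p \<in> W \<Longrightarrow> \<gamma> p \<in> carrier G"
  and \<gamma>_smooth_at: "p \<in> points P \<Longrightarrow> pr p \<in> W \<Longrightarrow> smooth_map_at P (atlas G) \<gamma> p"
  and act_\<gamma>: "p \<in> points P \<Longrightarrow> pr p \<in> W \<Longrightarrow> act (s (pr p)) (\<gamma> p) = p"
  and \<tau>_f: "p \<in> points P \<Longrightarrow> pr p \<in> W \<Longrightarrow> \<tau> (f p) = \<phi> (\<gamma> p)"
  using frame unfolding frame_def by blast+

lemma \<tau>_carrier: "q \<in> points Q \<Longrightarrow> pr' q \<in> W \<Longrightarrow> \<tau> q \<in> carrier H"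
  and \<tau>_smooth_at: "q \<in> points Q \<Longrightarrow> pr' q \<in> W \<Longrightarrow> smooth_map_at Q (atlas H) \<tau> q"
  and act_\<tau>: "q \<in> points Q \<Longrightarrow> pr' q \<in> W \<Longrightarrow> act' (f (s (pr' q))) (\<tau> q) = q"
  and \<tau>_act: "q \<in> points Q \<Longrightarrow> pr' q \<in> W \<Longrightarrow> h \<in> carrier H \<Longrightarrow> \<tau> (act' q h) = \<tau> q \<otimes>\<^bsub>H\<^esub> h"
  using frame unfolding frame_def by blast+

lemma P_eventually: "p \<in> points P \<Longrightarrow> pr p \<in> W \<Longrightarrow> eventually_at_point P p (\<lambda>z. z \<in> points P \<and> pr z \<in> W)"
  by (intro eventually_at_point_conj eventually_at_point_points[OF P.local_charts_total]
      eventually_at_point_compose[OF P.local_charts_total P.local_charts_base P.pr_smooth_at W_eventually])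

lemma Q_eventually: "q \<in> points Q \<Longrightarrow> pr' q \<in> W \<Longrightarrow> eventually_at_point Q q (\<lambda>z. z \<in> points Q \<and> pr' z \<in> W)"
  by (intro eventually_at_point_conj eventually_at_point_points[OF Q.local_charts_total]
      eventually_at_point_compose[OF Q.local_charts_total P.local_charts_base Q.pr_smooth_at W_eventually])

lemma P_section_smooth_at: "p \<in> points P \<Longrightarrow> pr p \<in> W \<Longrightarrow> smooth_map_at P P (\<lambda>p. s (pr p)) p"
  by (rule smooth_map_at_compose[OF P.local_charts_total P.local_charts_base P.pr_smooth_at s_smooth_at])

lemma Q_section_smooth_at: "q \<in> points Q \<Longrightarrow> pr' q \<in> W \<Longrightarrow> smooth_map_at Q P (\<lambda>q. s (pr' q)) q"
  by (rule smooth_map_at_compose[OF Q.local_charts_total P.local_charts_base Q.pr_smooth_at s_smooth_at])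

lemma \<tau>_log_smooth_at: "q \<in> points Q \<Longrightarrow> pr' q \<in> W \<Longrightarrow> smooth_map_at Q (atlas H) (log_at \<tau> q) q"
  by (intro smooth_map_at_mult[OF Q.structure_group Q.local_charts_total] smooth_map_at_const \<tau>_smooth_at)
    (simp_all add: Q.points_lie \<tau>_carrier)

lemma \<gamma>_log_smooth_at: "p \<in> points P \<Longrightarrow> pr p \<in> W \<Longrightarrow> smooth_map_at P (atlas G) (\<lambda>p'. inv\<^bsub>G\<^esub> \<gamma> p \<otimes>\<^bsub>G\<^esub> \<gamma> p') p"
  by (intro smooth_map_at_mult[OF P.structure_group P.local_charts_total] smooth_map_at_const \<gamma>_smooth_at)
    (simp_all add: P.points_lie \<gamma>_carrier)

context
  fixes q v
  assumes q: "q \<in> points Q" and qW: "pr' q \<in> W" and v: "v \<in> tangent_space Q q"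
begin

lemma base_form_in_lie_algebra:
  "\<omega> (s (pr' q)) (section_map s q v) \<in> lie_algebra G"
  by (rule \<omega>_values[OF s_points[OF qW] tangent_map_in_tangent_space[OF Q.smooth_atlas_total
      P.smooth_atlas_total Q_section_smooth_at[OF q qW] v]])

lemma twisted_base_form_in_lie_algebra:
  "twisted_map (\<tau> q)
       (\<omega> (s (pr' q)) (section_map s q v)) \<in> lie_algebra H"
  by (rule twisted_in_lie_algebra[OF \<tau>_carrier[OF q qW] base_form_in_lie_algebra])

lemma \<tau>_log_in_lie_algebra:
  "tangent_map Q (atlas H) (log_at \<tau> q) q v \<in> lie_algebra H"
  using tangent_map_in_tangent_space[OF Q.smooth_atlas_total Q.smooth_atlas_lie \<tau>_log_smooth_at[OF q
      qW] v] \<tau>_carrier[OF q qW]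
  by (simp add: lie_algebra_def)

lemma gauge_form_in_lie_algebra: "gauge_form s \<tau> q v \<in> lie_algebra H"
  unfolding gauge_form_def by (rule Q.lie_algebra_add[OF twisted_base_form_in_lie_algebra
      \<tau>_log_in_lie_algebra])

lemma gauge_form_add:
  assumes w: "w \<in> tangent_space Q q"
  shows "gauge_form s \<tau> q (\<lambda>c. v c + w c) = (\<lambda>d. gauge_form s \<tau> q v d + gauge_form s \<tau> q w d)"
proof -
  note S = Q_section_smooth_at[OF q qW]
  note Tv = tangent_map_in_tangent_space[OF Q.smooth_atlas_total P.smooth_atlas_total S v] and Tw =
      tangent_map_in_tangent_space[OF Q.smooth_atlas_total P.smooth_atlas_total S w]
  note lw = \<omega>_values[OF s_points[OF qW] Tw]
  have "twisted_map (\<tau> q)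
       (\<omega> (s (pr' q)) (section_map s q (\<lambda>c. v c + w c))) =
    (\<lambda>d. twisted_map (\<tau> q) (\<omega> (s (pr' q)) (section_map s q v)) d +
      twisted_map (\<tau> q) (\<omega> (s (pr' q)) (section_map s q w)) d)"
    unfolding tangent_map_add[OF Q.smooth_atlas_total S v w] \<omega>_add[OF s_points[OF qW] Tv Tw]
    by (rule tangent_map_add[OF P.smooth_atlas_lie twisted_smooth_at[OF \<tau>_carrier[OF q qW]]])
      (use base_form_in_lie_algebra lw in \<open>simp_all add: lie_algebra_def\<close>)
  then show ?thesis
    unfolding gauge_form_def tangent_map_add[OF Q.smooth_atlas_total \<tau>_log_smooth_at[OF q qW] v w]
    by (simp add: algebra_simps)
qed

lemma gauge_form_equiv:
  assumes h: "h \<in> carrier H"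
  shows "gauge_form s \<tau> (act' q h) (tangent_map Q Q (\<lambda>q. act' q h) q v) = Ad H (inv\<^bsub>H\<^esub> h) (gauge_form
      s \<tau> q v)"
proof -
  let ?Rv = "tangent_map Q Q (\<lambda>q. act' q h) q v"
  let ?Sv = "section_map s q v"
  let ?L = "\<lambda>q'. inv\<^bsub>H\<^esub> \<tau> q \<otimes>\<^bsub>H\<^esub> \<tau> q'"
  have qh: "act' q h \<in> points Q" and prh: "pr' (act' q h) = pr' q" using q h
      by (simp_all add: Q.act_points Q.pr_act)
  have qhW: "pr' (act' q h) \<in> W" using prh qW by simp
  have h': "inv\<^bsub>H\<^esub> h \<in> carrier H" using h by simp
  note R = Q.smooth_at_translation[OF q h]
  have "section_map s (act' q h) ?Rv = tangent_map Q P (\<lambda>q'. s (pr' (act' q' h))) q v"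
    by (rule tangent_map_compose[OF Q.smooth_atlas_total Q.smooth_atlas_total R Q_section_smooth_at[OF
        qh qhW] v, symmetric])
  also have "\<dots> = ?Sv"
    by (rule tangent_map_cong[OF Q.smooth_atlas_total Q_section_smooth_at[OF q qW] _ v, symmetric],
        rule eventually_at_point_points[OF Q.local_charts_total]) (simp add: Q.pr_act h)
  finally have 1: "section_map s (act' q h) ?Rv = ?Sv" .
  have "tangent_map Q (atlas H) (log_at \<tau> (act' q h)) (act' q h) ?Rv =
    tangent_map Q (atlas H) (\<lambda>q'. inv\<^bsub>H\<^esub> \<tau> (act' q h) \<otimes>\<^bsub>H\<^esub> \<tau> (act' q' h)) q v"
    by (rule tangent_map_compose[OF Q.smooth_atlas_total Q.smooth_atlas_total R \<tau>_log_smooth_at[OF qh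
        qhW] v, symmetric])
  also have "\<dots> = tangent_map Q (atlas H) (\<lambda>q'. inv\<^bsub>H\<^esub> h \<otimes>\<^bsub>H\<^esub> ?L q' \<otimes>\<^bsub>H\<^esub> inv\<^bsub>H\<^esub> (inv\<^bsub>H\<^esub> h)) q v"
  proof (rule tangent_map_cong[OF Q.smooth_atlas_total smooth_map_at_compose[OF Q.local_charts_total
      Q.local_charts_total R \<tau>_log_smooth_at[OF qh qhW]] _ v])
    show "eventually_at_point Q q (\<lambda>q'. inv\<^bsub>H\<^esub> \<tau> (act' q h) \<otimes>\<^bsub>H\<^esub> \<tau> (act' q' h) =
        inv\<^bsub>H\<^esub> h \<otimes>\<^bsub>H\<^esub> ?L q' \<otimes>\<^bsub>H\<^esub> inv\<^bsub>H\<^esub> (inv\<^bsub>H\<^esub> h))"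
      by (rule eventually_at_point_mono[OF Q.local_charts_total Q_eventually[OF q qW]])
        (use q qW h in \<open>simp add: \<tau>_act \<tau>_carrier Q.inv_mult_group Q.m_assoc\<close>)
  qed
  also have "\<dots> = Ad H (inv\<^bsub>H\<^esub> h) (tangent_map Q (atlas H) ?L q v)"
    by (rule Q.Ad_tangent_map[OF Q.smooth_atlas_total \<tau>_log_smooth_at[OF q qW] _ h' v, symmetric])
        (use \<tau>_carrier[OF q qW] in simp)
  finally have 2: "tangent_map Q (atlas H) (log_at \<tau> (act' q h)) (act' q h) ?Rv =
    Ad H (inv\<^bsub>H\<^esub> h) (tangent_map Q (atlas H) ?L q v)" .
  show ?thesis
    unfolding gauge_form_def Q.Ad_add[OF h' twisted_base_form_in_lie_algebra \<tau>_log_in_lie_algebra] 1 2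
    unfolding Ad_twisted[OF \<tau>_carrier[OF q qW] h base_form_in_lie_algebra] \<tau>_act[OF q qW h] prh
    ..
qed

text \<open>
  A form with the pointwise properties of a connection that is related with \<open>\<omega>\<close> is the gauge form.
  Smoothness is not assumed.
\<close>

lemma gauge_form_unique:
  assumes add: "\<And>u v. u \<in> tangent_space Q q \<Longrightarrow> v \<in> tangent_space Q q \<Longrightarrow>
       \<theta> q (\<lambda>c. u c + v c) = (\<lambda>d. \<theta> q u d + \<theta> q v d)"
    and fund: "\<And>X. X \<in> lie_algebra H \<Longrightarrow> \<theta> q (fundamental_vector_field Q H act' X q) = X"
    and equiv: "\<And>q h v. h \<in> carrier H \<Longrightarrow> q \<in> points Q \<Longrightarrow> v \<in> tangent_space Q q \<Longrightarrow>
       \<theta> (act' q h) (tangent_map Q Q (\<lambda>q. act' q h) q v) = Ad H (inv\<^bsub>H\<^esub> h) (\<theta> q v)"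
    and rel: "related_connections P G Q H f \<phi> \<omega> \<theta>"
  shows "\<theta> q v = gauge_form s \<tau> q v"
proof -
  let ?S = "\<lambda>q. f (s (pr' q))"
  let ?Sv = "section_map s q v"
  note sm = Q_section_smooth_at[OF q qW] and sp = s_points[OF qW] and \<tau>q = \<tau>_carrier[OF q qW]
  have S: "smooth_map_at Q Q ?S q"
    by (rule smooth_map_at_compose[OF Q.local_charts_total P.local_charts_total sm f_smooth_at[OF sp]])
  have Sv: "?Sv \<in> tangent_space P (s (pr' q))" by (rule tangent_map_in_tangent_space[OF
      Q.smooth_atlas_total P.smooth_atlas_total sm v])
  have eq: "eventually_at_point Q q (\<lambda>q'. act' (?S q') (\<tau> q') = q')"
    by (rule eventually_at_point_mono[OF Q.local_charts_total Q_eventually[OF q qW]]) (simp add: act_\<tau>)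
  have "\<theta> q v = (\<lambda>d. Ad H (inv\<^bsub>H\<^esub> \<tau> q) (\<theta> (?S q) (tangent_map Q Q ?S q v)) d +
      tangent_map Q (atlas H) (log_at \<tau> q) q v d)"
    by (rule Q.connection_decomposition[OF q S \<tau>_smooth_at[OF q qW] eq v add fund equiv[OF \<tau>q
        f_points[OF sp]]])
  moreover have "tangent_map Q Q ?S q v = tangent_map P Q f (s (pr' q)) ?Sv"
    by (rule tangent_map_compose[OF Q.smooth_atlas_total P.smooth_atlas_total sm f_smooth_at[OF sp] v])
  then have "\<theta> (?S q) (tangent_map Q Q ?S q v) = lie_algebra_map G H \<phi> (\<omega> (s (pr' q)) ?Sv)"
    using rel sp Sv unfolding related_connections_def by simp
  moreover have "Ad H (inv\<^bsub>H\<^esub> \<tau> q) (lie_algebra_map G H \<phi> (\<omega> (s (pr' q)) ?Sv)) =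
      twisted_map (\<tau> q) (\<omega> (s (pr' q)) ?Sv)"
    using Ad_twisted[OF Q.one_closed \<tau>q base_form_in_lie_algebra] lie_algebra_map_twisted[OF
        base_form_in_lie_algebra] \<tau>q
    by simp
  ultimately show ?thesis unfolding gauge_form_def by simp
qed

end

text \<open>
  The base component of a vertical vector is zero, and \<open>\<tau>(q)\<^sup>-\<^sup>1 \<tau>(q h) = h\<close>.
\<close>

lemma gauge_form_fund:
  assumes q: "q \<in> points Q" and qW: "pr' q \<in> W" and X: "X \<in> lie_algebra H"
  shows "gauge_form s \<tau> q (fundamental_vector_field Q H act' X q) = X"
proof -
  have X': "X \<in> tangent_space (atlas H) \<one>\<^bsub>H\<^esub>" using X by (simp add: lie_algebra_def)
  note orb = Q.smooth_at_orbit[OF q Q.one_closed] and q1 = Q.act_one[OF q]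
  let ?V = "tangent_map (atlas H) Q (\<lambda>h. act' q h) \<one>\<^bsub>H\<^esub> X"
  have "section_map s q ?V = tangent_map (atlas H) P (\<lambda>h. s (pr' (act' q h))) \<one>\<^bsub>H\<^esub> X"
    using tangent_map_compose[OF Q.smooth_atlas_lie Q.smooth_atlas_total orb _ X', of P "\<lambda>q'. s (pr'
        q')"] Q_section_smooth_at[OF q qW] q1 by simp
  also have "\<dots> = tangent_map (atlas H) P (\<lambda>h. s (pr' q)) \<one>\<^bsub>H\<^esub> X"
    by (rule tangent_map_cong[OF Q.smooth_atlas_lie smooth_map_at_const _ X', symmetric],
        rule Q.one_points, rule s_points[OF qW], rule eventually_at_point_points[OF Q.local_charts_lie])
      (simp add: Q.pr_act q Q.points_lie)
  finally have "section_map s q ?V = (\<lambda>d. 0)" by (simp add: tangent_map_const)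
  then have 1: "twisted_map (\<tau> q)
       (\<omega> (s (pr' q)) (section_map s q ?V)) = (\<lambda>d. 0)"
    using \<omega>_zero[OF s_points[OF qW]] tangent_map_zero[OF P.smooth_atlas_lie twisted_smooth_at[OF
        \<tau>_carrier[OF q qW]]] by simp
  have "tangent_map Q (atlas H) (log_at \<tau> q) q ?V =
    tangent_map (atlas H) (atlas H) (\<lambda>h. inv\<^bsub>H\<^esub> \<tau> q \<otimes>\<^bsub>H\<^esub> \<tau> (act' q h)) \<one>\<^bsub>H\<^esub> X"
    using tangent_map_compose[OF Q.smooth_atlas_lie Q.smooth_atlas_total orb _ X', of "atlas H" "\<lambda>q'.
        inv\<^bsub>H\<^esub> \<tau> q \<otimes>\<^bsub>H\<^esub> \<tau> q'"]
      \<tau>_log_smooth_at[OF q qW] q1 by simp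
  also have "\<dots> = tangent_map (atlas H) (atlas H) (\<lambda>h. h) \<one>\<^bsub>H\<^esub> X"
    by (rule tangent_map_cong[OF Q.smooth_atlas_lie smooth_map_at_ident[OF Q.smooth_atlas_lie
        Q.one_points] _ X', symmetric],
        rule eventually_at_point_points[OF Q.local_charts_lie])
      (use \<tau>_carrier[OF q qW] in \<open>simp add: \<tau>_act[OF q qW] Q.points_lie flip: Q.m_assoc\<close>)
  also have "\<dots> = X" by (rule tangent_map_ident[OF Q.smooth_atlas_lie Q.one_points X'])
  finally show ?thesis unfolding gauge_form_def fundamental_vector_field_def 1 by simp
qed

text \<open>
  The decomposition of \<open>\<omega>\<close> by the frame is carried term by term to the gauge form.
\<close>

lemma gauge_form_related:
  assumes p: "p \<in> points P" and pW: "pr p \<in> W" and u: "u \<in> tangent_space P p"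
  shows "gauge_form s \<tau> (f p) (tangent_map P Q f p u) = lie_algebra_map G H \<phi> (\<omega> p u)"
proof -
  let ?S = "\<lambda>p. s (pr p)"
  let ?X = "\<omega> (s (pr p)) (tangent_map P P ?S p u)"
  let ?Y = "tangent_map P (atlas G) (\<lambda>p'. inv\<^bsub>G\<^esub> \<gamma> p \<otimes>\<^bsub>G\<^esub> \<gamma> p') p u"
  note S = P_section_smooth_at[OF p pW] and fp = f_points[OF p] and fs = f_smooth_at[OF p] and pr_fp =
      pr_f[OF p]
    and \<gamma>p = \<gamma>_carrier[OF p pW]
  have fW: "pr' (f p) \<in> W" using pr_fp pW by simp
  have \<gamma>': "inv\<^bsub>G\<^esub> \<gamma> p \<in> carrier G" using \<gamma>p by simp
  have X: "?X \<in> lie_algebra G"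
    by (rule \<omega>_values[OF s_points[OF pW] tangent_map_in_tangent_space[OF P.smooth_atlas_total
        P.smooth_atlas_total S u]])
  have Y: "?Y \<in> lie_algebra G"
    using tangent_map_in_tangent_space[OF P.smooth_atlas_total P.smooth_atlas_lie \<gamma>_log_smooth_at[OF p
        pW] u] \<gamma>p
    by (simp add: lie_algebra_def)
  have eq: "eventually_at_point P p (\<lambda>p'. act (?S p') (\<gamma> p') = p')"
    by (rule eventually_at_point_mono[OF P.local_charts_total P_eventually[OF p pW]]) (simp add: act_\<gamma>)
  have "\<omega> p u = (\<lambda>d. Ad G (inv\<^bsub>G\<^esub> \<gamma> p) ?X d + ?Y d)"
    by (rule P.connection_decomposition[OF p S \<gamma>_smooth_at[OF p pW] eq u \<omega>_add[OF p] \<omega>_fund[OF _ p]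
        \<omega>_equiv[OF \<gamma>p s_points[OF pW]]])
  moreover have "Ad G (inv\<^bsub>G\<^esub> \<gamma> p) ?X \<in> lie_algebra G"
    using tangent_map_in_tangent_space[OF P.smooth_atlas_lie P.smooth_atlas_lie P.Ad_smooth_at[OF \<gamma>']] X \<gamma>p
    by (simp add: Ad_def lie_algebra_map_def lie_algebra_def)
  ultimately have 0: "lie_algebra_map G H \<phi> (\<omega> p u) =
     (\<lambda>d. lie_algebra_map G H \<phi> (Ad G (inv\<^bsub>G\<^esub> \<gamma> p) ?X) d + lie_algebra_map G H \<phi> ?Y d)"
    using tangent_map_add[OF P.smooth_atlas_lie \<phi>_smooth_at[OF P.one_closed]] Y
    by (simp add: lie_algebra_map_def lie_algebra_def)
  have "section_map s (f p) (tangent_map P Q f p u) = tangent_map P P (\<lambda>p'. s (pr' (f p'))) p u"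
    by (rule tangent_map_compose[OF P.smooth_atlas_total Q.smooth_atlas_total fs
        Q_section_smooth_at[OF fp fW] u, symmetric])
  also have "\<dots> = tangent_map P P ?S p u"
    by (rule tangent_map_cong[OF P.smooth_atlas_total S _ u, symmetric],
        rule eventually_at_point_points[OF P.local_charts_total])
      (simp add: pr_f)
  finally have 1: "twisted_map (\<tau> (f p))
       (\<omega> (s (pr' (f p))) (section_map s (f p) (tangent_map P Q f p u))) =
     lie_algebra_map G H \<phi> (Ad G (inv\<^bsub>G\<^esub> \<gamma> p) ?X)"
    using twisted_\<phi>[OF \<gamma>p X] pr_fp \<tau>_f[OF p pW] by simp
  have \<phi>1: "smooth_map_at (atlas G) (atlas H) \<phi> (inv\<^bsub>G\<^esub> \<gamma> p \<otimes>\<^bsub>G\<^esub> \<gamma> p)" by (rule \<phi>_smooth_at) (simp add: \<gamma>p)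
  have "tangent_map Q (atlas H) (log_at \<tau> (f p)) (f p) (tangent_map P Q f p u) =
    tangent_map P (atlas H) (\<lambda>p'. inv\<^bsub>H\<^esub> \<tau> (f p) \<otimes>\<^bsub>H\<^esub> \<tau> (f p')) p u"
    by (rule tangent_map_compose[OF P.smooth_atlas_total Q.smooth_atlas_total fs \<tau>_log_smooth_at[OF fp
        fW] u, symmetric])
  also have "\<dots> = tangent_map P (atlas H) (\<lambda>p'. \<phi> (inv\<^bsub>G\<^esub> \<gamma> p \<otimes>\<^bsub>G\<^esub> \<gamma> p')) p u"
  proof (rule tangent_map_cong[OF P.smooth_atlas_total smooth_map_at_compose[OF P.local_charts_total
      Q.local_charts_total fs \<tau>_log_smooth_at[OF fp fW]] _ u])
    show "eventually_at_point P p (\<lambda>p'. inv\<^bsub>H\<^esub> \<tau> (f p) \<otimes>\<^bsub>H\<^esub> \<tau> (f p') = \<phi> (inv\<^bsub>G\<^esub> \<gamma> p \<otimes>\<^bsub>G\<^esub> \<gamma> p'))"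
      by (rule eventually_at_point_mono[OF P.local_charts_total P_eventually[OF p pW]])
        (simp add: \<tau>_f \<gamma>_carrier p pW)
  qed
  also have "\<dots> = lie_algebra_map G H \<phi> ?Y"
    using tangent_map_compose[OF P.smooth_atlas_total P.smooth_atlas_lie \<gamma>_log_smooth_at[OF p pW] \<phi>1 u] \<gamma>p
    by (simp add: lie_algebra_map_def)
  finally have 2: "tangent_map Q (atlas H) (log_at \<tau> (f p)) (f p) (tangent_map P Q f p u) =
      lie_algebra_map G H \<phi> ?Y" .
  show ?thesis unfolding gauge_form_def 1 2 0 ..
qed

text \<open>
  Coordinate representation of \<open>(q, g) \<mapsto> \<tau>(q)\<^sup>-\<^sup>1 \<phi>(g) \<tau>(q)\<close>; its partial derivative at \<open>g = 1\<close>
  occurs in the gauge form.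
\<close>

lemma twisted_smooth_near:
  assumes q: "q \<in> points Q" and qW: "pr' q \<in> W" and c: "c \<in> charts_at Q q"
    and a: "a \<in> charts_at (atlas G) \<one>\<^bsub>G\<^esub>" and d: "d \<in> charts_at (atlas H) \<one>\<^bsub>H\<^esub>"
  shows "smooth_near (\<lambda>(y, z). coord_rep a d (twisted (\<tau> (chart_inv c y))) z) (snd c q, snd a \<one>\<^bsub>G\<^esub>)"
proof -
  let ?M = "prod_atlas Q (atlas G)"
  let ?F = "\<lambda>z. twisted (\<tau> (fst z)) (snd z)"
  note lc = local_charts_prod_atlas[OF Q.local_charts_total P.local_charts_lie]
  note k = prod_chart_in_charts_at[OF c a]
  have \<tau>f: "smooth_map_at ?M (atlas H) (\<lambda>z. \<tau> (fst z)) (q, \<one>\<^bsub>G\<^esub>)"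
    by (rule smooth_map_at_compose[OF lc Q.local_charts_total smooth_map_at_fst[OF
        Q.smooth_atlas_total P.local_charts_lie q P.one_points]])
      (simp add: \<tau>_smooth_at q qW)
  have \<phi>s: "smooth_map_at ?M (atlas H) (\<lambda>z. \<phi> (snd z)) (q, \<one>\<^bsub>G\<^esub>)"
    by (rule smooth_map_at_compose[OF lc P.local_charts_lie smooth_map_at_snd[OF Q.local_charts_total
        P.smooth_atlas_lie q P.one_points]])
      (simp add: \<phi>_smooth_at)
  have "smooth_map_at ?M (atlas H) ?F (q, \<one>\<^bsub>G\<^esub>)"
    unfolding twisted_def
    by (intro smooth_map_at_mult[OF Q.structure_group lc] smooth_map_at_inv[OF Q.structure_group lc] \<tau>f \<phi>s)
  from smooth_map_atD(2)[OF this k, of d] have "smooth_near (coord_rep (prod_chart c a) d ?F) (snd c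
      q, snd a \<one>\<^bsub>G\<^esub>)"
    using d twisted_one[OF \<tau>_carrier[OF q qW]] by (simp add: prod_chart_def)
  then show ?thesis
    by (rule smooth_near_cong)
      (use eventually_chart_inv_prod_chart[OF Q.local_charts_total P.local_charts_lie c a] in
        \<open>eventually_elim, simp add: coord_rep_def split_beta\<close>)
qed

text \<open>
  Coordinate representation of \<open>(q, q') \<mapsto> \<tau>(q)\<^sup>-\<^sup>1 \<tau>(q')\<close>; its partial derivative at \<open>q' = q\<close>
  occurs in the gauge form.
\<close>

lemma \<tau>_log_smooth_near:
  assumes q: "q \<in> points Q" and qW: "pr' q \<in> W" and c: "c \<in> charts_at Q q"
    and d: "d \<in> charts_at (atlas H) \<one>\<^bsub>H\<^esub>"
  shows "smooth_near (\<lambda>(y, z). coord_rep c d (log_at \<tau> (chart_inv c y)) z) (snd c q, snd c q)"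
proof -
  let ?M = "prod_atlas Q Q"
  let ?F = "\<lambda>z. inv\<^bsub>H\<^esub> \<tau> (fst z) \<otimes>\<^bsub>H\<^esub> \<tau> (snd z)"
  note lc = local_charts_prod_atlas[OF Q.local_charts_total Q.local_charts_total]
  note k = prod_chart_in_charts_at[OF c c]
  have \<tau>1: "smooth_map_at ?M (atlas H) (\<lambda>z. \<tau> (fst z)) (q, q)"
    by (rule smooth_map_at_compose[OF lc Q.local_charts_total smooth_map_at_fst[OF
        Q.smooth_atlas_total Q.local_charts_total q q]])
      (simp add: \<tau>_smooth_at q qW)
  have \<tau>2: "smooth_map_at ?M (atlas H) (\<lambda>z. \<tau> (snd z)) (q, q)"
    by (rule smooth_map_at_compose[OF lc Q.local_charts_total smooth_map_at_snd[OF
        Q.local_charts_total Q.smooth_atlas_total q q]])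
      (simp add: \<tau>_smooth_at q qW)
  have "smooth_map_at ?M (atlas H) ?F (q, q)"
    by (intro smooth_map_at_mult[OF Q.structure_group lc] smooth_map_at_inv[OF Q.structure_group lc] \<tau>1 \<tau>2)
  from smooth_map_atD(2)[OF this k, of d] have "smooth_near (coord_rep (prod_chart c c) d ?F) (snd c
      q, snd c q)"
    using d \<tau>_carrier[OF q qW] by (simp add: prod_chart_def)
  then show ?thesis
    by (rule smooth_near_cong)
      (use eventually_chart_inv_prod_chart[OF Q.local_charts_total Q.local_charts_total c c] in
        \<open>eventually_elim, simp add: coord_rep_def split_beta\<close>)
qed

lemma gauge_form_smooth:
  assumes q0: "q0 \<in> points Q" and q0W: "pr' q0 \<in> W" and c: "c \<in> charts_at Q q0"
    and d: "d \<in> charts_at (atlas H) \<one>\<^bsub>H\<^esub>"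
  shows "\<exists>A :: 'eq \<Rightarrow> 'eq \<Rightarrow>\<^sub>L 'eh. smooth_near A (snd c q0) \<and>
    (\<forall>\<^sub>F y in nhds (snd c q0). \<forall>v\<in>tangent_space Q (chart_inv c y).
       gauge_form s \<tau> (chart_inv c y) v d = blinfun_apply (A y) (v c))"
proof -
  let ?S = "\<lambda>q. s (pr' q)"
  let ?y0 = "snd c q0"
  note lcQ = Q.local_charts_total and lcP = P.local_charts_total
  note S0 = Q_section_smooth_at[OF q0 q0W]
  obtain e where e: "e \<in> charts_at P (?S q0)" using charts_at_nonempty[OF s_points[OF q0W]] by blast
  obtain a where a: "a \<in> charts_at (atlas G) \<one>\<^bsub>G\<^esub>" using charts_at_nonempty[OF P.one_points] by blast
  obtain A\<omega> :: "'ep \<Rightarrow> 'ep \<Rightarrow>\<^sub>L 'eg" where A\<omega>: "smooth_on (snd e ` fst e) A\<omega>"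
    and \<omega>A: "\<And>p u. p \<in> fst e \<Longrightarrow> u \<in> tangent_space P p \<Longrightarrow> \<omega> p u a = blinfun_apply (A\<omega> (snd e p)) (u e)"
    using form charts_atD(1)[OF e] a unfolding smooth_lie_form_def by meson
  define S' where "S' = coord_rep c e ?S"
  have S': "smooth_near S' ?y0" unfolding S'_def by (rule smooth_map_atD(2)[OF S0 c e])
  have S'0: "S' ?y0 = snd e (?S q0)" unfolding S'_def by (rule coord_rep_at[OF lcQ c])
  have "open (snd e ` fst e)" using lcP charts_atD(1)[OF e] by (simp add: local_charts_def)
  then have A\<omega>': "smooth_near A\<omega> (S' ?y0)"
    unfolding S'0 smooth_near_def using A\<omega> charts_atD(2)[OF e] by blast
  \<comment> \<open>the first summand of the gauge form is a composite of three operators, the second a single one\<close>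
  define K1 where "K1 = (\<lambda>(y, z). coord_rep a d (twisted (\<tau> (chart_inv c y))) z)"
  define K2 where "K2 = (\<lambda>(y, z). coord_rep c d (log_at \<tau> (chart_inv c y)) z)"
  have K1: "smooth_near K1 (?y0, snd a \<one>\<^bsub>G\<^esub>)" unfolding K1_def
      by (rule twisted_smooth_near[OF q0 q0W c a d])
  have K2: "smooth_near K2 (?y0, ?y0)" unfolding K2_def by (rule \<tau>_log_smooth_near[OF q0 q0W c d])
  note p1 = smooth_near_partial_derivative[where z = "\<lambda>y. snd a \<one>\<^bsub>G\<^esub>", OF K1 smooth_near_const]
  note p2 = smooth_near_partial_derivative[where z = "\<lambda>y. y", OF K2 smooth_near_ident]
  define A where "A y = (Blinfun (frechet_derivative (\<lambda>w. K1 (y, w)) (at (snd a \<one>\<^bsub>G\<^esub>))) o\<^sub>L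
      (A\<omega> (S' y) o\<^sub>L Blinfun (frechet_derivative S' (at y)))) +
      Blinfun (frechet_derivative (\<lambda>w. K2 (y, w)) (at y))" for y
  have "smooth_near A ?y0"
    unfolding A_def
    by (intro smooth_near_add smooth_near_bilinear[OF bounded_bilinear_blinfun_compose] p1(2) p2(2)
        smooth_near_compose[OF S' A\<omega>'] smooth_near_derivative S')
  moreover have "\<forall>\<^sub>F y in nhds ?y0. \<forall>v\<in>tangent_space Q (chart_inv c y).
       gauge_form s \<tau> (chart_inv c y) v d = blinfun_apply (A y) (v c)"
  proof -
    have ev: "\<forall>\<^sub>F y in nhds ?y0. chart_inv c y \<in> points Q \<and> pr' (chart_inv c y) \<in> W"
      using Q_eventually[OF q0 q0W] c unfolding eventually_at_point_def by blast
    from ev eventually_chart_image[OF lcQ c] smooth_map_atD(1)[OF S0 c e] p1(1) p2(1)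
        eventually_smooth_near[OF S']
    show ?thesis
    proof eventually_elim
      case (elim y)
      define q where "q = chart_inv c y"
      have q: "q \<in> points Q" and qW: "pr' q \<in> W" using elim(1) by (simp_all add: q_def)
      obtain z where z: "z \<in> fst c" "y = snd c z" using elim(2) by blast
      have qz: "q = z" unfolding q_def z by (rule chart_inv_left[OF lcQ charts_atD(1)[OF c] z(1)])
      have cq: "c \<in> charts_at Q q" and y: "snd c q = y"
        using z charts_atD(1)[OF c] by (simp_all add: qz charts_at_def)
      have eq: "e \<in> charts_at P (?S q)" using elim(3) charts_atD(1)[OF e] by (simp add: charts_at_def q_def)
      note \<tau>q = \<tau>_carrier[OF q qW]
      show ?case
      proof
        fix v assume "v \<in> tangent_space Q (chart_inv c y)"
        then have v: "v \<in> tangent_space Q q" by (simp add: q_def)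
        let ?Sv = "tangent_map Q P ?S q v"
        let ?X = "\<omega> (?S q) ?Sv"
        have X: "?X \<in> tangent_space (atlas G) \<one>\<^bsub>G\<^esub>"
          using base_form_in_lie_algebra[OF q qW v] by (simp add: lie_algebra_def)
        have Sv: "?Sv e = blinfun_apply (Blinfun (frechet_derivative S' (at y))) (v c)"
          using tangent_map_apply[OF Q.smooth_atlas_total Q_section_smooth_at[OF q qW] v cq eq]
              Blinfun_derivative_apply[OF elim(6)]
          by (simp add: S'_def y)
        have "S' y = snd e (?S q)" unfolding S'_def coord_rep_def by (simp add: q_def)
        then have Xa: "?X a = blinfun_apply (A\<omega> (S' y)) (?Sv e)"
          using \<omega>A[OF charts_atD(2)[OF eq] tangent_map_in_tangent_space[OF Q.smooth_atlas_total
              P.smooth_atlas_total Q_section_smooth_at[OF q qW] v]]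
          by simp
        have "d \<in> charts_at (atlas H) (twisted (\<tau> q) \<one>\<^bsub>G\<^esub>)" using d twisted_one[OF \<tau>q] by simp
        from tangent_map_apply[OF P.smooth_atlas_lie twisted_smooth_at[OF \<tau>q] X a this]
        have 1: "twisted_map (\<tau> q) ?X d =
          blinfun_apply (Blinfun (frechet_derivative (\<lambda>w. K1 (y, w)) (at (snd a \<one>\<^bsub>G\<^esub>)))) (?X a)"
          using Blinfun_derivative_apply[OF elim(4)] by (simp add: K1_def q_def)
        have "d \<in> charts_at (atlas H) (inv\<^bsub>H\<^esub> \<tau> q \<otimes>\<^bsub>H\<^esub> \<tau> q)" using d \<tau>q by simp
        from tangent_map_apply[OF Q.smooth_atlas_total \<tau>_log_smooth_at[OF q qW] v cq this]
        have 2: "tangent_map Q (atlas H) (log_at \<tau> q) q v d =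
          blinfun_apply (Blinfun (frechet_derivative (\<lambda>w. K2 (y, w)) (at y))) (v c)"
          using Blinfun_derivative_apply[OF elim(5)] by (simp add: K2_def y) (simp add: q_def)
        have "gauge_form s \<tau> q v d = blinfun_apply (A y) (v c)"
          unfolding gauge_form_def A_def 1 2 Xa Sv by (simp add: blinfun.add_left)
        then show "gauge_form s \<tau> (chart_inv c y) v d = blinfun_apply (A y) (v c)" by (simp add: q_def)
      qed
    qed
  qed
  ultimately show ?thesis by blast
qed

end

section \<open>Existence and uniqueness of the related connection\<close>

context connection_transfer
begin

lemma related_connection_eq_gauge_form:
  assumes \<theta>: "connection_form Q H act' \<theta>" and rel: "related_connections P G Q H f \<phi> \<omega> \<theta>"
    and frame: "frame W s \<gamma> \<tau>" and q: "q \<in> points Q" "pr' q \<in> W" and v: "v \<in> tangent_space Q q"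
  shows "\<theta> q v = gauge_form s \<tau> q v"
proof -
  interpret connection_transfer_frame P G B pr act Q H pr' act' f \<phi> \<omega> W s \<gamma> \<tau>
    by unfold_locales (rule frame)
  have form: "smooth_lie_form Q H \<theta>" using \<theta> unfolding connection_form_def by blast
  show ?thesis
    by (rule gauge_form_unique[OF q v Q.smooth_lie_form_add[OF form q(1)] _ _ rel])
      (use \<theta> q in \<open>unfold connection_form_def, blast+\<close>)
qed

theorem ex1_related_connection:
  "\<exists>!\<theta>. connection_form Q H act' \<theta> \<and> related_connections P G Q H f \<phi> \<omega> \<theta>"
proof -
  have "\<forall>b\<in>points B. \<exists>W s \<gamma> \<tau>. b \<in> W \<and> frame W s \<gamma> \<tau>" using frame_exists by blast
  then obtain W s \<gamma> \<tau> where bW: "\<And>b. b \<in> points B \<Longrightarrow> b \<in> W b"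
    and frame: "\<And>b. b \<in> points B \<Longrightarrow> frame (W b) (s b) (\<gamma> b) (\<tau> b)"
    by metis
  \<comment> \<open>over each point of the base its own frame is used\<close>
  define \<theta> where "\<theta> = (\<lambda>q\<in>points Q. \<lambda>v\<in>tangent_space Q q. gauge_form (s (pr' q)) (\<tau> (pr' q)) q v)"
  have \<theta>: "\<theta> q v = gauge_form (s (pr' q)) (\<tau> (pr' q)) q v" if "q \<in> points Q" "v \<in> tangent_space Q q" for q v
    using that by (simp add: \<theta>_def)
  have loc: "connection_transfer_frame P G B pr act Q H pr' act' f \<phi> \<omega> (W b) (s b) (\<gamma> b) (\<tau> b)"
    if "b \<in> points B" for b
    by unfold_locales (rule frame[OF that])
  note locQ = loc[OF Q.pr_points] and WQ = bW[OF Q.pr_points]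
  have add: "\<theta> q (\<lambda>c. u c + v c) = (\<lambda>d. \<theta> q u d + \<theta> q v d)"
    if q: "q \<in> points Q" and u: "u \<in> tangent_space Q q" and v: "v \<in> tangent_space Q q" for q u v
    unfolding \<theta>[OF q u] \<theta>[OF q v] \<theta>[OF q tangent_space_add[OF Q.smooth_atlas_total q u v]]
    by (rule connection_transfer_frame.gauge_form_add[OF locQ[OF q] q WQ[OF q] u v])
  have vals: "\<theta> q v \<in> lie_algebra H" if q: "q \<in> points Q" and v: "v \<in> tangent_space Q q" for q v
    unfolding \<theta>[OF q v]
    by (rule connection_transfer_frame.gauge_form_in_lie_algebra[OF locQ[OF q] q WQ[OF q] v])
  have fund: "\<theta> q (fundamental_vector_field Q H act' X q) = X" if q: "q \<in> points Q"
      and X: "X \<in> lie_algebra H" for q X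
  proof -
    have "fundamental_vector_field Q H act' X q \<in> tangent_space Q q"
      using tangent_map_in_tangent_space[OF Q.smooth_atlas_lie Q.smooth_atlas_total
          Q.smooth_at_orbit[OF q Q.one_closed], of X] X Q.act_one[OF q]
      by (simp add: fundamental_vector_field_def lie_algebra_def)
    then show ?thesis
      using \<theta>[OF q] connection_transfer_frame.gauge_form_fund[OF locQ[OF q] q WQ[OF q] X] by simp
  qed
  have equiv: "\<theta> (act' q h) (tangent_map Q Q (\<lambda>q. act' q h) q v) = Ad H (inv\<^bsub>H\<^esub> h) (\<theta> q v)"
    if h: "h \<in> carrier H" and q: "q \<in> points Q" and v: "v \<in> tangent_space Q q" for q h v
  proof -
    have "tangent_map Q Q (\<lambda>q. act' q h) q v \<in> tangent_space Q (act' q h)"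
      by (rule tangent_map_in_tangent_space[OF Q.smooth_atlas_total Q.smooth_atlas_total
          Q.smooth_at_translation[OF q h] v])
    then show ?thesis
      using \<theta>[OF q v] \<theta>[OF Q.act_points[OF q h]] Q.pr_act[OF q h]
        connection_transfer_frame.gauge_form_equiv[OF locQ[OF q] q WQ[OF q] v h] by simp
  qed
  have rel: "related_connections P G Q H f \<phi> \<omega> \<theta>"
    unfolding related_connections_def
  proof (intro ballI)
    fix p u assume p: "p \<in> points P" and u: "u \<in> tangent_space P p"
    have "tangent_map P Q f p u \<in> tangent_space Q (f p)"
      by (rule tangent_map_in_tangent_space[OF P.smooth_atlas_total Q.smooth_atlas_total
          f_smooth_at[OF p] u])
    then show "\<theta> (f p) (tangent_map P Q f p u) = lie_algebra_map G H \<phi> (\<omega> p u)"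
      using \<theta>[OF f_points[OF p]] pr_f[OF p]
        connection_transfer_frame.gauge_form_related[OF loc[OF P.pr_points[OF p]] p bW[OF
            P.pr_points[OF p]] u] by simp
  qed
  \<comment> \<open>by uniqueness \<open>\<theta>\<close> agrees with the gauge form of any frame near \<open>q\<close>\<close>
  have gauge: "\<theta> q v = gauge_form (s b) (\<tau> b) q v"
    if b: "b \<in> points B" and q: "q \<in> points Q" and qW: "pr' q \<in> W b" and v: "v \<in> tangent_space Q q"
        for b q v
    by (rule connection_transfer_frame.gauge_form_unique[OF loc[OF b] q qW v add[OF q] fund[OF q]
        equiv rel])
  have smooth: "smooth_lie_form Q H \<theta>"
    unfolding smooth_lie_form_def
  proof (intro conjI ballI)
    show "\<theta> \<in> (\<Pi>\<^sub>E q\<in>points Q. tangent_space Q q \<rightarrow>\<^sub>E lie_algebra H)"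
      using vals by (auto simp: \<theta>_def PiE_iff)
    fix c d assume c: "c \<in> Q" and d: "d \<in> charts_at (atlas H) \<one>\<^bsub>H\<^esub>"
    \<comment> \<open>the coordinate expression of \<open>\<theta>\<close>, chosen pointwise\<close>
    define A :: "'eq \<Rightarrow> 'eq \<Rightarrow>\<^sub>L 'eh" where
      "A y = (SOME a. \<forall>v\<in>tangent_space Q (chart_inv c y). \<theta> (chart_inv c y) v d =
          blinfun_apply a (v c))" for y
    have A: "smooth_near A (snd c q) \<and> (\<forall>v\<in>tangent_space Q q. \<theta> q v d = blinfun_apply (A (snd c q)) (v c))"
      if qc: "q \<in> fst c" for q
    proof -
      have cq: "c \<in> charts_at Q q" using c qc by (simp add: charts_at_def)
      have q: "q \<in> points Q" by (rule charts_at_points[OF cq])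
      note b = Q.pr_points[OF q] and qW = WQ[OF q]
      interpret F: connection_transfer_frame P G B pr act Q H pr' act' f \<phi> \<omega> "W (pr' q)" "s (pr' q)"
          "\<gamma> (pr' q)" "\<tau> (pr' q)"
        by (rule loc[OF b])
      obtain A' :: "'eq \<Rightarrow> 'eq \<Rightarrow>\<^sub>L 'eh" where A': "smooth_near A' (snd c q)"
        and ev: "\<forall>\<^sub>F y in nhds (snd c q). \<forall>v\<in>tangent_space Q (chart_inv c y).
            gauge_form (s (pr' q)) (\<tau> (pr' q)) (chart_inv c y) v d = blinfun_apply (A' y) (v c)"
        using F.gauge_form_smooth[OF q qW cq d] by blast
      have "\<forall>\<^sub>F y in nhds (snd c q). chart_inv c y \<in> points Q \<and> pr' (chart_inv c y) \<in> W (pr' q)"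
        using F.Q_eventually[OF q qW] cq unfolding eventually_at_point_def by blast
      with ev eventually_chart_image[OF Q.local_charts_total cq]
      have ev': "\<forall>\<^sub>F y in nhds (snd c q). A' y = A y \<and>
          (\<forall>v\<in>tangent_space Q (chart_inv c y). \<theta> (chart_inv c y) v d = blinfun_apply (A y) (v c))"
      proof eventually_elim
        case (elim y)
        let ?q = "chart_inv c y"
        have eq: "\<forall>v\<in>tangent_space Q ?q. \<theta> ?q v d = blinfun_apply (A' y) (v c)"
          using elim(1,3) gauge[OF b] by simp
        then have eq': "\<forall>v\<in>tangent_space Q ?q. \<theta> ?q v d = blinfun_apply (A y) (v c)"
          unfolding A_def by (rule someI)
        have "?q \<in> fst c" using elim(2) chart_inv_left[OF Q.local_charts_total c] by auto
        then have cy: "c \<in> charts_at Q ?q" using c by (simp add: charts_at_def)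
        \<comment> \<open>the operator is unique because every vector is the coordinate of a tangent vector\<close>
        have "A' y = A y"
        proof (rule blinfun_eqI)
          fix w
          obtain v where "v \<in> tangent_space Q ?q" "v c = w"
              using tangent_vector_exists[OF Q.smooth_atlas_total cy] by blast
          then show "blinfun_apply (A' y) w = blinfun_apply (A y) w" using eq eq' by force
        qed
        with eq' show ?case by blast
      qed
      from ev' have "\<forall>\<^sub>F y in nhds (snd c q). A' y = A y" by eventually_elim simp
      then have "smooth_near A (snd c q)" by (rule smooth_near_cong[OF A'])
      then show ?thesis
        using eventually_nhds_x_imp_x[OF ev'] chart_inv_at[OF Q.local_charts_total cq] by simp
    qed
    have "open (snd c ` fst c)" using Q.local_charts_total c by (simp add: local_charts_def)
    then have "smooth_on (snd c ` fst c) A" using smooth_on_iff_smooth_near A by blast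
    then show "\<exists>A :: 'eq \<Rightarrow> 'eq \<Rightarrow>\<^sub>L 'eh. smooth_on (snd c ` fst c) A \<and>
        (\<forall>q\<in>fst c. \<forall>v\<in>tangent_space Q q. \<theta> q v d = blinfun_apply (A (snd c q)) (v c))"
      using A by blast
  qed
  show ?thesis
  proof (rule ex1I[of _ \<theta>])
    show "connection_form Q H act' \<theta> \<and> related_connections P G Q H f \<phi> \<omega> \<theta>"
      unfolding connection_form_def using smooth fund equiv rel by blast
  next
    fix \<eta> assume \<eta>: "connection_form Q H act' \<eta> \<and> related_connections P G Q H f \<phi> \<omega> \<eta>"
    then have PE: "\<eta> \<in> (\<Pi>\<^sub>E q\<in>points Q. tangent_space Q q \<rightarrow>\<^sub>E lie_algebra H)"
      "\<theta> \<in> (\<Pi>\<^sub>E q\<in>points Q. tangent_space Q q \<rightarrow>\<^sub>E lie_algebra H)"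
      using smooth unfolding connection_form_def smooth_lie_form_def by simp_all
    show "\<eta> = \<theta>"
    proof (rule PiE_ext[OF PE])
      fix q assume q: "q \<in> points Q"
      show "\<eta> q = \<theta> q"
      proof (rule PiE_ext[OF PiE_mem[OF PE(1) q] PiE_mem[OF PE(2) q]])
        fix v assume v: "v \<in> tangent_space Q q"
        show "\<eta> q v = \<theta> q v"
          unfolding \<theta>[OF q v]
          by (rule related_connection_eq_gauge_form[OF _ _ frame[OF Q.pr_points[OF q]] q WQ[OF q] v])
              (use \<eta> in auto)
      qed
    qed
  qed
qed

end

theorem theorem4p6:
  fixes P :: "('p, 'ep::banach) atlas" and G :: "('g, 'eg::banach) lie_group"
    and Q :: "('q, 'eq::banach) atlas" and H :: "('h, 'eh::banach) lie_group"
    and B :: "('b, 'eb::banach) atlas"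
    and pr :: "'p \<Rightarrow> 'b" and pr' :: "'q \<Rightarrow> 'b"
    and act :: "'p \<Rightarrow> 'g \<Rightarrow> 'p" and act' :: "'q \<Rightarrow> 'h \<Rightarrow> 'q"
    and f :: "'p \<Rightarrow> 'q" and \<phi> :: "'g \<Rightarrow> 'h"
    and \<omega> :: "('p, 'ep, 'g, 'eg) lie_form"
  assumes "principal_bundle P G B pr act"
    and "principal_bundle Q H B pr' act'"
    and "principal_bundle_morphism P G pr act Q H pr' act' f \<phi>"
    and "connection_form P G act \<omega>"
  shows "\<exists>!\<theta> :: ('q, 'eq, 'h, 'eh) lie_form.
           connection_form Q H act' \<theta> \<and> related_connections P G Q H f \<phi> \<omega> \<theta>"
proof -
  interpret connection_transfer P G B pr act Q H pr' act' f \<phi> \<omega>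
    using assms by unfold_locales
  show ?thesis by (rule ex1_related_connection)
qed

end
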